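(* Let $X$ be a connected compact Hausdorff space with $\mathrm{H}^n(X,A)=0$ for all $n>0$ and all finite abelian groups $A$. Let $G$ be a profinite group acting continuously and freely on $X$. Then $G$ is torsion-free.
   Context: $\mathrm{H}^n(X,A)$ denotes sheaf cohomology of $X$ with coefficients in the constant sheaf associated with $A$. Torsion-free means that $G$ has no non-trivial element of finite order. *)

theory Defs
  imports "HOL-Analysis.Analysis" "HOL-Algebra.Group_Action"
    "HOL-Algebra.Product_Groups" "HOL-Algebra.Elementary_Groups"
begin

section \<open>Sheaves of abelian groups\<close>

text \<open>
  Abelian groups are written multiplicatively, as commutative groups of HOL-Algebra.
  Only the values of a presheaf at open sets, and of its maps at elements of the carriers, matter.
\<close>

record ('x, 'v) presheaf_data =
  sections :: "'x set \<Rightarrow> 'v monoid"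
  restr :: "'x set \<Rightarrow> 'x set \<Rightarrow> 'v \<Rightarrow> 'v"  \<comment> \<open>\<open>restr F U V\<close> restricts from \<open>U\<close> to \<open>V\<close>\<close>

locale ab_presheaf =
  fixes X :: "'x topology" and F :: "('x, 'v) presheaf_data"
  assumes comm_group_sections: "openin X U \<Longrightarrow> comm_group (sections F U)"
    and restr_hom: "\<lbrakk>openin X U; openin X V; V \<subseteq> U\<rbrakk>
      \<Longrightarrow> restr F U V \<in> hom (sections F U) (sections F V)"
    and restr_id: "\<lbrakk>openin X U; s \<in> carrier (sections F U)\<rbrakk> \<Longrightarrow> restr F U U s = s"
    and restr_trans: "\<lbrakk>openin X U; openin X V; openin X W; W \<subseteq> V; V \<subseteq> U;
        s \<in> carrier (sections F U)\<rbrakk>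
      \<Longrightarrow> restr F V W (restr F U V s) = restr F U W s"

locale ab_sheaf = ab_presheaf +
  assumes glue: "\<lbrakk>\<And>U. U \<in> \<U> \<Longrightarrow> openin X U;
      \<And>U. U \<in> \<U> \<Longrightarrow> t U \<in> carrier (sections F U);
      \<And>U V. \<lbrakk>U \<in> \<U>; V \<in> \<U>\<rbrakk> \<Longrightarrow> restr F U (U \<inter> V) (t U) = restr F V (U \<inter> V) (t V)\<rbrakk>
    \<Longrightarrow> \<exists>!s. s \<in> carrier (sections F (\<Union>\<U>)) \<and> (\<forall>U\<in>\<U>. restr F (\<Union>\<U>) U s = t U)"

definition sheaf_hom ::
  "'x topology \<Rightarrow> ('x, 'v) presheaf_data \<Rightarrow> ('x, 'w) presheaf_data \<Rightarrow> ('x set \<Rightarrow> 'v \<Rightarrow> 'w) set"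
  where "sheaf_hom X F G =
    {\<phi>. (\<forall>U. openin X U \<longrightarrow> \<phi> U \<in> hom (sections F U) (sections G U)) \<and>
        (\<forall>U V s. openin X U \<and> openin X V \<and> V \<subseteq> U \<and> s \<in> carrier (sections F U)
           \<longrightarrow> \<phi> V (restr F U V s) = restr G U V (\<phi> U s))}"

definition sheaf_mono ::
  "'x topology \<Rightarrow> ('x, 'v) presheaf_data \<Rightarrow> ('x, 'w) presheaf_data \<Rightarrow> ('x set \<Rightarrow> 'v \<Rightarrow> 'w) set"
  where "sheaf_mono X F G =
    {\<phi> \<in> sheaf_hom X F G. \<forall>U. openin X U \<longrightarrow> inj_on (\<phi> U) (carrier (sections F U))}"

text \<open>
  Exactness of \<open>F \<rightarrow> G \<rightarrow> H\<close> as sheaves: the kernel of \<open>\<psi>\<close> consists of the sections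
  that lie locally in the image of \<open>\<phi>\<close>.
\<close>

definition sheaf_exact ::
  "'x topology \<Rightarrow> ('x, 'u) presheaf_data \<Rightarrow> ('x set \<Rightarrow> 'u \<Rightarrow> 'v) \<Rightarrow> ('x, 'v) presheaf_data
    \<Rightarrow> ('x set \<Rightarrow> 'v \<Rightarrow> 'w) \<Rightarrow> ('x, 'w) presheaf_data \<Rightarrow> bool"
  where "sheaf_exact X F \<phi> G \<psi> H \<longleftrightarrow>
    (\<forall>U s. openin X U \<and> s \<in> carrier (sections G U) \<longrightarrow>
       (\<psi> U s = \<one>\<^bsub>sections H U\<^esub> \<longleftrightarrow>
        (\<forall>x\<in>U. \<exists>V t. openin X V \<and> x \<in> V \<and> V \<subseteq> U \<and> t \<in> carrier (sections F V)
           \<and> \<phi> V t = restr G U V s)))"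

text \<open>
  The constant sheaf associated with \<open>A\<close>: sections over \<open>U\<close> are the continuous (that is, locally
  constant) maps from \<open>U\<close> to the discrete space \<open>A\<close>, with pointwise operations.
\<close>

definition constant_sheaf :: "'x topology \<Rightarrow> 'a monoid \<Rightarrow> ('x, 'x \<Rightarrow> 'a) presheaf_data"
  where "constant_sheaf X A = \<lparr>
    sections = (\<lambda>U. (product_group U (\<lambda>_. A))\<lparr>carrier :=
      {s \<in> carrier (product_group U (\<lambda>_. A)).
        continuous_map (subtopology X U) (discrete_topology (carrier A)) s}\<rparr>),
    restr = (\<lambda>U V s. restrict s V)\<rparr>"

section \<open>Sheaf cohomology as derived functor of global sections\<close>

definition injective_sheaf :: "'x topology \<Rightarrow> ('x, 'v) presheaf_data \<Rightarrow> bool"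
  where "injective_sheaf X I \<longleftrightarrow> ab_sheaf X I \<and>
    (\<forall>(F :: ('x, 'v) presheaf_data) (G :: ('x, 'v) presheaf_data) i f.
       ab_sheaf X F \<and> ab_sheaf X G \<and> i \<in> sheaf_mono X F G \<and> f \<in> sheaf_hom X F I \<longrightarrow>
       (\<exists>g \<in> sheaf_hom X G I. \<forall>U s. openin X U \<and> s \<in> carrier (sections F U)
          \<longrightarrow> g U (i U s) = f U s))"

text \<open>\<open>0 \<rightarrow> F \<rightarrow> I 0 \<rightarrow> I 1 \<rightarrow> \<dots>\<close> with augmentation \<open>\<epsilon>\<close> and differentials \<open>d n : I n \<rightarrow> I (n + 1)\<close>\<close>

definition injective_resolution ::
  "'x topology \<Rightarrow> ('x, 'u) presheaf_data \<Rightarrow> ('x set \<Rightarrow> 'u \<Rightarrow> 'v) \<Rightarrow> (nat \<Rightarrow> ('x, 'v) presheaf_data)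
    \<Rightarrow> (nat \<Rightarrow> 'x set \<Rightarrow> 'v \<Rightarrow> 'v) \<Rightarrow> bool"
  where "injective_resolution X F \<epsilon> I d \<longleftrightarrow>
    (\<forall>n. injective_sheaf X (I n)) \<and>
    (\<forall>n. d n \<in> sheaf_hom X (I n) (I (Suc n))) \<and>
    \<epsilon> \<in> sheaf_mono X F (I 0) \<and>
    sheaf_exact X F \<epsilon> (I 0) (d 0) (I 1) \<and>
    (\<forall>n. sheaf_exact X (I n) (d n) (I (Suc n)) (d (Suc n)) (I (Suc (Suc n))))"

definition global_sections :: "'x topology \<Rightarrow> ('x, 'v) presheaf_data \<Rightarrow> 'v monoid"
  where "global_sections X F = sections F (topspace X)"

definition cocycles ::
  "'x topology \<Rightarrow> (nat \<Rightarrow> ('x, 'v) presheaf_data) \<Rightarrow> (nat \<Rightarrow> 'x set \<Rightarrow> 'v \<Rightarrow> 'v) \<Rightarrow> nat \<Rightarrow> 'v set"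
  where "cocycles X I d n =
    kernel (global_sections X (I n)) (global_sections X (I (Suc n))) (d n (topspace X))"

definition coboundaries ::
  "'x topology \<Rightarrow> (nat \<Rightarrow> ('x, 'v) presheaf_data) \<Rightarrow> (nat \<Rightarrow> 'x set \<Rightarrow> 'v \<Rightarrow> 'v) \<Rightarrow> nat \<Rightarrow> 'v set"
  where "coboundaries X I d n = (case n of
      0 \<Rightarrow> {\<one>\<^bsub>global_sections X (I 0)\<^esub>}
    | Suc m \<Rightarrow> d m (topspace X) ` carrier (global_sections X (I m)))"

definition complex_cohomology ::
  "'x topology \<Rightarrow> (nat \<Rightarrow> ('x, 'v) presheaf_data) \<Rightarrow> (nat \<Rightarrow> 'x set \<Rightarrow> 'v \<Rightarrow> 'v) \<Rightarrow> nat
    \<Rightarrow> 'v set monoid"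
  where "complex_cohomology X I d n =
    (global_sections X (I n))\<lparr>carrier := cocycles X I d n\<rparr> Mod coboundaries X I d n"

text \<open>
  \<open>is_sheaf_cohomology X F n H\<close> says that the group \<open>H\<close> is (up to isomorphism) the \<open>n\<close>-th
  cohomology group of \<open>X\<close> with coefficients in \<open>F\<close>; by the usual comparison of injective
  resolutions it does not matter which resolution is used.

  HOL cannot quantify over all types inside a formula, so the sheaves in a resolution, and the
  sheaves against which injectivity is tested, take values in the fixed type \<^typ>\<open>'x list \<Rightarrow> nat\<close>
  of cardinality \<open>\<kappa> = 2 ^ max(|'x|, \<aleph>\<^sub>0)\<close>.  This loses nothing.  The sheaves \<open>\<int>\<^sub>U\<close>
  (for \<open>U\<close> open) and their subsheaves have at most \<open>\<kappa>\<close> sections, so by Baer's criterion the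
  injectivity below is injectivity in the category of all sheaves of abelian groups on \<open>X\<close>.
  And if \<open>F\<close> has at most \<open>\<kappa>\<close> sections, then so do all terms of the usual injective resolution, made
  of products over the points of \<open>X\<close> of skyscraper sheaves of divisible hulls of stalks, because
  \<open>\<kappa> ^ |'x| = \<kappa>\<close>; so \<open>F\<close> has a resolution of the required kind.
\<close>

definition is_sheaf_cohomology ::
  "'x topology \<Rightarrow> ('x, 'u) presheaf_data \<Rightarrow> nat \<Rightarrow> 'h monoid \<Rightarrow> bool"
  where "is_sheaf_cohomology X F n H \<longleftrightarrow>
    (\<exists>\<epsilon> (I :: nat \<Rightarrow> ('x, 'x list \<Rightarrow> nat) presheaf_data) d.
       injective_resolution X F \<epsilon> I d \<and> complex_cohomology X I d n \<cong> H)"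

section \<open>Profinite groups and their actions\<close>

definition topological_group :: "'g monoid \<Rightarrow> 'g topology \<Rightarrow> bool"
  where "topological_group G T \<longleftrightarrow> group G \<and> topspace T = carrier G \<and>
    continuous_map (prod_topology T T) T (\<lambda>(g, h). g \<otimes>\<^bsub>G\<^esub> h) \<and>
    continuous_map T T (\<lambda>g. inv\<^bsub>G\<^esub> g)"

definition totally_disconnected_space :: "'a topology \<Rightarrow> bool"
  where "totally_disconnected_space T \<longleftrightarrow> (\<forall>S. connectedin T S \<longrightarrow> (\<exists>a. S \<subseteq> {a}))"

definition profinite_group :: "'g monoid \<Rightarrow> 'g topology \<Rightarrow> bool"
  where "profinite_group G T \<longleftrightarrow> topological_group G T \<and>
    compact_space T \<and> Hausdorff_space T \<and> totally_disconnected_space T"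

definition continuous_action ::
  "'g monoid \<Rightarrow> 'g topology \<Rightarrow> 'x topology \<Rightarrow> ('g \<Rightarrow> 'x \<Rightarrow> 'x) \<Rightarrow> bool"
  where "continuous_action G T X \<phi> \<longleftrightarrow> group_action G (topspace X) \<phi> \<and>
    continuous_map (prod_topology T X) X (\<lambda>(g, x). \<phi> g x)"

definition free_action :: "'g monoid \<Rightarrow> 'x set \<Rightarrow> ('g \<Rightarrow> 'x \<Rightarrow> 'x) \<Rightarrow> bool"
  where "free_action G E \<phi> \<longleftrightarrow> (\<forall>g\<in>carrier G. \<forall>x\<in>E. \<phi> g x = x \<longrightarrow> g = \<one>\<^bsub>G\<^esub>)"

definition torsion_free_group :: "'g monoid \<Rightarrow> bool"
  where "torsion_free_group G \<longleftrightarrow>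
    (\<forall>g\<in>carrier G. (\<exists>n::nat. n > 0 \<and> g [^]\<^bsub>G\<^esub> n = \<one>\<^bsub>G\<^esub>) \<longrightarrow> g = \<one>\<^bsub>G\<^esub>)"

end

(* Let g have finite order p > 1, acting on X by \<theta>. Then Z/p acts freely on X, whose cohomology with
   coefficients in Z/p is trivial, so that X/(Z/p) would have the cohomology ring of the group Z/p,
   in which a class b of degree 2 is not nilpotent. But b vanishes locally, and finitely many open
   sets suffice to cover the compact space X/(Z/p), hence a power of b vanishes.

   The argument is carried out on X, with integer cochains modulo p on tuples of points that are small
   with respect to an open cover. The class is given by an explicit zigzag between b and the constant 1,
   and descending along it from b^m = 0 yields 1 = 0 modulo p; each step uses that a cocycle
   on small tuples is, after refinement, a coboundary.

   That follows from the vanishing of sheaf cohomology by dimension shifting along an injective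
   resolution: the Cech complex of an injective sheaf I is exact for every cover, since I is a retract
   of its sheaf of discontinuous sections, and in a compact Hausdorff space local lifts of Cech
   cochains exist on the members of a refined cover. *)

theory Submission
  imports Defs
begin

text \<open>Cochains are arbitrary functions on tuples of points of X. This suits two needs:
  positions along orbits are recorded by a discontinuous labelling, and the group acts on tuples
  directly, so that no quotient space is formed. That a power of the class bounds on X carries no
  information, since the class itself is a coboundary there. What is kept through the descent is a
  bounding cochain whose orbit sum vanishes modulo \<open>p\<close>; it stands in for a cochain on
  the quotient. Integers rather than residues allow division with remainder by \<open>p\<close> (a
  Bockstein), so that identities and invariance hold exactly and congruences enter only with the
  vanishing of cohomology. The number \<open>p\<close> may be composite: the contradiction is merely
  that it divides 1. The main obstacle is that Cech arguments bound a cocycle only after composition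
  with a refining map of indices, chosen without regard to the action. A prism homotopy removes this
  map, so that each refinement just shrinks the set attached to a point, and a further shrinking
  keeps the translates of small tuples small.\<close>

section \<open>The simplicial coboundary on lists\<close>

text \<open>
  Lists are tuples \<open>(x\<^sub>0, \<dots>, x\<^sub>n)\<close>, and the recursion unfolds to the alternating product of the values
  of \<open>c\<close> at the faces. In degree \<open>0\<close> the face is the empty list: the complex is augmented.
\<close>

fun cobd :: "('v, 'e) monoid_scheme \<Rightarrow> ('x list \<Rightarrow> 'v) \<Rightarrow> 'x list \<Rightarrow> 'v" where
  "cobd M c [] = \<one>\<^bsub>M\<^esub>"
| "cobd M c (x # xs) = c xs \<otimes>\<^bsub>M\<^esub> inv\<^bsub>M\<^esub> (cobd M (\<lambda>ys. c (x # ys)) xs)"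

lemma cobd_cong:
  assumes "\<And>ys. \<lbrakk>set ys \<subseteq> set xs; Suc (length ys) = length xs\<rbrakk> \<Longrightarrow> c ys = c' ys"
  shows "cobd M c xs = cobd M c' xs"
  using assms
proof (induction xs arbitrary: c c')
  case (Cons x xs)
  have "cobd M (\<lambda>ys. c (x # ys)) xs = cobd M (\<lambda>ys. c' (x # ys)) xs"
    by (rule Cons.IH) (rule Cons.prems, auto)
  moreover have "c xs = c' xs" by (rule Cons.prems) auto
  ultimately show ?case by simp
qed simp

lemma (in group) cobd_closed:
  assumes "\<And>ys. \<lbrakk>set ys \<subseteq> set xs; Suc (length ys) = length xs\<rbrakk> \<Longrightarrow> c ys \<in> carrier G"
  shows "cobd G c xs \<in> carrier G"
  using assms
proof (induction xs arbitrary: c)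
  case (Cons x xs)
  have "cobd G (\<lambda>ys. c (x # ys)) xs \<in> carrier G"
    by (rule Cons.IH) (rule Cons.prems, auto)
  moreover have "c xs \<in> carrier G" by (rule Cons.prems) auto
  ultimately show ?case by simp
qed simp

lemma cobd_hom:
  assumes "group M" "group N" "h \<in> hom M N"
    and "\<And>ys. \<lbrakk>set ys \<subseteq> set xs; Suc (length ys) = length xs\<rbrakk> \<Longrightarrow> c ys \<in> carrier M"
  shows "h (cobd M c xs) = cobd N (\<lambda>ys. h (c ys)) xs"
  using assms(4)
proof (induction xs arbitrary: c)
  case Nil
  then show ?case using assms by (simp add: hom_one)
next
  case (Cons x xs)
  interpret h: group_hom M N h
    using assms by (simp add: group_hom_def group_hom_axioms_def)
  have "cobd M (\<lambda>ys. c (x # ys)) xs \<in> carrier M"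
    by (rule h.G.cobd_closed) (rule Cons.prems, auto)
  moreover have "c xs \<in> carrier M" by (rule Cons.prems) auto
  moreover have "h (cobd M (\<lambda>ys. c (x # ys)) xs) = cobd N (\<lambda>ys. h (c (x # ys))) xs"
    by (rule Cons.IH) (rule Cons.prems, auto)
  ultimately show ?case by simp
qed

lemma (in comm_group) cobd_div:
  assumes "\<And>ys. \<lbrakk>set ys \<subseteq> set xs; Suc (length ys) = length xs\<rbrakk> \<Longrightarrow> a ys \<in> carrier G"
    and "\<And>ys. \<lbrakk>set ys \<subseteq> set xs; Suc (length ys) = length xs\<rbrakk> \<Longrightarrow> b ys \<in> carrier G"
  shows "cobd G (\<lambda>ys. a ys \<otimes> inv (b ys)) xs = cobd G a xs \<otimes> inv (cobd G b xs)"
  using assms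
proof (induction xs arbitrary: a b)
  case (Cons x xs)
  have eq: "cobd G (\<lambda>ys. a (x # ys) \<otimes> inv (b (x # ys))) xs =
      cobd G (\<lambda>ys. a (x # ys)) xs \<otimes> inv (cobd G (\<lambda>ys. b (x # ys)) xs)"
    by (rule Cons.IH) (rule Cons.prems, auto)+
  have "a xs \<in> carrier G" "b xs \<in> carrier G"
    "cobd G (\<lambda>ys. a (x # ys)) xs \<in> carrier G" "cobd G (\<lambda>ys. b (x # ys)) xs \<in> carrier G"
    by (auto intro!: Cons.prems cobd_closed)
  then show ?case
    by (simp add: eq inv_mult m_ac)
qed simp

lemma (in comm_group) cobd_cobd:
  assumes "\<And>ys. \<lbrakk>set ys \<subseteq> set xs; Suc (Suc (length ys)) = length xs\<rbrakk> \<Longrightarrow> c ys \<in> carrier G"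
  shows "cobd G (cobd G c) xs = \<one>"
  using assms
proof (induction xs arbitrary: c)
  case (Cons x xs)
  have car: "cobd G c xs \<in> carrier G"
    by (auto intro!: Cons.prems cobd_closed)
  have "cobd G (\<lambda>ys. c ys \<otimes> inv (cobd G (\<lambda>zs. c (x # zs)) ys)) xs =
     cobd G c xs \<otimes> inv (cobd G (cobd G (\<lambda>zs. c (x # zs))) xs)"
  proof (rule cobd_div)
    fix ys assume ys: "set ys \<subseteq> set xs" "Suc (length ys) = length xs"
    then show "c ys \<in> carrier G" by (intro Cons.prems) auto
    show "cobd G (\<lambda>zs. c (x # zs)) ys \<in> carrier G"
      using ys by (intro cobd_closed Cons.prems) (fastforce, simp)
  qed
  also have "cobd G (cobd G (\<lambda>zs. c (x # zs))) xs = \<one>"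
    by (rule Cons.IH) (rule Cons.prems, auto)
  finally show ?case using car by simp
qed simp

section \<open>Integer cochains\<close>

fun cob :: "('x list \<Rightarrow> int) \<Rightarrow> 'x list \<Rightarrow> int" where
  "cob f [] = 0"
| "cob f (x # xs) = f xs - cob (\<lambda>ys. f (x # ys)) xs"

text \<open>The bridge from integer cochains to Cech cochains of constant sections, which are images
  of integers under homomorphisms.\<close>

lemma cobd_of_int_hom:
  assumes "group M" "h \<in> hom integer_group M"
  shows "cobd M (\<lambda>ys. h (f ys)) xs = h (cob f xs)"
proof -
  have "cobd integer_group f xs = cob f xs" for xs
    by (induction xs arbitrary: f) auto
  then show ?thesis
    using cobd_hom[OF group_integer_group assms, of xs f] by simp
qed

lemma cob_add: "cob (\<lambda>ys. f ys + g ys) xs = cob f xs + cob g xs"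
  by (induction xs arbitrary: f g) auto

lemma cob_diff: "cob (\<lambda>ys. f ys - g ys) xs = cob f xs - cob g xs"
  by (induction xs arbitrary: f g) auto

lemma cob_const_mult: "cob (\<lambda>ys. k * f ys) xs = k * cob f xs"
  by (induction xs arbitrary: f) (auto simp: algebra_simps)

lemma cob_sum: "cob (\<lambda>ys. \<Sum>i\<in>I. f i ys) xs = (\<Sum>i\<in>I. cob (f i) xs)"
  by (induction xs arbitrary: f) (auto simp: sum_subtractf)

lemma cob_cob [simp]: "cob (cob f) xs = 0"
  by (induction xs arbitrary: f) (auto simp: cob_diff)

lemma cob_map: "cob (\<lambda>ys. f (map h ys)) xs = cob f (map h xs)"
  by (induction xs arbitrary: f) auto

lemma cob_cong:
  assumes "\<And>ys. \<lbrakk>set ys \<subseteq> set xs; Suc (length ys) = length xs\<rbrakk> \<Longrightarrow> f ys = g ys"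
  shows "cob f xs = cob g xs"
  using assms
proof (induction xs arbitrary: f g)
  case (Cons x xs)
  have "cob (\<lambda>ys. f (x # ys)) xs = cob (\<lambda>ys. g (x # ys)) xs"
    by (rule Cons.IH) (rule Cons.prems, auto)
  moreover have "f xs = g xs" by (rule Cons.prems) auto
  ultimately show ?case by simp
qed simp

text \<open>The prism operator: the alternating sum over i of
  \<open>f [x0, ..., xi, t xi, ..., t xn]\<close>.\<close>

fun prism :: "('x \<Rightarrow> 'x) \<Rightarrow> ('x list \<Rightarrow> int) \<Rightarrow> 'x list \<Rightarrow> int" where
  "prism t f [] = 0"
| "prism t f (x # xs) = f (x # map t (x # xs)) - prism t (\<lambda>ys. f (x # ys)) xs"

lemma prism_diff: "prism t (\<lambda>ys. f ys - g ys) xs = prism t f xs - prism t g xs"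
  by (induction xs arbitrary: f g) auto

text \<open>The homotopy formula that later trades \<open>f\<close> composed with an index map for
  \<open>f\<close> itself. In the induction, \<open>cob_map\<close> moves \<open>map t\<close> out
  of the coboundary of the leading summand.\<close>

lemma cob_prism: "cob (prism t f) xs + prism t (cob f) xs = f (map t xs) - f xs"
proof (induction xs arbitrary: f)
  case (Cons x xs)
  have "cob (\<lambda>ys. f (x # t x # map t ys)) xs = cob (\<lambda>zs. f (x # t x # zs)) (map t xs)"
    by (rule cob_map)
  then show ?case
    using Cons.IH[of "\<lambda>ys. f (x # ys)"] by (simp add: cob_diff prism_diff)
qed simp

lemma dvd_prism:
  assumes "\<And>ys. \<lbrakk>set ys \<subseteq> set xs \<union> t ` set xs; length ys = Suc (length xs)\<rbrakk> \<Longrightarrow> p dvd f ys"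
  shows "p dvd prism t f xs"
  using assms
proof (induction xs arbitrary: f)
  case (Cons x xs)
  have "p dvd prism t (\<lambda>ys. f (x # ys)) xs"
    by (rule Cons.IH) (rule Cons.prems, auto)
  moreover have "p dvd f (x # map t (x # xs))" by (rule Cons.prems) auto
  ultimately show ?case by simp
qed simp

text \<open>The Alexander-Whitney product: front and back face share the entry at position
  \<open>n\<close>. Only the degree of the first factor is recorded; that of the second follows from
  the length of the list.\<close>

definition cup :: "nat \<Rightarrow> ('x list \<Rightarrow> int) \<Rightarrow> ('x list \<Rightarrow> int) \<Rightarrow> 'x list \<Rightarrow> int"
  where "cup n f g xs = f (take (Suc n) xs) * g (drop n xs)"

lemma cup_Suc_Cons: "cup (Suc n) f g (x # ys) = cup n (\<lambda>zs. f (x # zs)) g ys"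
  by (simp add: cup_def)

text \<open>The Leibniz rule. The bound on the length excludes the short tuples on which the
  augmentation would enter.\<close>

lemma cob_cup:
  assumes "length xs \<ge> Suc (Suc n)"
  shows "cob (cup n f g) xs = cup (Suc n) (cob f) g xs + (-1) ^ n * cup n f (cob g) xs"
  using assms
proof (induction n arbitrary: xs f)
  case 0
  then obtain x y zs where xs: "xs = x # y # zs"
    by (cases xs; cases "tl xs") auto
  show ?case
    by (simp add: xs cup_def algebra_simps cob_const_mult)
next
  case (Suc n)
  then obtain x ys where xs: "xs = x # ys"
    by (cases xs) auto
  have IH: "cob (cup n (\<lambda>zs. f (x # zs)) g) ys =
     cup (Suc n) (cob (\<lambda>zs. f (x # zs))) g ys + (-1) ^ n * cup n (\<lambda>zs. f (x # zs)) (cob g) ys"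
    using Suc by (simp add: xs)
  show ?case
    by (simp add: xs cup_Suc_Cons IH) (simp add: cup_def algebra_simps)
qed

context ab_presheaf
begin

lemma group_sections: "openin X U \<Longrightarrow> group (sections F U)"
  using comm_group_sections comm_group.axioms(2) by blast

lemma restr_closed:
  "\<lbrakk>openin X U; openin X V; V \<subseteq> U; s \<in> carrier (sections F U)\<rbrakk>
    \<Longrightarrow> restr F U V s \<in> carrier (sections F V)"
  using restr_hom[unfolded hom_def] by blast

lemma restr_mult:
  "\<lbrakk>openin X U; openin X V; V \<subseteq> U; s \<in> carrier (sections F U); t \<in> carrier (sections F U)\<rbrakk>
    \<Longrightarrow> restr F U V (s \<otimes>\<^bsub>sections F U\<^esub> t) = restr F U V s \<otimes>\<^bsub>sections F V\<^esub> restr F U V t"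
  using hom_mult[OF restr_hom] by blast

lemma restr_group_hom:
  "\<lbrakk>openin X U; openin X V; V \<subseteq> U\<rbrakk> \<Longrightarrow> group_hom (sections F U) (sections F V) (restr F U V)"
  by (simp add: group_hom_def group_hom_axioms_def restr_hom group_sections)

lemma restr_one:
  "\<lbrakk>openin X U; openin X V; V \<subseteq> U\<rbrakk> \<Longrightarrow> restr F U V \<one>\<^bsub>sections F U\<^esub> = \<one>\<^bsub>sections F V\<^esub>"
  using restr_group_hom group_hom.hom_one by metis

lemma restr_inv:
  "\<lbrakk>openin X U; openin X V; V \<subseteq> U; s \<in> carrier (sections F U)\<rbrakk>
    \<Longrightarrow> restr F U V (inv\<^bsub>sections F U\<^esub> s) = inv\<^bsub>sections F V\<^esub> (restr F U V s)"
  using restr_group_hom group_hom.hom_inv by metis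

end

section \<open>Stalks and the sheaf of discontinuous sections\<close>

text \<open>A germ is kept as the set of all its representatives, so that equality of germs is
  equality of sets.\<close>

definition germ :: "'x topology \<Rightarrow> ('x, 'v) presheaf_data \<Rightarrow> 'x \<Rightarrow> 'x set \<Rightarrow> 'v \<Rightarrow> ('x set \<times> 'v) set"
  where "germ X F y U s = {(V, t). openin X V \<and> y \<in> V \<and> t \<in> carrier (sections F V) \<and>
    (\<exists>W. openin X W \<and> y \<in> W \<and> W \<subseteq> U \<and> W \<subseteq> V \<and> restr F U W s = restr F V W t)}"

text \<open>The product is a union over all pairs of representatives. Every member of that union is
  one and the same germ, so no representative has to be chosen.\<close>

definition stalk :: "'x topology \<Rightarrow> ('x, 'v) presheaf_data \<Rightarrow> 'x \<Rightarrow> ('x set \<times> 'v) set monoid"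
  where "stalk X F y = \<lparr>
    carrier = {germ X F y U s | U s. openin X U \<and> y \<in> U \<and> s \<in> carrier (sections F U)},
    monoid.mult = (\<lambda>A B. \<Union>(U, s)\<in>A. \<Union>(V, t)\<in>B. germ X F y (U \<inter> V)
      (restr F U (U \<inter> V) s \<otimes>\<^bsub>sections F (U \<inter> V)\<^esub> restr F V (U \<inter> V) t)),
    one = germ X F y (topspace X) \<one>\<^bsub>sections F (topspace X)\<^esub>\<rparr>"

definition godement_sheaf ::
  "'x topology \<Rightarrow> ('x, 'v) presheaf_data \<Rightarrow> ('x, 'x \<Rightarrow> ('x set \<times> 'v) set) presheaf_data"
  where "godement_sheaf X F = \<lparr>
    sections = (\<lambda>U. product_group U (stalk X F)),
    restr = (\<lambda>U V s. restrict s V)\<rparr>"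

definition germs :: "'x topology \<Rightarrow> ('x, 'v) presheaf_data \<Rightarrow> 'x set \<Rightarrow> 'v \<Rightarrow> 'x \<Rightarrow> ('x set \<times> 'v) set"
  where "germs X F U s = (\<lambda>y\<in>U. germ X F y U s)"

context ab_presheaf
begin

lemma germ_eqI:
  assumes "openin X U" "openin X V" "s \<in> carrier (sections F U)" "t \<in> carrier (sections F V)"
    and "openin X W" "y \<in> W" "W \<subseteq> U" "W \<subseteq> V" "restr F U W s = restr F V W t"
  shows "germ X F y U s = germ X F y V t"
proof -
  have *: "germ X F y U s \<subseteq> germ X F y V t"
    if "openin X U" "openin X V" "s \<in> carrier (sections F U)" "t \<in> carrier (sections F V)"
      "W \<subseteq> U" "W \<subseteq> V" "restr F U W s = restr F V W t" for U V s t
  proof clarify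
    fix V' t' assume "(V', t') \<in> germ X F y U s"
    then obtain W' where V': "openin X V'" "y \<in> V'" "t' \<in> carrier (sections F V')"
      and W': "openin X W'" "y \<in> W'" "W' \<subseteq> U" "W' \<subseteq> V'" "restr F U W' s = restr F V' W' t'"
      by (auto simp: germ_def)
    have o: "openin X (W \<inter> W')" using assms W' by blast
    have "restr F V (W \<inter> W') t = restr F W (W \<inter> W') (restr F V W t)"
      using that assms o by (simp add: restr_trans)
    also have "\<dots> = restr F U (W \<inter> W') s"
      unfolding that(7)[symmetric] using that(1-6) assms(5-6) o by (simp add: restr_trans)
    also have "\<dots> = restr F W' (W \<inter> W') (restr F U W' s)"
      using that(1,3) W'(1-4) o by (simp add: restr_trans[of U W'])
    also have "\<dots> = restr F V' (W \<inter> W') t'"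
      unfolding W'(5) using V' W'(1-4) o by (simp add: restr_trans[of V' W'])
    finally show "(V', t') \<in> germ X F y V t"
      using that V' W' o assms by (force simp: germ_def intro!: exI[of _ "W \<inter> W'"])
  qed
  show ?thesis
    using *[of U V s t] *[of V U t s] assms by auto
qed

lemma germ_self: 
  "\<lbrakk>openin X U; y \<in> U; s \<in> carrier (sections F U)\<rbrakk> \<Longrightarrow> (U, s) \<in> germ X F y U s"
  by (auto simp: germ_def)

lemma germ_eqD:
  assumes "germ X F y U s = germ X F y V t" "openin X V" "y \<in> V" "t \<in> carrier (sections F V)"
  shows "\<exists>W. openin X W \<and> y \<in> W \<and> W \<subseteq> U \<and> W \<subseteq> V \<and> restr F U W s = restr F V W t"
proof -
  have "(V, t) \<in> germ X F y U s" using germ_self assms by auto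
  then show ?thesis by (auto simp: germ_def)
qed

lemma germ_restr:
  assumes "openin X U" "openin X V" "V \<subseteq> U" "y \<in> V" "s \<in> carrier (sections F U)"
  shows "germ X F y V (restr F U V s) = germ X F y U s"
  by (rule germ_eqI[where W = V]) (use assms in \<open>auto simp: restr_closed restr_id\<close>)

lemma germ_mem:
  assumes "openin X U" "s \<in> carrier (sections F U)" "(V, t) \<in> germ X F y U s"
  shows "openin X V" "y \<in> V" "t \<in> carrier (sections F V)" "germ X F y V t = germ X F y U s"
proof -
  from assms(3) obtain W where W: "openin X V" "y \<in> V" "t \<in> carrier (sections F V)"
      "openin X W" "y \<in> W" "W \<subseteq> U" "W \<subseteq> V" "restr F U W s = restr F V W t"
    by (auto simp: germ_def)
  then show "openin X V" "y \<in> V" "t \<in> carrier (sections F V)" by auto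
  show "germ X F y V t = germ X F y U s"
    by (rule germ_eqI[where W = W]) (use W assms in auto)
qed

lemma germ_closed:
  "\<lbrakk>openin X U; y \<in> U; s \<in> carrier (sections F U)\<rbrakk> \<Longrightarrow> germ X F y U s \<in> carrier (stalk X F y)"
  by (auto simp: stalk_def)

lemma germ_mult:
  assumes "openin X U" "y \<in> U" "s \<in> carrier (sections F U)" "t \<in> carrier (sections F U)"
  shows "germ X F y U s \<otimes>\<^bsub>stalk X F y\<^esub> germ X F y U t = germ X F y U (s \<otimes>\<^bsub>sections F U\<^esub> t)"
proof -
  have eq: "germ X F y (V \<inter> V') (restr F V (V \<inter> V') a \<otimes>\<^bsub>sections F (V \<inter> V')\<^esub> restr F V' (V \<inter> V') b)
      = germ X F y U (s \<otimes>\<^bsub>sections F U\<^esub> t)"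
    if a: "(V, a) \<in> germ X F y U s" and b: "(V', b) \<in> germ X F y U t" for V a V' b
  proof -
    from a obtain W where W: "openin X V" "y \<in> V" "a \<in> carrier (sections F V)"
      "openin X W" "y \<in> W" "W \<subseteq> U" "W \<subseteq> V" "restr F U W s = restr F V W a"
      by (auto simp: germ_def)
    from b obtain W' where W': "openin X V'" "y \<in> V'" "b \<in> carrier (sections F V')"
      "openin X W'" "y \<in> W'" "W' \<subseteq> U" "W' \<subseteq> V'" "restr F U W' t = restr F V' W' b"
      by (auto simp: germ_def)
    define O' where "O' = W \<inter> W'"
    have o: "openin X O'" "O' \<subseteq> W" "O' \<subseteq> W'" "O' \<subseteq> V" "O' \<subseteq> V'" "O' \<subseteq> U" "y \<in> O'" "O' \<subseteq> V \<inter> V'"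
      using W W' by (auto simp: O'_def)
    have oV: "openin X (V \<inter> V')" using W W' by auto
    have e1: "restr F U O' s = restr F V O' a"
      using restr_trans[of U W O' s] restr_trans[of V W O' a] W o assms by simp
    have e2: "restr F U O' t = restr F V' O' b"
      using restr_trans[of U W' O' t] restr_trans[of V' W' O' b] W' o assms by simp
    interpret G: comm_group "sections F U" using comm_group_sections assms by simp
    interpret G': comm_group "sections F (V \<inter> V')" using comm_group_sections oV by simp
    show ?thesis
    proof (rule germ_eqI[where W = O'])
      show "restr F (V \<inter> V') O' (restr F V (V \<inter> V') a \<otimes>\<^bsub>sections F (V \<inter> V')\<^esub> restr F V' (V \<inter> V') b)
        = restr F U O' (s \<otimes>\<^bsub>sections F U\<^esub> t)"
        using assms(1,3,4) W(1,3) W'(1,3) o oV e1 e2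
        by (simp add: restr_mult restr_closed restr_trans[of _ "V \<inter> V'" O'])
    qed (use assms W W' o oV in \<open>auto simp: restr_closed\<close>)
  qed
  have "(U, s) \<in> germ X F y U s" "(U, t) \<in> germ X F y U t"
    using assms by (auto intro: germ_self)
  then show ?thesis
    using eq by (force simp: stalk_def)
qed

lemma germ_one:
  assumes "openin X U" "y \<in> U"
  shows "germ X F y U \<one>\<^bsub>sections F U\<^esub> = \<one>\<^bsub>stalk X F y\<^esub>"
proof -
  have U: "U \<subseteq> topspace X" using assms openin_subset by auto
  then have "restr F (topspace X) U \<one>\<^bsub>sections F (topspace X)\<^esub> = \<one>\<^bsub>sections F U\<^esub>"
    using assms by (simp add: restr_one)
  then show ?thesis
    using germ_restr[of "topspace X" U y "\<one>\<^bsub>sections F (topspace X)\<^esub>"] assms U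
      group.is_monoid[OF group_sections[OF openin_topspace]]
    by (simp add: stalk_def monoid.one_closed)
qed

lemma stalk_common:
  assumes "A \<in> carrier (stalk X F y)" "B \<in> carrier (stalk X F y)"
  obtains U s t where "openin X U" "y \<in> U" "s \<in> carrier (sections F U)" "t \<in> carrier (sections F U)"
    "A = germ X F y U s" "B = germ X F y U t"
proof -
  from assms obtain U s V t where *: "openin X U" "y \<in> U" "s \<in> carrier (sections F U)"
    "openin X V" "y \<in> V" "t \<in> carrier (sections F V)" "A = germ X F y U s" "B = germ X F y V t"
    by (auto simp: stalk_def)
  show ?thesis
    by (rule that[of "U \<inter> V" "restr F U (U \<inter> V) s" "restr F V (U \<inter> V) t"])
      (use * in \<open>simp_all add: restr_closed germ_restr openin_Int\<close>)
qed

lemma comm_group_stalk: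
  assumes y: "y \<in> topspace X"
  shows "comm_group (stalk X F y)"
proof (rule comm_groupI)
  show "\<one>\<^bsub>stalk X F y\<^esub> \<in> carrier (stalk X F y)"
    unfolding germ_one[OF openin_topspace y, symmetric]
    by (rule germ_closed)
      (use y group.is_monoid[OF group_sections[OF openin_topspace]] in \<open>auto simp: monoid.one_closed\<close>)
next
  fix A B assume "A \<in> carrier (stalk X F y)" "B \<in> carrier (stalk X F y)"
  then obtain U s t where *: "openin X U" "y \<in> U" "s \<in> carrier (sections F U)" "t \<in> carrier (sections F U)"
    "A = germ X F y U s" "B = germ X F y U t"
    by (rule stalk_common)
  interpret G: comm_group "sections F U" using * by (simp add: comm_group_sections)
  show "A \<otimes>\<^bsub>stalk X F y\<^esub> B \<in> carrier (stalk X F y)"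
    using * by (simp add: germ_mult germ_closed)
  show "A \<otimes>\<^bsub>stalk X F y\<^esub> B = B \<otimes>\<^bsub>stalk X F y\<^esub> A"
    using * by (simp add: germ_mult G.m_comm)
next
  fix A B C assume A: "A \<in> carrier (stalk X F y)" and "B \<in> carrier (stalk X F y)" "C \<in> carrier (stalk X F y)"
  then obtain V s t where *: "openin X V" "y \<in> V" "s \<in> carrier (sections F V)" "t \<in> carrier (sections F V)"
    "B = germ X F y V s" "C = germ X F y V t"
    using stalk_common by metis
  obtain U r where **: "openin X U" "y \<in> U" "r \<in> carrier (sections F U)" "A = germ X F y U r"
    using A by (auto simp: stalk_def)
  let ?W = "U \<inter> V"
  interpret G: comm_group "sections F ?W" using * ** by (simp add: comm_group_sections openin_Int)
  have "A = germ X F y ?W (restr F U ?W r)" "B = germ X F y ?W (restr F V ?W s)"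
    "C = germ X F y ?W (restr F V ?W t)"
    using * ** by (simp_all add: germ_restr openin_Int)
  moreover have "restr F U ?W r \<in> carrier (sections F ?W)" "restr F V ?W s \<in> carrier (sections F ?W)"
     "restr F V ?W t \<in> carrier (sections F ?W)"
    using * ** by (simp_all add: restr_closed openin_Int)
  ultimately show "A \<otimes>\<^bsub>stalk X F y\<^esub> B \<otimes>\<^bsub>stalk X F y\<^esub> C = A \<otimes>\<^bsub>stalk X F y\<^esub> (B \<otimes>\<^bsub>stalk X F y\<^esub> C)"
    using * ** by (simp add: germ_mult openin_Int G.m_assoc)
next
  fix A assume "A \<in> carrier (stalk X F y)"
  then obtain U s where *: "openin X U" "y \<in> U" "s \<in> carrier (sections F U)" "A = germ X F y U s"
    by (auto simp: stalk_def)
  interpret G: comm_group "sections F U" using * by (simp add: comm_group_sections)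
  show "\<one>\<^bsub>stalk X F y\<^esub> \<otimes>\<^bsub>stalk X F y\<^esub> A = A"
    using * by (simp flip: germ_one[of U] add: germ_mult)
  show "\<exists>B\<in>carrier (stalk X F y). B \<otimes>\<^bsub>stalk X F y\<^esub> A = \<one>\<^bsub>stalk X F y\<^esub>"
    using * by (intro bexI[of _ "germ X F y U (inv\<^bsub>sections F U\<^esub> s)"])
      (auto simp flip: germ_one[of U] simp: germ_mult germ_closed)
qed

lemma germ_hom: "\<lbrakk>openin X U; y \<in> U\<rbrakk> \<Longrightarrow> germ X F y U \<in> hom (sections F U) (stalk X F y)"
  by (auto simp: hom_def germ_closed germ_mult)

lemma comm_group_product_stalks:
  assumes "U \<subseteq> topspace X"
  shows "comm_group (product_group U (stalk X F))"
proof (rule group.group_comm_groupI)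
  have *: "comm_group (stalk X F y)" if "y \<in> U" for y
    using that assms comm_group_stalk by auto
  show "group (product_group U (stalk X F))"
    using * by (simp add: comm_group.axioms(2))
  show "x \<otimes>\<^bsub>product_group U (stalk X F)\<^esub> y = y \<otimes>\<^bsub>product_group U (stalk X F)\<^esub> x"
    if "x \<in> carrier (product_group U (stalk X F))" "y \<in> carrier (product_group U (stalk X F))" for x y
    using that * by (auto simp: comm_monoid.m_comm[OF comm_group.axioms(1)] PiE_iff fun_eq_iff)
qed

lemma ab_sheaf_godement: "ab_sheaf X (godement_sheaf X F)"
proof (intro ab_sheaf.intro ab_presheaf.intro ab_sheaf_axioms.intro)
  show "comm_group (sections (godement_sheaf X F) U)" if "openin X U" for U
    using comm_group_product_stalks[OF openin_subset[OF that]] by (simp add: godement_sheaf_def)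
  show "restr (godement_sheaf X F) U V \<in>
      hom (sections (godement_sheaf X F) U) (sections (godement_sheaf X F) V)"
    if "openin X U" "openin X V" "V \<subseteq> U" for U V
    using that by (auto simp: godement_sheaf_def hom_def PiE_iff restrict_def fun_eq_iff)
  show "restr (godement_sheaf X F) U U s = s"
    if "openin X U" "s \<in> carrier (sections (godement_sheaf X F) U)" for U s
    using that by (auto simp: godement_sheaf_def PiE_restrict)
  show "restr (godement_sheaf X F) V W (restr (godement_sheaf X F) U V s) = restr (godement_sheaf X F) U W s"
    if "W \<subseteq> V" for U V W s
    using that by (auto simp: godement_sheaf_def restrict_def fun_eq_iff)
next
  fix \<U> :: "'x set set" and t
  assume op: "\<And>U. U \<in> \<U> \<Longrightarrow> openin X U"
    and t: "\<And>U. U \<in> \<U> \<Longrightarrow> t U \<in> carrier (sections (godement_sheaf X F) U)"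
    and agree: "\<And>U V. \<lbrakk>U \<in> \<U>; V \<in> \<U>\<rbrakk> \<Longrightarrow>
      restr (godement_sheaf X F) U (U \<inter> V) (t U) = restr (godement_sheaf X F) V (U \<inter> V) (t V)"
  define u where "u y = (SOME U. U \<in> \<U> \<and> y \<in> U)" for y
  have u: "u y \<in> \<U>" "y \<in> u y" if "y \<in> \<Union>\<U>" for y
  proof -
    have "\<exists>U. U \<in> \<U> \<and> y \<in> U" using that by auto
    then have "u y \<in> \<U> \<and> y \<in> u y" unfolding u_def by (rule someI_ex)
    then show "u y \<in> \<U>" "y \<in> u y" by auto
  qed
  have t': "t U y \<in> carrier (stalk X F y)" "t U = restrict (t U) U" if "U \<in> \<U>" "y \<in> U" for U y
    using t[OF that(1)] that by (auto simp: godement_sheaf_def PiE_iff fun_eq_iff extensional_def)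
  have ag: "t U y = t V y" if "U \<in> \<U>" "V \<in> \<U>" "y \<in> U" "y \<in> V" for U V y
    using fun_cong[OF agree[OF that(1,2)], of y] that by (simp add: godement_sheaf_def)
  show "\<exists>!s. s \<in> carrier (sections (godement_sheaf X F) (\<Union>\<U>)) \<and>
      (\<forall>U\<in>\<U>. restr (godement_sheaf X F) (\<Union>\<U>) U s = t U)"
  proof (rule ex1I[of _ "\<lambda>y\<in>\<Union>\<U>. t (u y) y"], intro conjI ballI)
    show "(\<lambda>y\<in>\<Union>\<U>. t (u y) y) \<in> carrier (sections (godement_sheaf X F) (\<Union>\<U>))"
      using u t' by (auto simp: godement_sheaf_def)
    fix U assume U: "U \<in> \<U>"
    have "t U \<in> extensional U" using t[OF U] by (auto simp: godement_sheaf_def PiE_iff)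
    moreover have "t (u y) y = t U y" "y \<in> \<Union>\<U>" if "y \<in> U" for y
      using ag[OF u(1) U u(2)] U that by blast+
    ultimately have "restrict (\<lambda>y\<in>\<Union>\<U>. t (u y) y) U = t U"
      by (intro extensionalityI[where A = U]) auto
    then show "restr (godement_sheaf X F) (\<Union>\<U>) U (\<lambda>y\<in>\<Union>\<U>. t (u y) y) = t U"
      by (simp add: godement_sheaf_def)
  next
    fix s assume s: "s \<in> carrier (sections (godement_sheaf X F) (\<Union>\<U>)) \<and>
      (\<forall>U\<in>\<U>. restr (godement_sheaf X F) (\<Union>\<U>) U s = t U)"
    then have "s \<in> extensional (\<Union>\<U>)" by (auto simp: godement_sheaf_def PiE_iff)
    moreover have "s y = t (u y) y" if "y \<in> \<Union>\<U>" for y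
      using s u[OF that] by (auto simp: godement_sheaf_def restrict_def fun_eq_iff split: if_splits)
    ultimately show "s = (\<lambda>y\<in>\<Union>\<U>. t (u y) y)"
      by (auto simp: fun_eq_iff extensional_def)
  qed
qed

lemma germs_sheaf_hom: "germs X F \<in> sheaf_hom X F (godement_sheaf X F)"
  by (auto simp: sheaf_hom_def hom_def germs_def godement_sheaf_def germ_closed germ_mult germ_restr
      restrict_def fun_eq_iff)

end

context ab_sheaf
begin

lemma section_eqI:
  assumes "openin X U" "s \<in> carrier (sections F U)" "t \<in> carrier (sections F U)"
    and "\<And>y. y \<in> U \<Longrightarrow> \<exists>W. openin X W \<and> y \<in> W \<and> W \<subseteq> U \<and> restr F U W s = restr F U W t"
  shows "s = t"
proof -
  define \<U> where "\<U> = {W. openin X W \<and> W \<subseteq> U \<and> restr F U W s = restr F U W t}"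
  have Un: "\<Union>\<U> = U" using assms(4) by (auto simp: \<U>_def)
  have "\<exists>!r. r \<in> carrier (sections F (\<Union>\<U>)) \<and> (\<forall>W\<in>\<U>. restr F (\<Union>\<U>) W r = restr F U W s)"
    by (rule glue) (use assms in \<open>auto simp: \<U>_def restr_closed restr_trans openin_Int intro: le_infI1\<close>)
  moreover have "\<forall>W\<in>\<U>. restr F (\<Union>\<U>) W s = restr F U W s" "\<forall>W\<in>\<U>. restr F (\<Union>\<U>) W t = restr F U W s"
    unfolding Un by (auto simp: \<U>_def)
  ultimately show ?thesis
    using assms(2,3) unfolding Un by blast
qed

text \<open>Local agreement is vacuous here. This disposes of tuples whose members of the cover have
  no common point.\<close>

lemma section_empty:
  assumes "s \<in> carrier (sections F {})" "t \<in> carrier (sections F {})"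
  shows "s = t"
  by (rule section_eqI[of "{}"]) (use assms in auto)

lemma germs_sheaf_mono: "germs X F \<in> sheaf_mono X F (godement_sheaf X F)"
proof -
  have "inj_on (germs X F U) (carrier (sections F U))" if U: "openin X U" for U
  proof (rule inj_onI)
    fix s t assume st: "s \<in> carrier (sections F U)" "t \<in> carrier (sections F U)"
      and eq: "germs X F U s = germs X F U t"
    show "s = t"
    proof (rule section_eqI[OF U st])
      fix y assume y: "y \<in> U"
      then have "germ X F y U s = germ X F y U t"
        using fun_cong[OF eq, of y] by (simp add: germs_def)
      then show "\<exists>W. openin X W \<and> y \<in> W \<and> W \<subseteq> U \<and> restr F U W s = restr F U W t"
        by (auto dest!: germ_eqD[OF _ U y st(2)])
    qed
  qed
  then show ?thesis using germs_sheaf_hom by (simp add: sheaf_mono_def)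
qed

end

section \<open>Injective sheaves as retracts of their sheaves of discontinuous sections\<close>

definition transport ::
  "('x set \<Rightarrow> 'w \<Rightarrow> 'v) \<Rightarrow> ('x, 'w) presheaf_data \<Rightarrow> ('x, 'v) presheaf_data"
  where "transport J F = (let K = (\<lambda>U. inv_into (carrier (sections F U)) (J U)) in \<lparr>
    sections = (\<lambda>U. \<lparr>carrier = J U ` carrier (sections F U),
      monoid.mult = (\<lambda>a b. J U (K U a \<otimes>\<^bsub>sections F U\<^esub> K U b)),
      one = J U \<one>\<^bsub>sections F U\<^esub>\<rparr>),
    restr = (\<lambda>U V a. J V (restr F U V (K U a)))\<rparr>)"

context
  fixes X :: "'x topology" and F :: "('x, 'w) presheaf_data" and J :: "'x set \<Rightarrow> 'w \<Rightarrow> 'v"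
  assumes F: "ab_sheaf X F"
    and inj: "\<And>U. openin X U \<Longrightarrow> inj_on (J U) (carrier (sections F U))"
begin

interpretation ab_sheaf X F by (rule F)

lemma transport_simps:
  assumes "openin X U"
  shows "carrier (sections (transport J F) U) = J U ` carrier (sections F U)"
    and "\<one>\<^bsub>sections (transport J F) U\<^esub> = J U \<one>\<^bsub>sections F U\<^esub>"
    and "\<lbrakk>s \<in> carrier (sections F U); t \<in> carrier (sections F U)\<rbrakk>
      \<Longrightarrow> J U s \<otimes>\<^bsub>sections (transport J F) U\<^esub> J U t = J U (s \<otimes>\<^bsub>sections F U\<^esub> t)"
    and "s \<in> carrier (sections F U) \<Longrightarrow> restr (transport J F) U V (J U s) = J V (restr F U V s)"
  using inj[OF assms] by (simp_all add: transport_def Let_def)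

lemma transport_comm_group:
  assumes U: "openin X U"
  shows "comm_group (sections (transport J F) U)"
proof -
  interpret G: comm_group "sections F U" using U by (rule comm_group_sections)
  show ?thesis
  proof (rule comm_groupI, goal_cases)
    case (6 x)
    then obtain s where s: "s \<in> carrier (sections F U)" "x = J U s"
      by (auto simp: transport_simps U)
    show ?case
      by (rule bexI[of _ "J U (inv\<^bsub>sections F U\<^esub> s)"]) (use s in \<open>auto simp: transport_simps U\<close>)
  qed (auto simp: transport_simps U G.m_ac)
qed

lemma ab_sheaf_transport: "ab_sheaf X (transport J F)"
proof (intro ab_sheaf.intro ab_presheaf.intro ab_sheaf_axioms.intro)
  show "comm_group (sections (transport J F) U)" if "openin X U" for U
    using that by (rule transport_comm_group)
  show "restr (transport J F) U V \<in> hom (sections (transport J F) U) (sections (transport J F) V)"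
    if "openin X U" "openin X V" "V \<subseteq> U" for U V
  proof -
    interpret G: comm_group "sections F U" using that by (simp add: comm_group_sections)
    show ?thesis
      using that by (auto simp: hom_def transport_simps restr_closed restr_mult)
  qed
  show "restr (transport J F) U U s = s"
    if "openin X U" "s \<in> carrier (sections (transport J F) U)" for U s
    using that by (auto simp: transport_simps restr_id)
  show "restr (transport J F) V W (restr (transport J F) U V s) = restr (transport J F) U W s"
    if "openin X U" "openin X V" "openin X W" "W \<subseteq> V" "V \<subseteq> U"
      "s \<in> carrier (sections (transport J F) U)" for U V W s
    using that by (auto simp: transport_simps restr_trans restr_closed)
next
  fix \<U> and t
  assume op: "\<And>U. U \<in> \<U> \<Longrightarrow> openin X U"
    and t: "\<And>U. U \<in> \<U> \<Longrightarrow> t U \<in> carrier (sections (transport J F) U)"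
    and agree: "\<And>U V. \<lbrakk>U \<in> \<U>; V \<in> \<U>\<rbrakk> \<Longrightarrow>
      restr (transport J F) U (U \<inter> V) (t U) = restr (transport J F) V (U \<inter> V) (t V)"
  define t' where "t' U = inv_into (carrier (sections F U)) (J U) (t U)" for U
  have t': "t' U \<in> carrier (sections F U)" "t U = J U (t' U)" if "U \<in> \<U>" for U
    using t[OF that] op[OF that] by (auto simp: t'_def transport_simps inv_into_into f_inv_into_f)
  have opU: "openin X (\<Union>\<U>)" using op by blast
  have "\<exists>!s. s \<in> carrier (sections F (\<Union>\<U>)) \<and> (\<forall>U\<in>\<U>. restr F (\<Union>\<U>) U s = t' U)"
  proof (rule glue)
    fix U V assume UV: "U \<in> \<U>" "V \<in> \<U>"
    note o = op[OF UV(1)] op[OF UV(2)] openin_Int[OF op[OF UV(1)] op[OF UV(2)]]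
    have "J (U \<inter> V) (restr F U (U \<inter> V) (t' U)) = J (U \<inter> V) (restr F V (U \<inter> V) (t' V))"
      using agree[OF UV] t'[OF UV(1)] t'[OF UV(2)] o by (simp add: transport_simps)
    then show "restr F U (U \<inter> V) (t' U) = restr F V (U \<inter> V) (t' V)"
      using inj[OF o(3)] t'[OF UV(1)] t'[OF UV(2)] o by (simp add: inj_on_eq_iff restr_closed)
  qed (use op t' in auto)
  then obtain s where s: "s \<in> carrier (sections F (\<Union>\<U>))" "\<forall>U\<in>\<U>. restr F (\<Union>\<U>) U s = t' U"
    and uniq: "\<And>r. \<lbrakk>r \<in> carrier (sections F (\<Union>\<U>)); \<forall>U\<in>\<U>. restr F (\<Union>\<U>) U r = t' U\<rbrakk> \<Longrightarrow> r = s"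
    by auto
  show "\<exists>!s. s \<in> carrier (sections (transport J F) (\<Union>\<U>)) \<and>
      (\<forall>U\<in>\<U>. restr (transport J F) (\<Union>\<U>) U s = t U)"
  proof (rule ex1I[of _ "J (\<Union>\<U>) s"], intro conjI ballI)
    show "J (\<Union>\<U>) s \<in> carrier (sections (transport J F) (\<Union>\<U>))"
      using s opU by (simp add: transport_simps)
    show "restr (transport J F) (\<Union>\<U>) U (J (\<Union>\<U>) s) = t U" if "U \<in> \<U>" for U
      using s opU t' that by (simp add: transport_simps)
    fix a assume a: "a \<in> carrier (sections (transport J F) (\<Union>\<U>)) \<and>
      (\<forall>U\<in>\<U>. restr (transport J F) (\<Union>\<U>) U a = t U)"
    then obtain r where r: "r \<in> carrier (sections F (\<Union>\<U>))" "a = J (\<Union>\<U>) r"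
      using opU by (auto simp: transport_simps)
    have "restr F (\<Union>\<U>) U r = t' U" if U: "U \<in> \<U>" for U
    proof -
      have "J U (restr F (\<Union>\<U>) U r) = J U (t' U)"
        using a r t'[OF U] U opU by (simp add: transport_simps)
      moreover have "restr F (\<Union>\<U>) U r \<in> carrier (sections F U)"
        using r U op opU by (auto intro!: restr_closed)
      ultimately show ?thesis
        using inj[OF op[OF U]] t'[OF U] by (simp add: inj_on_eq_iff)
    qed
    then show "a = J (\<Union>\<U>) s" using uniq r by blast
  qed
qed

lemma transport_hom: "J \<in> sheaf_hom X F (transport J F)"
  by (auto simp: sheaf_hom_def hom_def transport_simps)

end

lemma sheaf_hom_comp:
  assumes "\<alpha> \<in> sheaf_hom X F G" "\<beta> \<in> sheaf_hom X G H"
  shows "(\<lambda>U s. \<beta> U (\<alpha> U s)) \<in> sheaf_hom X F H"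
proof -
  have "(\<lambda>s. \<beta> U (\<alpha> U s)) \<in> hom (sections F U) (sections H U)" if "openin X U" for U
    using hom_compose[of "\<alpha> U" "sections F U" "sections G U" "\<beta> U" "sections H U"] assms that
    by (auto simp: sheaf_hom_def comp_def)
  moreover have "\<beta> V (\<alpha> V (restr F U V s)) = restr H U V (\<beta> U (\<alpha> U s))"
    if "openin X U" "openin X V" "V \<subseteq> U" "s \<in> carrier (sections F U)" for U V s
  proof -
    have "\<alpha> U s \<in> carrier (sections G U)"
      using assms(1) that by (auto simp: sheaf_hom_def hom_def)
    then show ?thesis
      using assms that by (simp add: sheaf_hom_def)
  qed
  ultimately show ?thesis by (auto simp: sheaf_hom_def)
qed

lemma sheaf_mono_comp:
  assumes "\<alpha> \<in> sheaf_mono X F G" "\<beta> \<in> sheaf_mono X G H"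
  shows "(\<lambda>U s. \<beta> U (\<alpha> U s)) \<in> sheaf_mono X F H"
proof -
  have "inj_on (\<lambda>s. \<beta> U (\<alpha> U s)) (carrier (sections F U))" if U: "openin X U" for U
  proof (rule inj_onI)
    fix s t assume st: "s \<in> carrier (sections F U)" "t \<in> carrier (sections F U)"
      "\<beta> U (\<alpha> U s) = \<beta> U (\<alpha> U t)"
    have "\<alpha> U s \<in> carrier (sections G U)" "\<alpha> U t \<in> carrier (sections G U)"
      using assms(1) U st by (auto simp: sheaf_mono_def sheaf_hom_def hom_def)
    then show "s = t"
      using assms U st by (auto simp: sheaf_mono_def dest!: inj_onD)
  qed
  then show ?thesis
    using assms sheaf_hom_comp by (auto simp: sheaf_mono_def)
qed

text \<open>
  The sheaf of discontinuous sections has values in another type than the sheaf it is built from,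
  so injectivity applies only after encoding its sections as functions on lists.
\<close>

definition encode :: "('x \<Rightarrow> 'x set \<times> ('x list \<Rightarrow> nat)) \<Rightarrow> 'x list \<Rightarrow> nat"
  where "encode h l = (case l of [] \<Rightarrow> 0
    | y # ys \<Rightarrow> prod_encode (snd (h y) ys, if \<exists>u \<in> fst (h y). ys = [u] then 1 else 0))"

lemma inj_encode: "inj encode"
proof (rule injI, rule ext, rule prod_eqI)
  fix h h' :: "'a \<Rightarrow> 'a set \<times> ('a list \<Rightarrow> nat)" and y
  assume eq: "encode h = encode h'"
  have *: "snd (h y) ys = snd (h' y) ys \<and> ((\<exists>u \<in> fst (h y). ys = [u]) \<longleftrightarrow> (\<exists>u \<in> fst (h' y). ys = [u]))" for ys
    using fun_cong[OF eq, of "y # ys"] by (auto simp: encode_def split: if_splits)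
  then show "snd (h y) = snd (h' y)" by auto
  have "u \<in> fst (h y) \<longleftrightarrow> u \<in> fst (h' y)" for u
    using *[of "[u]"] by auto
  then show "fst (h y) = fst (h' y)" by auto
qed

text \<open>A germ is determined by any one of its representatives, so recording one choice per
  point loses nothing.\<close>

definition encode_germs :: "('x \<Rightarrow> ('x set \<times> ('x list \<Rightarrow> nat)) set) \<Rightarrow> 'x list \<Rightarrow> nat"
  where "encode_germs \<sigma> = encode (\<lambda>y. SOME r. r \<in> \<sigma> y)"

lemma inj_encode_germs:
  fixes F :: "('x, 'x list \<Rightarrow> nat) presheaf_data"
  assumes "ab_presheaf X F"
  shows "inj_on encode_germs (carrier (sections (godement_sheaf X F) U))"
proof (rule inj_onI)
  interpret ab_presheaf X F by fact
  fix \<sigma> \<tau> assume \<sigma>: "\<sigma> \<in> carrier (sections (godement_sheaf X F) U)"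
    and \<tau>: "\<tau> \<in> carrier (sections (godement_sheaf X F) U)" and eq: "encode_germs \<sigma> = encode_germs \<tau>"
  have rep: "(SOME r. r \<in> \<sigma> y) = (SOME r. r \<in> \<tau> y)" for y
  proof -
    have "(\<lambda>y. SOME r. r \<in> \<sigma> y) = (\<lambda>y. SOME r. r \<in> \<tau> y)"
      by (rule injD[OF inj_encode]) (use eq in \<open>simp add: encode_germs_def\<close>)
    then show ?thesis by (rule fun_cong)
  qed
  have some: "(SOME r. r \<in> A) \<in> A" "\<And>V t. (V, t) \<in> A \<Longrightarrow> A = germ X F y V t" 
    if A: "A \<in> carrier (stalk X F y)" for A y
  proof -
    obtain V s where Vs: "openin X V" "y \<in> V" "s \<in> carrier (sections F V)" "A = germ X F y V s"
      using A by (auto simp: stalk_def)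
    have "(V, s) \<in> A" using Vs germ_self by auto
    then show "(SOME r. r \<in> A) \<in> A" by (rule someI)
    show "A = germ X F y V' t" if "(V', t) \<in> A" for V' t
      using germ_mem[of V s V' t y] Vs that by auto
  qed
  have "\<sigma> y = \<tau> y" if "y \<in> U" for y
  proof -
    have A: "\<sigma> y \<in> carrier (stalk X F y)" "\<tau> y \<in> carrier (stalk X F y)"
      using \<sigma> \<tau> that by (auto simp: godement_sheaf_def)
    obtain V t where Vt: "(SOME r. r \<in> \<sigma> y) = (V, t)" by fastforce
    show ?thesis
      using some[OF A(1)] some[OF A(2)] Vt rep[of y] by metis
  qed
  moreover have "\<sigma> \<in> extensional U" "\<tau> \<in> extensional U"
    using \<sigma> \<tau> by (auto simp: godement_sheaf_def PiE_iff)
  ultimately show "\<sigma> = \<tau>" by (intro extensionalityI)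
qed

text \<open>Injectivity extends the identity of \<open>I\<close> along the embedding of
  \<open>I\<close> into the encoded sheaf; the extension preceded by the encoding is
  \<open>r\<close>.\<close>

lemma godement_retraction:
  fixes I :: "('x, 'x list \<Rightarrow> nat) presheaf_data"
  assumes "injective_sheaf X I"
  obtains r where "r \<in> sheaf_hom X (godement_sheaf X I) I"
    and "\<And>U s. \<lbrakk>openin X U; s \<in> carrier (sections I U)\<rbrakk> \<Longrightarrow> r U (germs X I U s) = s"
proof -
  interpret I: ab_sheaf X I using assms by (simp add: injective_sheaf_def)
  let ?J = "\<lambda>_ :: 'x set. encode_germs :: ('x \<Rightarrow> ('x set \<times> ('x list \<Rightarrow> nat)) set) \<Rightarrow> 'x list \<Rightarrow> nat"
  let ?D = "godement_sheaf X I"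
  let ?T = "transport ?J ?D"
  note D = I.ab_sheaf_godement inj_encode_germs[OF I.ab_presheaf_axioms]
  have "?J \<in> sheaf_mono X ?D ?T"
    using transport_hom[of X ?D ?J] D by (auto simp: sheaf_mono_def)
  then have "(\<lambda>U s. ?J U (germs X I U s)) \<in> sheaf_mono X I ?T"
    by (rule sheaf_mono_comp[OF I.germs_sheaf_mono])
  moreover have "(\<lambda>U s. s) \<in> sheaf_hom X I I" by (auto simp: sheaf_hom_def hom_def)
  moreover have "ab_sheaf X ?T" using D by (intro ab_sheaf_transport)
  ultimately have *: "ab_sheaf X I \<and> ab_sheaf X ?T \<and> (\<lambda>U s. ?J U (germs X I U s)) \<in> sheaf_mono X I ?T
      \<and> (\<lambda>U s. s) \<in> sheaf_hom X I I"
    using I.ab_sheaf_axioms by simp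
  have "\<exists>g \<in> sheaf_hom X ?T I. \<forall>U s. openin X U \<and> s \<in> carrier (sections I U)
      \<longrightarrow> g U (?J U (germs X I U s)) = s"
    using conjunct2[OF assms[unfolded injective_sheaf_def], THEN spec, THEN spec, THEN spec, THEN spec,
        THEN mp, OF *] .
  then obtain g where g: "g \<in> sheaf_hom X ?T I"
    "\<forall>U s. openin X U \<and> s \<in> carrier (sections I U) \<longrightarrow> g U (?J U (germs X I U s)) = s"
    by blast
  have "(\<lambda>U s. g U (?J U s)) \<in> sheaf_hom X ?D I"
  proof (rule sheaf_hom_comp[of ?J X ?D ?T g I])
    show "?J \<in> sheaf_hom X ?D ?T" by (rule transport_hom) (rule D)+
    show "g \<in> sheaf_hom X ?T I" by (rule g)
  qed
  moreover have "g U (?J U (germs X I U s)) = s" if "openin X U" "s \<in> carrier (sections I U)" for U s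
    using g(2) that by blast
  ultimately show ?thesis by (rule that)
qed

section \<open>Cech cochains for covers indexed by points\<close>

text \<open>Indexing covers by the points of X gives all of them the same tuples, with the same
  group action, and lets two covers be compared point by point.\<close>

definition cover_family :: "'x topology \<Rightarrow> ('x \<Rightarrow> 'x set) \<Rightarrow> bool"
  where "cover_family X V \<longleftrightarrow> (\<forall>x\<in>topspace X. openin X (V x) \<and> x \<in> V x)"

text \<open>Containment in \<open>V (\<tau> x)\<close> permits restriction along \<tau>. Containment
  in \<open>V x\<close> as well keeps tuples mixed from \<open>xs\<close> and
  \<open>map \<tau> xs\<close> small, as the prism operator requires.\<close>

definition crefines :: "'x topology \<Rightarrow> ('x \<Rightarrow> 'x set) \<Rightarrow> ('x \<Rightarrow> 'x set) \<Rightarrow> ('x \<Rightarrow> 'x) \<Rightarrow> bool"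
  where "crefines X V W \<tau> \<longleftrightarrow> (\<forall>x\<in>topspace X. \<tau> x \<in> topspace X \<and> W x \<subseteq> V x \<inter> V (\<tau> x))"

text \<open>The factor \<open>topspace X\<close> attaches the whole space to the empty tuple, so
  that cochains of length 0 are global sections.\<close>

definition nb :: "'x topology \<Rightarrow> ('x \<Rightarrow> 'x set) \<Rightarrow> 'x list \<Rightarrow> 'x set"
  where "nb X V xs = (\<Inter>x\<in>set xs. V x) \<inter> topspace X"

text \<open>The index \<open>n\<close> counts entries: the Cech degree is \<open>n - 1\<close>, and
  \<open>n = 0\<close> is the augmentation.\<close>

definition cochains ::
  "'x topology \<Rightarrow> ('x, 'v) presheaf_data \<Rightarrow> ('x \<Rightarrow> 'x set) \<Rightarrow> nat \<Rightarrow> ('x list \<Rightarrow> 'v) set"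
  where "cochains X F V n =
    {c. \<forall>xs. set xs \<subseteq> topspace X \<and> length xs = n \<longrightarrow> c xs \<in> carrier (sections F (nb X V xs))}"

definition delta ::
  "'x topology \<Rightarrow> ('x, 'v) presheaf_data \<Rightarrow> ('x \<Rightarrow> 'x set) \<Rightarrow> ('x list \<Rightarrow> 'v) \<Rightarrow> 'x list \<Rightarrow> 'v"
  where "delta X F V c xs =
    cobd (sections F (nb X V xs)) (\<lambda>ys. restr F (nb X V ys) (nb X V xs) (c ys)) xs"

definition pull :: "'x topology \<Rightarrow> ('x, 'v) presheaf_data \<Rightarrow> ('x \<Rightarrow> 'x set) \<Rightarrow> ('x \<Rightarrow> 'x set)
    \<Rightarrow> ('x \<Rightarrow> 'x) \<Rightarrow> ('x list \<Rightarrow> 'v) \<Rightarrow> 'x list \<Rightarrow> 'v"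
  where "pull X F V W \<tau> c xs = restr F (nb X V (map \<tau> xs)) (nb X W xs) (c (map \<tau> xs))"

lemma openin_nb: "\<lbrakk>cover_family X V; set xs \<subseteq> topspace X\<rbrakk> \<Longrightarrow> openin X (nb X V xs)"
  unfolding nb_def by (rule openin_INT) (auto simp: cover_family_def)

lemma nb_antimono: "set ys \<subseteq> set xs \<Longrightarrow> nb X V xs \<subseteq> nb X V ys"
  by (auto simp: nb_def)

lemma nb_refines:
  assumes "crefines X V W \<tau>" "set xs \<subseteq> topspace X"
  shows "nb X W xs \<subseteq> nb X V (map \<tau> xs)" "nb X W xs \<subseteq> nb X V xs"
    "nb X W xs \<subseteq> nb X V (xs @ map \<tau> xs)"
  using assms by (fastforce simp: nb_def crefines_def)+

lemma refines_trans:
  assumes "crefines X V W \<tau>" "crefines X W W' \<tau>'"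
  shows "crefines X V W' (\<tau> \<circ> \<tau>')"
  unfolding crefines_def
proof (intro ballI conjI)
  fix x assume x: "x \<in> topspace X"
  then have "\<tau>' x \<in> topspace X" using assms(2) by (auto simp: crefines_def)
  then show "(\<tau> \<circ> \<tau>') x \<in> topspace X" "W' x \<subseteq> V x \<inter> V ((\<tau> \<circ> \<tau>') x)"
    using x assms unfolding crefines_def by (auto, blast+)
qed

lemma refines_map:
  "\<lbrakk>crefines X V W \<tau>; set xs \<subseteq> topspace X\<rbrakk> \<Longrightarrow> set (map \<tau> xs) \<subseteq> topspace X"
  by (auto simp: crefines_def)

lemma refines_id: "crefines X V V id"
  by (auto simp: crefines_def)

lemma cobd_map: "cobd M (\<lambda>ys. c (map h ys)) xs = cobd M c (map h xs)"
proof (induction xs arbitrary: c)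
  case (Cons x xs)
  show ?case using Cons[of "\<lambda>ys. c (h x # ys)"] by simp
qed simp

lemma cobd_Cons_eq_one:
  assumes "group M" "cobd M c (x # xs) = \<one>\<^bsub>M\<^esub>" "c xs \<in> carrier M"
    and "cobd M (\<lambda>ys. c (x # ys)) xs \<in> carrier M"
  shows "c xs = cobd M (\<lambda>ys. c (x # ys)) xs"
proof -
  interpret group M by fact
  show ?thesis
    using assms inv_solve_right[of "\<one>\<^bsub>M\<^esub>" "c xs" "cobd M (\<lambda>ys. c (x # ys)) xs"] by simp
qed

lemma cochainsD:
  "\<lbrakk>c \<in> cochains X F V n; set xs \<subseteq> topspace X; length xs = n\<rbrakk>
    \<Longrightarrow> c xs \<in> carrier (sections F (nb X V xs))"
  by (simp add: cochains_def)

context ab_presheaf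
begin

lemma cochains_restr:
  assumes "cover_family X V" "c \<in> cochains X F V n" "set ys \<subseteq> topspace X" "length ys = n"
    and "openin X U" "U \<subseteq> nb X V ys"
  shows "restr F (nb X V ys) U (c ys) \<in> carrier (sections F U)"
  using assms by (intro restr_closed openin_nb cochainsD)

lemma restr_delta:
  assumes V: "cover_family X V" and c: "c \<in> cochains X F V n"
    and xs: "set xs \<subseteq> topspace X" "length xs = Suc n" and U: "openin X U" "U \<subseteq> nb X V xs"
  shows "restr F (nb X V xs) U (delta X F V c xs) =
    cobd (sections F U) (\<lambda>ys. restr F (nb X V ys) U (c ys)) xs"
proof -
  note o = openin_nb[OF V xs(1)]
  have ys: "restr F (nb X V ys) (nb X V xs) (c ys) \<in> carrier (sections F (nb X V xs))"
    "restr F (nb X V xs) U (restr F (nb X V ys) (nb X V xs) (c ys)) = restr F (nb X V ys) U (c ys)"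
    if "set ys \<subseteq> set xs" "Suc (length ys) = length xs" for ys
  proof -
    have ys: "set ys \<subseteq> topspace X" "length ys = n" using that xs by auto
    note le = nb_antimono[OF that(1), of X V]
    show "restr F (nb X V ys) (nb X V xs) (c ys) \<in> carrier (sections F (nb X V xs))"
      by (rule cochains_restr[OF V c ys o le])
    show "restr F (nb X V xs) U (restr F (nb X V ys) (nb X V xs) (c ys)) = restr F (nb X V ys) U (c ys)"
      by (rule restr_trans[OF openin_nb[OF V ys(1)] o U(1,2) le cochainsD[OF c ys]])
  qed
  have "restr F (nb X V xs) U (delta X F V c xs) =
      cobd (sections F U) (\<lambda>ys. restr F (nb X V xs) U (restr F (nb X V ys) (nb X V xs) (c ys))) xs"
    unfolding delta_def by (rule cobd_hom) (use o U ys in \<open>auto intro: group_sections restr_hom\<close>)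
  also have "\<dots> = cobd (sections F U) (\<lambda>ys. restr F (nb X V ys) U (c ys)) xs"
    by (rule cobd_cong) (rule ys)
  finally show ?thesis .
qed

lemma delta_cochains:
  assumes V: "cover_family X V" and c: "c \<in> cochains X F V n"
  shows "delta X F V c \<in> cochains X F V (Suc n)"
  unfolding cochains_def
proof (intro CollectI allI impI)
  fix xs assume xs: "set xs \<subseteq> topspace X \<and> length xs = Suc n"
  then have o: "openin X (nb X V xs)" by (simp add: V openin_nb)
  show "delta X F V c xs \<in> carrier (sections F (nb X V xs))"
    unfolding delta_def
    by (rule group.cobd_closed[OF group_sections[OF o]], rule cochains_restr[OF V c])
      (use xs o in \<open>auto intro: subsetD[OF nb_antimono]\<close>)
qed

lemma delta_cong:
  assumes "\<And>ys. \<lbrakk>set ys \<subseteq> topspace X; length ys = n\<rbrakk> \<Longrightarrow> c ys = c' ys"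
    and "set xs \<subseteq> topspace X" "length xs = Suc n"
  shows "delta X F V c xs = delta X F V c' xs"
  unfolding delta_def
proof (rule cobd_cong)
  fix ys assume "set ys \<subseteq> set xs" "Suc (length ys) = length xs"
  then have "c ys = c' ys" using assms by auto
  then show "restr F (nb X V ys) (nb X V xs) (c ys) = restr F (nb X V ys) (nb X V xs) (c' ys)" by simp
qed

lemma cochains_div:
  assumes V: "cover_family X V" and "a \<in> cochains X F V n" "b \<in> cochains X F V n"
  shows "(\<lambda>ys. a ys \<otimes>\<^bsub>sections F (nb X V ys)\<^esub> inv\<^bsub>sections F (nb X V ys)\<^esub> (b ys)) \<in> cochains X F V n"
  unfolding cochains_def
proof (intro CollectI allI impI)
  fix xs assume xs: "set xs \<subseteq> topspace X \<and> length xs = n"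
  interpret comm_group "sections F (nb X V xs)"
    using xs V by (simp add: comm_group_sections openin_nb)
  show "a xs \<otimes>\<^bsub>sections F (nb X V xs)\<^esub> inv\<^bsub>sections F (nb X V xs)\<^esub> (b xs) \<in> carrier (sections F (nb X V xs))"
    using assms xs by (simp add: cochainsD)
qed

lemma delta_div:
  assumes V: "cover_family X V" and a: "a \<in> cochains X F V n" and b: "b \<in> cochains X F V n"
    and xs: "set xs \<subseteq> topspace X" "length xs = Suc n"
  shows "delta X F V (\<lambda>ys. a ys \<otimes>\<^bsub>sections F (nb X V ys)\<^esub> inv\<^bsub>sections F (nb X V ys)\<^esub> (b ys)) xs =
    delta X F V a xs \<otimes>\<^bsub>sections F (nb X V xs)\<^esub> inv\<^bsub>sections F (nb X V xs)\<^esub> (delta X F V b xs)"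
proof -
  note o = openin_nb[OF V xs(1)]
  interpret G: comm_group "sections F (nb X V xs)" using o by (rule comm_group_sections)
  let ?r = "\<lambda>ys. restr F (nb X V ys) (nb X V xs)"
  have ys: "?r ys (a ys) \<in> carrier (sections F (nb X V xs))" "?r ys (b ys) \<in> carrier (sections F (nb X V xs))"
    "?r ys (a ys \<otimes>\<^bsub>sections F (nb X V ys)\<^esub> inv\<^bsub>sections F (nb X V ys)\<^esub> (b ys)) =
      ?r ys (a ys) \<otimes>\<^bsub>sections F (nb X V xs)\<^esub> inv\<^bsub>sections F (nb X V xs)\<^esub> (?r ys (b ys))"
    if "set ys \<subseteq> set xs" "Suc (length ys) = length xs" for ys
  proof -
    have ys: "set ys \<subseteq> topspace X" "length ys = n" using that xs by auto
    note le = nb_antimono[OF that(1), of X V]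
    note o' = openin_nb[OF V ys(1)]
    interpret H: comm_group "sections F (nb X V ys)" using o' by (rule comm_group_sections)
    show "?r ys (a ys) \<in> carrier (sections F (nb X V xs))" "?r ys (b ys) \<in> carrier (sections F (nb X V xs))"
      using cochains_restr[OF V _ ys o le] a b by auto
    show "?r ys (a ys \<otimes>\<^bsub>sections F (nb X V ys)\<^esub> inv\<^bsub>sections F (nb X V ys)\<^esub> (b ys)) =
      ?r ys (a ys) \<otimes>\<^bsub>sections F (nb X V xs)\<^esub> inv\<^bsub>sections F (nb X V xs)\<^esub> (?r ys (b ys))"
      using cochainsD[OF a ys] cochainsD[OF b ys] by (simp add: restr_mult[OF o' o le] restr_inv[OF o' o le])
  qed
  show ?thesis
    unfolding delta_def
    by (rule trans[OF cobd_cong G.cobd_div], rule ys(3)) (assumption | rule ys)+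
qed

lemma delta_delta:
  assumes V: "cover_family X V" and c: "c \<in> cochains X F V n"
    and xs: "set xs \<subseteq> topspace X" "length xs = Suc (Suc n)"
  shows "delta X F V (delta X F V c) xs = \<one>\<^bsub>sections F (nb X V xs)\<^esub>"
proof -
  note o = openin_nb[OF V xs(1)]
  interpret G: comm_group "sections F (nb X V xs)" using o by (rule comm_group_sections)
  have "delta X F V (delta X F V c) xs = cobd (sections F (nb X V xs))
      (cobd (sections F (nb X V xs)) (\<lambda>ys. restr F (nb X V ys) (nb X V xs) (c ys))) xs"
    unfolding delta_def[of X F V "delta X F V c"]
    by (rule cobd_cong, rule restr_delta[OF V c _ _ o]) (use xs in \<open>auto intro: subsetD[OF nb_antimono]\<close>)
  also have "\<dots> = \<one>\<^bsub>sections F (nb X V xs)\<^esub>"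
    by (rule G.cobd_cobd, rule cochains_restr[OF V c]) (use xs o in \<open>auto intro: subsetD[OF nb_antimono]\<close>)
  finally show ?thesis .
qed

lemma pull_cochains:
  assumes "cover_family X V" "cover_family X W" "crefines X V W \<tau>" "c \<in> cochains X F V n"
  shows "pull X F V W \<tau> c \<in> cochains X F W n"
  unfolding cochains_def pull_def
proof (intro CollectI allI impI)
  fix xs assume xs: "set xs \<subseteq> topspace X \<and> length xs = n"
  then show "restr F (nb X V (map \<tau> xs)) (nb X W xs) (c (map \<tau> xs)) \<in> carrier (sections F (nb X W xs))"
    by (intro cochains_restr[OF assms(1,4)] refines_map[OF assms(3)] nb_refines(1)[OF assms(3)]
        openin_nb[OF assms(2)]) auto
qed

lemma delta_pull:
  assumes V: "cover_family X V" and W: "cover_family X W" and \<tau>: "crefines X V W \<tau>"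
    and c: "c \<in> cochains X F V n" and xs: "set xs \<subseteq> topspace X" "length xs = Suc n"
  shows "delta X F W (pull X F V W \<tau> c) xs = pull X F V W \<tau> (delta X F V c) xs"
proof -
  note o = openin_nb[OF W xs(1)]
  let ?f = "\<lambda>zs. restr F (nb X V zs) (nb X W xs) (c zs)"
  have "delta X F W (pull X F V W \<tau> c) xs = cobd (sections F (nb X W xs)) (\<lambda>ys. ?f (map \<tau> ys)) xs"
    unfolding delta_def
  proof (rule cobd_cong)
    fix ys assume that: "set ys \<subseteq> set xs" "Suc (length ys) = length xs"
    have ys: "set ys \<subseteq> topspace X" "length (map \<tau> ys) = n" using that xs by auto
    note m = refines_map[OF \<tau> ys(1)]
    show "restr F (nb X W ys) (nb X W xs) (pull X F V W \<tau> c ys) = ?f (map \<tau> ys)"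
      unfolding pull_def
      by (rule restr_trans[OF openin_nb[OF V m] openin_nb[OF W ys(1)] o nb_antimono[OF that(1)]
            nb_refines(1)[OF \<tau> ys(1)] cochainsD[OF c m ys(2)]])
  qed
  also have "\<dots> = cobd (sections F (nb X W xs)) ?f (map \<tau> xs)"
    by (rule cobd_map)
  also have "\<dots> = pull X F V W \<tau> (delta X F V c) xs"
    unfolding pull_def
    by (rule restr_delta[symmetric, OF V c refines_map[OF \<tau> xs(1)] _ o nb_refines(1)[OF \<tau> xs(1)]])
      (simp add: xs)
  finally show ?thesis .
qed

lemma pull_pull:
  assumes V: "cover_family X V" and W: "cover_family X W" "cover_family X W'"
    and \<tau>: "crefines X V W \<tau>" "crefines X W W' \<tau>'"
    and c: "c \<in> cochains X F V n" and xs: "set xs \<subseteq> topspace X" "length xs = n"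
  shows "pull X F W W' \<tau>' (pull X F V W \<tau> c) xs = pull X F V W' (\<tau> \<circ> \<tau>') c xs"
proof -
  note m' = refines_map[OF \<tau>(2) xs(1)]
  note m = refines_map[OF \<tau>(1) m']
  show ?thesis
    using restr_trans[OF openin_nb[OF V m] openin_nb[OF W(1) m'] openin_nb[OF W(2) xs(1)]
        nb_refines(1)[OF \<tau>(2) xs(1)] nb_refines(1)[OF \<tau>(1) m'] cochainsD[OF c m]] xs
    by (simp add: pull_def)
qed

lemma pull_id:
  assumes V: "cover_family X V" and c: "c \<in> cochains X F V n" and xs: "set xs \<subseteq> topspace X" "length xs = n"
  shows "pull X F V V id c xs = c xs"
  using assms by (simp add: pull_def restr_id openin_nb cochainsD)

end

lemma sheaf_homD:
  assumes "\<alpha> \<in> sheaf_hom X F G" "openin X U"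
  shows "\<alpha> U \<in> hom (sections F U) (sections G U)"
    and "s \<in> carrier (sections F U) \<Longrightarrow> \<alpha> U s \<in> carrier (sections G U)"
    and "\<lbrakk>openin X V; V \<subseteq> U; s \<in> carrier (sections F U)\<rbrakk> \<Longrightarrow> \<alpha> V (restr F U V s) = restr G U V (\<alpha> U s)"
  using assms by (auto simp: sheaf_hom_def hom_def)

lemma cochains_hom:
  assumes "cover_family X V" "\<alpha> \<in> sheaf_hom X F G" "c \<in> cochains X F V n"
  shows "(\<lambda>ys. \<alpha> (nb X V ys) (c ys)) \<in> cochains X G V n"
  unfolding cochains_def
  using sheaf_homD(2)[OF assms(2) openin_nb[OF assms(1)] cochainsD[OF assms(3)]] by blast

lemma delta_hom:
  assumes F: "ab_presheaf X F" and G: "ab_presheaf X G" and \<alpha>: "\<alpha> \<in> sheaf_hom X F G"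
    and V: "cover_family X V" and c: "c \<in> cochains X F V n"
    and xs: "set xs \<subseteq> topspace X" "length xs = Suc n"
  shows "\<alpha> (nb X V xs) (delta X F V c xs) = delta X G V (\<lambda>ys. \<alpha> (nb X V ys) (c ys)) xs"
proof -
  interpret F: ab_presheaf X F by (rule F)
  interpret G: ab_presheaf X G by (rule G)
  note o = openin_nb[OF V xs(1)]
  have ys: "restr F (nb X V ys) (nb X V xs) (c ys) \<in> carrier (sections F (nb X V xs))"
    "\<alpha> (nb X V xs) (restr F (nb X V ys) (nb X V xs) (c ys)) =
      restr G (nb X V ys) (nb X V xs) (\<alpha> (nb X V ys) (c ys))"
    if "set ys \<subseteq> set xs" "Suc (length ys) = length xs" for ys
  proof -
    have ys: "set ys \<subseteq> topspace X" "length ys = n" using that xs by auto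
    note le = nb_antimono[OF that(1), of X V]
    show "restr F (nb X V ys) (nb X V xs) (c ys) \<in> carrier (sections F (nb X V xs))"
      by (rule F.cochains_restr[OF V c ys o le])
    show "\<alpha> (nb X V xs) (restr F (nb X V ys) (nb X V xs) (c ys)) =
      restr G (nb X V ys) (nb X V xs) (\<alpha> (nb X V ys) (c ys))"
      by (rule sheaf_homD(3)[OF \<alpha> openin_nb[OF V ys(1)] o le cochainsD[OF c ys]])
  qed
  have "\<alpha> (nb X V xs) (delta X F V c xs) =
      cobd (sections G (nb X V xs)) (\<lambda>ys. \<alpha> (nb X V xs) (restr F (nb X V ys) (nb X V xs) (c ys))) xs"
    unfolding delta_def
    by (rule cobd_hom[OF F.group_sections[OF o] G.group_sections[OF o] sheaf_homD(1)[OF \<alpha> o]]) (rule ys)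
  also have "\<dots> = delta X G V (\<lambda>ys. \<alpha> (nb X V ys) (c ys)) xs"
    unfolding delta_def by (rule cobd_cong) (rule ys)
  finally show ?thesis .
qed

text \<open>
  With \<open>y \<mapsto> germ\<^sub>y (c (y # ys))\<close> as value at \<open>ys\<close>, a cocycle bounds in the sheaf of discontinuous
  sections, because \<open>y\<close> belongs to the member of the cover with index \<open>y\<close>. A retraction brings this
  solution back to the injective sheaf.
\<close>

lemma cech_acyclic:
  fixes I :: "('x, 'x list \<Rightarrow> nat) presheaf_data"
  assumes I: "injective_sheaf X I" and V: "cover_family X V" and c: "c \<in> cochains X I V (Suc n)"
    and cocycle: "\<And>xs. \<lbrakk>set xs \<subseteq> topspace X; length xs = Suc (Suc n)\<rbrakk>
      \<Longrightarrow> delta X I V c xs = \<one>\<^bsub>sections I (nb X V xs)\<^esub>"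
  obtains b where "b \<in> cochains X I V n"
    "\<And>xs. \<lbrakk>set xs \<subseteq> topspace X; length xs = Suc n\<rbrakk> \<Longrightarrow> delta X I V b xs = c xs"
proof -
  interpret I: ab_sheaf X I using I by (simp add: injective_sheaf_def)
  let ?D = "godement_sheaf X I"
  interpret D: ab_sheaf X ?D by (rule I.ab_sheaf_godement)
  obtain r where r: "r \<in> sheaf_hom X ?D I"
      "\<And>U s. \<lbrakk>openin X U; s \<in> carrier (sections I U)\<rbrakk> \<Longrightarrow> r U (germs X I U s) = s"
    using godement_retraction[OF I] by blast
  define b where "b ys = (\<lambda>y\<in>nb X V ys. germ X I y (nb X V (y # ys)) (c (y # ys)))" for ys
  have Cons: "y \<in> topspace X" "y \<in> nb X V (y # ys)" "set (y # ys) \<subseteq> topspace X"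
    if "set ys \<subseteq> topspace X" "y \<in> nb X V ys" for y ys
    using that V by (auto simp: nb_def cover_family_def)
  have b: "b \<in> cochains X ?D V n"
    unfolding cochains_def
  proof (intro CollectI allI impI)
    fix ys assume ys: "set ys \<subseteq> topspace X \<and> length ys = n"
    show "b ys \<in> carrier (sections ?D (nb X V ys))"
      using ys Cons[of ys] unfolding b_def godement_sheaf_def
      by (auto intro!: I.germ_closed openin_nb[OF V] cochainsD[OF c])
  qed
  have delta_b: "delta X ?D V b xs = germs X I (nb X V xs) (c xs)"
    if xs: "set xs \<subseteq> topspace X" "length xs = Suc n" for xs
  proof (rule extensionalityI)
    let ?U = "nb X V xs"
    have "delta X ?D V b xs \<in> carrier (sections ?D ?U)"
      by (rule cochainsD[OF D.delta_cochains[OF V b] xs])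
    then show "delta X ?D V b xs \<in> extensional ?U"
      by (simp add: godement_sheaf_def PiE_iff)
    show "germs X I ?U (c xs) \<in> extensional ?U" by (simp add: germs_def)
    fix y assume y: "y \<in> ?U"
    note yX = Cons[OF xs(1) y]
    let ?N = "nb X V (y # xs)" and ?S = "stalk X I y"
    note oN = openin_nb[OF V yX(3)] and oU = openin_nb[OF V xs(1)]
    have gS: "group ?S" using I.comm_group_stalk[OF yX(1)] comm_group.axioms(2) by blast
    have proj: "(\<lambda>\<sigma>. \<sigma> y) \<in> hom (sections ?D ?U) ?S"
      using y by (auto simp: godement_sheaf_def hom_def)
    have mem: "restr I (nb X V zs) ?N (c zs) \<in> carrier (sections I ?N)"
      if "set zs \<subseteq> set (y # xs)" "length zs = Suc n" for zs
      by (rule I.cochains_restr[OF V c _ that(2) oN nb_antimono[OF that(1)]]) (use that yX in auto)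
    have car: "cobd (sections I ?N) (\<lambda>ys. restr I (nb X V (y # ys)) ?N (c (y # ys))) xs \<in> carrier (sections I ?N)"
      by (rule group.cobd_closed[OF I.group_sections[OF oN]]) (rule mem, use xs in auto)
    have "delta X ?D V b xs y = cobd ?S (\<lambda>ys. restr ?D (nb X V ys) ?U (b ys) y) xs"
      unfolding delta_def
      by (rule cobd_hom[OF D.group_sections[OF oU] gS proj], rule D.cochains_restr[OF V b _ _ oU])
        (use xs in \<open>auto intro: subsetD[OF nb_antimono]\<close>)
    also have "\<dots> = cobd ?S (\<lambda>ys. germ X I y ?N (restr I (nb X V (y # ys)) ?N (c (y # ys)))) xs"
    proof (rule cobd_cong)
      fix ys assume ys: "set ys \<subseteq> set xs" "Suc (length ys) = length xs"
      have y': "set ys \<subseteq> topspace X" "y \<in> nb X V ys" "length (y # ys) = Suc n"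
        using ys xs subsetD[OF nb_antimono[OF ys(1)] y] by auto
      note yX' = Cons[OF y'(1,2)]
      have "germ X I y ?N (restr I (nb X V (y # ys)) ?N (c (y # ys))) = germ X I y (nb X V (y # ys)) (c (y # ys))"
        by (rule I.germ_restr[OF openin_nb[OF V yX'(3)] oN _ yX(2) cochainsD[OF c yX'(3) y'(3)]])
          (use ys in \<open>auto simp: nb_def\<close>)
      then show "restr ?D (nb X V ys) ?U (b ys) y =
          germ X I y ?N (restr I (nb X V (y # ys)) ?N (c (y # ys)))"
        using y y' by (simp add: godement_sheaf_def b_def)
    qed
    also have "\<dots> = germ X I y ?N (cobd (sections I ?N) (\<lambda>ys. restr I (nb X V (y # ys)) ?N (c (y # ys))) xs)"
      by (rule cobd_hom[symmetric, OF I.group_sections[OF oN] gS I.germ_hom[OF oN yX(2)]], rule mem)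
        (use xs in auto)
    \<comment> \<open>The cocycle condition at \<open>y # xs\<close>: the face that omits
      \<open>y\<close> equals the alternating sum of the faces that keep it.\<close>
    also have "cobd (sections I ?N) (\<lambda>ys. restr I (nb X V (y # ys)) ?N (c (y # ys))) xs =
        restr I ?U ?N (c xs)"
    proof (rule cobd_Cons_eq_one[symmetric, OF I.group_sections[OF oN] _ _ car])
      show "cobd (sections I ?N) (\<lambda>ys. restr I (nb X V ys) ?N (c ys)) (y # xs) = \<one>\<^bsub>sections I ?N\<^esub>"
        using cocycle[of "y # xs"] yX xs unfolding delta_def by simp
    qed (rule mem, use xs in auto)
    also have "germ X I y ?N (restr I ?U ?N (c xs)) = germ X I y ?U (c xs)"
      by (rule I.germ_restr[OF oU oN nb_antimono yX(2) cochainsD[OF c xs]]) auto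
    finally show "delta X ?D V b xs y = germs X I ?U (c xs) y"
      using y by (simp add: germs_def)
  qed
  show ?thesis
  proof (rule that)
    show "(\<lambda>ys. r (nb X V ys) (b ys)) \<in> cochains X I V n"
      by (rule cochains_hom[OF V r(1) b])
    fix xs assume xs: "set xs \<subseteq> topspace X" "length xs = Suc n"
    show "delta X I V (\<lambda>ys. r (nb X V ys) (b ys)) xs = c xs"
      using delta_hom[OF D.ab_presheaf_axioms I.ab_presheaf_axioms r(1) V b xs] delta_b[OF xs]
        r(2)[OF openin_nb[OF V xs(1)] cochainsD[OF c xs]] by simp
  qed
qed

section \<open>Refinements in compact Hausdorff spaces\<close>

text \<open>Regularity gives closed neighbourhoods inside the sets \<open>V x\<close>, and
  compactness leaves finitely many of them.\<close>

lemma shrinking: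
  assumes X: "compact_space X" "Hausdorff_space X" and V: "cover_family X V"
  obtains T K where "finite T" "T \<subseteq> topspace X"
    "\<And>t. t \<in> T \<Longrightarrow> closedin X (K t) \<and> K t \<subseteq> V t"
    "topspace X \<subseteq> (\<Union>t\<in>T. X interior_of K t)"
proof -
  have "neighbourhood_base_of (closedin X) X"
    using compact_Hausdorff_imp_regular_space[OF X] neighbourhood_base_of_closedin by blast
  then have "\<forall>x\<in>topspace X. \<exists>U K. openin X U \<and> closedin X K \<and> x \<in> U \<and> U \<subseteq> K \<and> K \<subseteq> V x"
    using V unfolding neighbourhood_base_of cover_family_def by blast
  then obtain U K where UK: "\<And>x. x \<in> topspace X \<Longrightarrow>
      openin X (U x) \<and> closedin X (K x) \<and> x \<in> U x \<and> U x \<subseteq> K x \<and> K x \<subseteq> V x"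
    by metis
  have "(\<forall>W\<in>U ` topspace X. openin X W) \<and> topspace X \<subseteq> \<Union>(U ` topspace X)"
    using UK by blast
  then obtain \<F> where \<F>: "finite \<F>" "\<F> \<subseteq> U ` topspace X" "topspace X \<subseteq> \<Union>\<F>"
    using X(1) unfolding compact_space_alt by meson
  obtain T where T: "finite T" "T \<subseteq> topspace X" "\<F> = U ` T"
    using finite_subset_image[OF \<F>(1,2)] by blast
  show ?thesis
  proof (rule that[OF T(1,2)])
    show "closedin X (K t) \<and> K t \<subseteq> V t" if "t \<in> T" for t using UK T that by blast
    show "topspace X \<subseteq> (\<Union>t\<in>T. X interior_of K t)"
    proof
      fix x assume "x \<in> topspace X"
      then obtain t where t: "t \<in> T" "x \<in> U t" using \<F> T by blast
      have "U t \<subseteq> X interior_of K t"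
        using UK[of t] t T by (intro interior_of_maximal) auto
      then show "x \<in> (\<Union>t\<in>T. X interior_of K t)" using t by blast
    qed
  qed
qed

text \<open>Removing every closed set that misses \<open>x\<close> leaves a neighbourhood of
  \<open>x\<close> which meets only those sets \<open>K t\<close> that contain
  \<open>x\<close>.\<close>

definition avoid :: "'x topology \<Rightarrow> 'i set \<Rightarrow> ('i \<Rightarrow> 'x set) \<Rightarrow> 'x \<Rightarrow> 'x set"
  where "avoid X T K x = topspace X - (\<Union>t\<in>{t\<in>T. x \<notin> K t}. K t)"

lemma avoid_nbhd:
  assumes "finite T" "\<And>t. t \<in> T \<Longrightarrow> closedin X (K t)" "x \<in> topspace X"
  shows "openin X (avoid X T K x)" "x \<in> avoid X T K x"
  using assms unfolding avoid_def by (auto intro!: openin_diff closedin_Union)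

lemma avoid_mem: "\<lbrakk>y \<in> avoid X T K x; t \<in> T; y \<in> K t\<rbrakk> \<Longrightarrow> x \<in> K t"
  by (auto simp: avoid_def)

text \<open>A point common to the sets \<open>avoid X T K x\<close> lies in some \<open>K t\<close>,
  and \<open>avoid_mem\<close> then forces every index \<open>x\<close> into this same
  \<open>K t\<close>.\<close>

lemma star_refinement:
  assumes "finite T" "\<And>t. t \<in> T \<Longrightarrow> closedin X (K t)" "topspace X \<subseteq> (\<Union>t\<in>T. K t)"
  obtains W where "cover_family X W"
    "\<And>xs. nb X W xs \<noteq> {} \<Longrightarrow> \<exists>t\<in>T. set xs \<subseteq> K t"
proof (rule that)
  show "cover_family X (avoid X T K)"
    using avoid_nbhd[OF assms(1,2)] by (simp add: cover_family_def)
  fix xs assume "nb X (avoid X T K) xs \<noteq> {}"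
  then obtain y where y: "y \<in> topspace X" "\<And>x. x \<in> set xs \<Longrightarrow> y \<in> avoid X T K x"
    by (auto simp: nb_def)
  obtain t where "t \<in> T" "y \<in> K t" using y(1) assms(3) by blast
  then show "\<exists>t\<in>T. set xs \<subseteq> K t" using y(2) avoid_mem by (metis subsetI)
qed

text \<open>Turns a property that holds near each point into one that holds over all intersections
  of a finer cover at once. Indices are mapped into a finite set, so at each point only finitely
  many tuples impose a condition and their neighbourhoods can be intersected. Local lifts of Cech
  cochains are obtained in this way.\<close>

lemma refinement:
  assumes X: "compact_space X" "Hausdorff_space X" and V: "cover_family X V"
    and mono: "\<And>ts U U'. \<lbrakk>set ts \<subseteq> topspace X; length ts = Suc m; P ts U; openin X U; openin X U';
        U' \<subseteq> U; U \<subseteq> nb X V ts\<rbrakk> \<Longrightarrow> P ts U'"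
    and empty: "\<And>ts. \<lbrakk>set ts \<subseteq> topspace X; length ts = Suc m\<rbrakk> \<Longrightarrow> P ts {}"
    and local: "\<And>ts y. \<lbrakk>set ts \<subseteq> topspace X; length ts = Suc m; y \<in> nb X V ts\<rbrakk>
      \<Longrightarrow> \<exists>U. openin X U \<and> y \<in> U \<and> U \<subseteq> nb X V ts \<and> P ts U"
  obtains W \<tau> where "cover_family X W" "crefines X V W \<tau>"
    "\<And>xs. \<lbrakk>set xs \<subseteq> topspace X; length xs = Suc m\<rbrakk> \<Longrightarrow> P (map \<tau> xs) (nb X W xs)"
proof -
  obtain T K where T: "finite T" "T \<subseteq> topspace X"
    and K: "\<And>t. t \<in> T \<Longrightarrow> closedin X (K t)" "\<And>t. t \<in> T \<Longrightarrow> K t \<subseteq> V t"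
      "topspace X \<subseteq> (\<Union>t\<in>T. X interior_of K t)"
    using shrinking[OF X V] by metis
  define L where "L = {ts. set ts \<subseteq> T \<and> length ts = Suc m}"
  have L: "finite L" unfolding L_def by (rule finite_lists_length_eq[OF T(1)])
  have "\<forall>ts y. \<exists>U. set ts \<subseteq> topspace X \<longrightarrow> length ts = Suc m \<longrightarrow> y \<in> nb X V ts
      \<longrightarrow> openin X U \<and> y \<in> U \<and> U \<subseteq> nb X V ts \<and> P ts U"
    using local by metis
  then obtain N where N: "\<And>ts y. \<lbrakk>set ts \<subseteq> topspace X; length ts = Suc m; y \<in> nb X V ts\<rbrakk>
      \<Longrightarrow> openin X (N ts y) \<and> y \<in> N ts y \<and> N ts y \<subseteq> nb X V ts \<and> P ts (N ts y)"
    by metis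
  define O' where "O' y = (\<Inter>ts\<in>{ts\<in>L. y \<in> nb X V ts}. N ts y) \<inter> topspace X" for y
  have O': "openin X (O' y)" "y \<in> O' y" if "y \<in> topspace X" for y
  proof -
    show "openin X (O' y)" unfolding O'_def
    proof (rule openin_INT)
      show "finite {ts \<in> L. y \<in> nb X V ts}" using L by simp
    qed (use N T in \<open>auto simp: L_def\<close>)
    show "y \<in> O' y" unfolding O'_def using that N T by (auto simp: L_def)
  qed
  define \<tau> where "\<tau> x = (SOME t. t \<in> T \<and> x \<in> X interior_of K t)" for x
  have \<tau>: "\<tau> x \<in> T" "x \<in> X interior_of K (\<tau> x)" if "x \<in> topspace X" for x
  proof -
    have "\<exists>t. t \<in> T \<and> x \<in> X interior_of K t" using that K(3) by blast
    then have "\<tau> x \<in> T \<and> x \<in> X interior_of K (\<tau> x)" unfolding \<tau>_def by (rule someI_ex)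
    then show "\<tau> x \<in> T" "x \<in> X interior_of K (\<tau> x)" by auto
  qed
  \<comment> \<open>\<open>O' x\<close> serves all tuples from \<open>T\<close> near
    \<open>x\<close>; \<open>V x\<close> and the interior of \<open>K (\<tau> x)\<close> yield the
    refinement; the \<open>avoid\<close> set transfers membership from a common point to the index
    \<open>x\<close>.\<close>
  define W where "W x = O' x \<inter> V x \<inter> X interior_of K (\<tau> x) \<inter> avoid X T K x" for x
  have W: "cover_family X W"
    unfolding cover_family_def W_def
    using O' \<tau> V avoid_nbhd[of T X K, OF T(1) K(1)] by (simp add: cover_family_def openin_Int)
  have sub: "W x \<subseteq> K (\<tau> x)" for x
    using interior_of_subset[of X "K (\<tau> x)"] by (auto simp: W_def)
  have ref: "crefines X V W \<tau>"
    unfolding crefines_def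
  proof (intro ballI conjI)
    fix x assume x: "x \<in> topspace X"
    show "\<tau> x \<in> topspace X" using \<tau>[OF x] T by auto
    show "W x \<subseteq> V x \<inter> V (\<tau> x)" using sub[of x] K(2) \<tau>[OF x] by (auto simp: W_def)
  qed
  show ?thesis
  proof (rule that[OF W ref])
    fix xs assume xs: "set xs \<subseteq> topspace X" "length xs = Suc m"
    let ?ts = "map \<tau> xs"
    have ts: "?ts \<in> L" "set ?ts \<subseteq> topspace X" "length ?ts = Suc m"
      using xs \<tau> T by (auto simp: L_def)
    show "P ?ts (nb X W xs)"
    proof (cases "nb X W xs = {}")
      case True
      then show ?thesis using empty ts by simp
    next
      case False
      then obtain y where y: "\<And>x. x \<in> set xs \<Longrightarrow> y \<in> W x" by (auto simp: nb_def)
      obtain x0 xs' where x0: "xs = x0 # xs'" using xs by (cases xs) auto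
      \<comment> \<open>The common point \<open>y\<close> lies in \<open>K (\<tau> x)\<close> and in
        the \<open>avoid\<close> set of the first index \<open>x0\<close>, so \<open>x0\<close> lies
        in \<open>K (\<tau> x)\<close> too. Hence the neighbourhood chosen at \<open>x0\<close> for
        the tuple \<open>?ts\<close> exists, and it contains the whole intersection.\<close>
      have "x0 \<in> V (\<tau> x)" if "x \<in> set xs" for x
      proof -
        have "y \<in> K (\<tau> x)" using y[OF that] sub by blast
        moreover have "y \<in> avoid X T K x0" using y[of x0] x0 by (simp add: W_def)
        ultimately show ?thesis using avoid_mem \<tau> K(2) that xs by (metis subsetD)
      qed
      then have m: "x0 \<in> nb X V ?ts" using xs x0 by (auto simp: nb_def)
      have N0: "openin X (N ?ts x0)" "N ?ts x0 \<subseteq> nb X V ?ts" "P ?ts (N ?ts x0)"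
        using N[OF ts(2,3) m] by auto
      have "nb X W xs \<subseteq> W x0" using x0 by (auto simp: nb_def)
      also have "\<dots> \<subseteq> N ?ts x0" using m ts by (auto simp: W_def O'_def)
      finally show ?thesis
        using mono[OF ts(2,3) N0(3,1) openin_nb[OF W xs(1)] _ N0(2)] by simp
    qed
  qed
qed

section \<open>Dimension shifting along an injective resolution\<close>

text \<open>A quotient in bijection with a singleton has only one coset. The coset of
  \<open>s\<close> is therefore that of the unit, which consists of coboundaries.\<close>

lemma trivial_cohomologyD:
  assumes I: "ab_presheaf X (I n)" "ab_presheaf X (I (Suc n))"
    and d: "d n \<in> sheaf_hom X (I n) (I (Suc n))"
    and triv: "complex_cohomology X I d (Suc n) \<cong> singleton_group ()"
    and s: "s \<in> carrier (sections (I (Suc n)) (topspace X))"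
    and ds: "d (Suc n) (topspace X) s = \<one>\<^bsub>sections (I (Suc (Suc n))) (topspace X)\<^esub>"
    and one: "d (Suc n) (topspace X) \<one>\<^bsub>sections (I (Suc n)) (topspace X)\<^esub> =
      \<one>\<^bsub>sections (I (Suc (Suc n))) (topspace X)\<^esub>"
  obtains t where "t \<in> carrier (sections (I n) (topspace X))" "d n (topspace X) t = s"
proof -
  let ?G = "sections (I (Suc n)) (topspace X)"
  let ?Z = "cocycles X I d (Suc n)" and ?B = "coboundaries X I d (Suc n)"
  let ?Q = "complex_cohomology X I d (Suc n)"
  interpret G: group ?G using I(2) by (simp add: ab_presheaf.group_sections)
  interpret H: group "sections (I n) (topspace X)" using I(1) by (simp add: ab_presheaf.group_sections)
  obtain h where "bij_betw h (carrier ?Q) {()}"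
    using triv by (auto simp: is_iso_def iso_def singleton_group_def)
  then have sub: "A = B" if "A \<in> carrier ?Q" "B \<in> carrier ?Q" for A B
    using that by (auto simp: bij_betw_def inj_on_def)
  have Z: "s \<in> ?Z" "\<one>\<^bsub>?G\<^esub> \<in> ?Z"
    using s ds one by (auto simp: cocycles_def kernel_def global_sections_def)
  define C where "C a = ?B #>\<^bsub>?G\<lparr>carrier := ?Z\<rparr>\<^esub> a" for a
  have "C a \<in> carrier ?Q" if "a \<in> ?Z" for a
    using that by (auto simp: complex_cohomology_def FactGroup_def RCOSETS_def C_def global_sections_def)
  then have eq: "C s = C \<one>\<^bsub>?G\<^esub>" using sub Z by blast
  have B: "?B = d n (topspace X) ` carrier (sections (I n) (topspace X))"
    by (simp add: coboundaries_def global_sections_def)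
  have hom: "d n (topspace X) \<in> hom (sections (I n) (topspace X)) ?G"
    using d by (simp add: sheaf_hom_def)
  have "\<one>\<^bsub>?G\<^esub> \<in> ?B"
    unfolding B using hom_one[OF hom H.is_group G.is_group] H.one_closed by (metis imageI)
  then have "s \<in> C s" using s by (force simp: C_def r_coset_def)
  then obtain b where b: "b \<in> ?B" "s = b \<otimes>\<^bsub>?G\<^esub> \<one>\<^bsub>?G\<^esub>"
    unfolding eq by (auto simp: C_def r_coset_def)
  then obtain t where t: "t \<in> carrier (sections (I n) (topspace X))" "b = d n (topspace X) t"
    unfolding B by blast
  then have "b \<in> carrier ?G" using hom by (auto simp: hom_def)
  then show ?thesis using that t b by simp
qed

locale injective_complex =
  fixes X :: "'x topology" and I :: "nat \<Rightarrow> ('x, 'x list \<Rightarrow> nat) presheaf_data"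
    and d :: "nat \<Rightarrow> 'x set \<Rightarrow> ('x list \<Rightarrow> nat) \<Rightarrow> 'x list \<Rightarrow> nat"
  assumes injective: "injective_sheaf X (I n)"
    and d_hom: "d n \<in> sheaf_hom X (I n) (I (Suc n))"
    and exact: "sheaf_exact X (I n) (d n) (I (Suc n)) (d (Suc n)) (I (Suc (Suc n)))"
begin

lemma sheaf: "ab_sheaf X (I n)"
  using injective by (simp add: injective_sheaf_def)

lemma presheaf: "ab_presheaf X (I n)"
  using sheaf ab_sheaf.axioms(1) by blast

lemma d_closed: "\<lbrakk>openin X U; s \<in> carrier (sections (I n) U)\<rbrakk> \<Longrightarrow> d n U s \<in> carrier (sections (I (Suc n)) U)"
  by (rule sheaf_homD(2)[OF d_hom])

lemma d_restr: "\<lbrakk>openin X U; openin X V; V \<subseteq> U; s \<in> carrier (sections (I n) U)\<rbrakk>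
    \<Longrightarrow> d n V (restr (I n) U V s) = restr (I (Suc n)) U V (d n U s)"
  by (rule sheaf_homD(3)[OF d_hom])

lemma d_group_hom: "openin X U \<Longrightarrow> group_hom (sections (I n) U) (sections (I (Suc n)) U) (d n U)"
  by (simp add: group_hom_def group_hom_axioms_def sheaf_homD(1)[OF d_hom]
      ab_presheaf.group_sections[OF presheaf])

lemma d_one: "openin X U \<Longrightarrow> d n U \<one>\<^bsub>sections (I n) U\<^esub> = \<one>\<^bsub>sections (I (Suc n)) U\<^esub>"
  using d_group_hom group_hom.hom_one by metis

lemma d_exact_iff:
  assumes "openin X U" "s \<in> carrier (sections (I (Suc n)) U)"
  shows "d (Suc n) U s = \<one>\<^bsub>sections (I (Suc (Suc n))) U\<^esub> \<longleftrightarrow>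
    (\<forall>x\<in>U. \<exists>V t. openin X V \<and> x \<in> V \<and> V \<subseteq> U \<and> t \<in> carrier (sections (I n) V)
      \<and> d n V t = restr (I (Suc n)) U V s)"
  by (rule exact[of n, unfolded sheaf_exact_def, THEN spec, THEN spec, THEN mp, OF conjI[OF assms]])

lemma d_d:
  assumes U: "openin X U" and s: "s \<in> carrier (sections (I n) U)"
  shows "d (Suc n) U (d n U s) = \<one>\<^bsub>sections (I (Suc (Suc n))) U\<^esub>"
  unfolding d_exact_iff[OF U d_closed[OF U s]]
  using U s ab_presheaf.restr_id[OF presheaf U d_closed[OF U s]]
  by (intro ballI exI[of _ U] exI[of _ s]) simp

lemma d_exact:
  assumes "openin X U" "s \<in> carrier (sections (I (Suc n)) U)"
    and "d (Suc n) U s = \<one>\<^bsub>sections (I (Suc (Suc n))) U\<^esub>" "x \<in> U"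
  obtains V t where "openin X V" "x \<in> V" "V \<subseteq> U" "t \<in> carrier (sections (I n) V)"
      "d n V t = restr (I (Suc n)) U V s"
proof -
  from assms(3,4) obtain V t where "openin X V \<and> x \<in> V \<and> V \<subseteq> U \<and> t \<in> carrier (sections (I n) V)
      \<and> d n V t = restr (I (Suc n)) U V s"
    unfolding d_exact_iff[OF assms(1,2)] by blast
  then show ?thesis using that by blast
qed

text \<open>Cech cochains of the kernel sheaf of \<open>d j\<close>, without forming that
  sheaf.\<close>

definition closed_cochains :: "nat \<Rightarrow> ('x \<Rightarrow> 'x set) \<Rightarrow> nat \<Rightarrow> ('x list \<Rightarrow> 'x list \<Rightarrow> nat) set"
  where "closed_cochains j V n = {c \<in> cochains X (I j) V n. \<forall>xs. set xs \<subseteq> topspace X \<and> length xs = n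
    \<longrightarrow> d j (nb X V xs) (c xs) = \<one>\<^bsub>sections (I (Suc j)) (nb X V xs)\<^esub>}"

text \<open>The quotient of the pulled back \<open>a\<close> by \<open>delta b\<close> is closed
  because both have the same image under \<open>d j\<close>, and dividing by a coboundary does not
  change the Cech coboundary.\<close>

lemma correct_by_lift:
  assumes V: "cover_family X V" and W: "cover_family X W" and \<tau>: "crefines X V W \<tau>"
    and a: "a \<in> cochains X (I j) V (Suc i)"
    and b: "b \<in> cochains X (I j) W i"
    and eq: "\<And>xs. \<lbrakk>set xs \<subseteq> topspace X; length xs = Suc i\<rbrakk> \<Longrightarrow>
      delta X (I (Suc j)) W (\<lambda>ys. d j (nb X W ys) (b ys)) xs =
      pull X (I (Suc j)) V W \<tau> (\<lambda>ys. d j (nb X V ys) (a ys)) xs"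
  obtains e where "e \<in> closed_cochains j W (Suc i)"
    "\<And>xs. \<lbrakk>set xs \<subseteq> topspace X; length xs = Suc (Suc i)\<rbrakk> \<Longrightarrow>
      delta X (I j) W e xs = pull X (I j) V W \<tau> (delta X (I j) V a) xs"
proof -
  interpret P: ab_presheaf X "I j" by (rule presheaf)
  interpret Q: ab_presheaf X "I (Suc j)" by (rule presheaf)
  let ?a = "pull X (I j) V W \<tau> a" and ?b = "delta X (I j) W b"
  define e where "e = (\<lambda>ys. ?a ys \<otimes>\<^bsub>sections (I j) (nb X W ys)\<^esub> inv\<^bsub>sections (I j) (nb X W ys)\<^esub> (?b ys))"
  have ab: "?a \<in> cochains X (I j) W (Suc i)" "?b \<in> cochains X (I j) W (Suc i)"
    using P.pull_cochains[OF V W \<tau> a] P.delta_cochains[OF W b] by auto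
  have e: "e \<in> cochains X (I j) W (Suc i)"
    unfolding e_def by (rule P.cochains_div[OF W ab])
  have "d j (nb X W xs) (e xs) = \<one>\<^bsub>sections (I (Suc j)) (nb X W xs)\<^esub>"
    if xs: "set xs \<subseteq> topspace X" "length xs = Suc i" for xs
  proof -
    note o = openin_nb[OF W xs(1)]
    note m = refines_map[OF \<tau> xs(1)]
    have am: "a (map \<tau> xs) \<in> carrier (sections (I j) (nb X V (map \<tau> xs)))"
      by (rule cochainsD[OF a m]) (simp add: xs)
    interpret h: group_hom "sections (I j) (nb X W xs)" "sections (I (Suc j)) (nb X W xs)" "d j (nb X W xs)"
      using o by (rule d_group_hom)
    have "d j (nb X W xs) (?a xs) = pull X (I (Suc j)) V W \<tau> (\<lambda>ys. d j (nb X V ys) (a ys)) xs"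
      unfolding pull_def by (rule d_restr[OF openin_nb[OF V m] o nb_refines(1)[OF \<tau> xs(1)] am])
    also have "\<dots> = d j (nb X W xs) (?b xs)"
      using eq[OF xs] delta_hom[OF presheaf presheaf d_hom W b xs] by simp
    finally show ?thesis
      using cochainsD[OF ab(1) xs] cochainsD[OF ab(2) xs] by (simp add: e_def)
  qed
  then have "e \<in> closed_cochains j W (Suc i)"
    using e by (simp add: closed_cochains_def)
  moreover have "delta X (I j) W e xs = pull X (I j) V W \<tau> (delta X (I j) V a) xs"
    if xs: "set xs \<subseteq> topspace X" "length xs = Suc (Suc i)" for xs
  proof -
    interpret G: group "sections (I j) (nb X W xs)"
      by (rule P.group_sections[OF openin_nb[OF W xs(1)]])
    have "delta X (I j) W e xs = delta X (I j) W ?a xs"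
      unfolding e_def P.delta_div[OF W ab xs] P.delta_delta[OF W b xs]
      using cochainsD[OF P.delta_cochains[OF W ab(1)] xs] by simp
    then show ?thesis by (simp only: P.delta_pull[OF V W \<tau> a xs])
  qed
  ultimately show ?thesis by (rule that)
qed

text \<open>Dimension shifting: \<open>c\<close> has Cech degree \<open>i + 1\<close> with values in
  the kernel of \<open>d j\<close>. Bounding \<open>c\<close> by some \<open>a\<close> in the
  injective sheaf and passing to \<open>d j\<close> of \<open>a\<close> trades one Cech degree for
  one step of the resolution, so \<open>j + i\<close> is kept. At \<open>i = 0\<close> the vanishing
  of cohomology in degree \<open>r + 1\<close>, given as \<open>surj\<close>, ends the
  process.\<close>

lemma closed_cocycle_bounds:
  assumes X: "compact_space X" "Hausdorff_space X"
    and surj: "\<And>s. \<lbrakk>s \<in> carrier (sections (I (Suc r)) (topspace X));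
      d (Suc r) (topspace X) s = \<one>\<^bsub>sections (I (Suc (Suc r))) (topspace X)\<^esub>\<rbrakk>
      \<Longrightarrow> \<exists>t \<in> carrier (sections (I r) (topspace X)). d r (topspace X) t = s"
    and r: "j + i = r"
    and V: "cover_family X V" and c: "c \<in> closed_cochains j V (Suc (Suc i))"
    and cocycle: "\<And>xs. \<lbrakk>set xs \<subseteq> topspace X; length xs = Suc (Suc (Suc i))\<rbrakk>
      \<Longrightarrow> delta X (I j) V c xs = \<one>\<^bsub>sections (I j) (nb X V xs)\<^esub>"
  shows "\<exists>W \<tau> e. cover_family X W \<and> crefines X V W \<tau> \<and> e \<in> closed_cochains j W (Suc i) \<and>
    (\<forall>xs. set xs \<subseteq> topspace X \<and> length xs = Suc (Suc i)
      \<longrightarrow> delta X (I j) W e xs = pull X (I j) V W \<tau> c xs)"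
  using r V c cocycle
proof (induction i arbitrary: j V c)
  case (0 j V c)
  note V = 0(2)
  have j: "j = r" using 0 by simp
  interpret P: ab_presheaf X "I j" by (rule presheaf)
  interpret Q: ab_sheaf X "I (Suc j)" by (rule sheaf)
  have c: "c \<in> cochains X (I j) V (Suc (Suc 0))" using 0(3) by (simp add: closed_cochains_def)
  obtain a where a: "a \<in> cochains X (I j) V (Suc 0)"
    and da: "\<And>xs. \<lbrakk>set xs \<subseteq> topspace X; length xs = Suc (Suc 0)\<rbrakk> \<Longrightarrow> delta X (I j) V a xs = c xs"
    using cech_acyclic[OF injective V c 0(4)] by blast
  let ?a = "\<lambda>ys. d j (nb X V ys) (a ys)"
  have a': "?a \<in> cochains X (I (Suc j)) V (Suc 0)"
    by (rule cochains_hom[OF V d_hom a])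
  have "delta X (I (Suc j)) V ?a xs = \<one>\<^bsub>sections (I (Suc j)) (nb X V xs)\<^esub>"
    if xs: "set xs \<subseteq> topspace X" "length xs = Suc (Suc 0)" for xs
    using delta_hom[OF presheaf presheaf d_hom V a xs] da[OF xs] xs 0(3)
    by (simp add: closed_cochains_def)
  \<comment> \<open>At the augmentation, exactness is gluing: \<open>b []\<close> is the global
    section with restrictions \<open>?a [y]\<close>.\<close>
  then obtain b where b: "b \<in> cochains X (I (Suc j)) V 0"
    and db: "\<And>xs. \<lbrakk>set xs \<subseteq> topspace X; length xs = Suc 0\<rbrakk> \<Longrightarrow> delta X (I (Suc j)) V b xs = ?a xs"
    using cech_acyclic[OF injective V a'] by blast
  have nb0: "nb X V [] = topspace X" by (simp add: nb_def)
  have b0: "b [] \<in> carrier (sections (I (Suc j)) (topspace X))"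
    using cochainsD[OF b, of "[]"] nb0 by simp
  have "d (Suc j) (topspace X) (b []) = \<one>\<^bsub>sections (I (Suc (Suc j))) (topspace X)\<^esub>"
  proof (rule ab_sheaf.section_eqI[OF sheaf openin_topspace])
    show "d (Suc j) (topspace X) (b []) \<in> carrier (sections (I (Suc (Suc j))) (topspace X))"
      by (rule d_closed[OF openin_topspace b0])
    show "\<one>\<^bsub>sections (I (Suc (Suc j))) (topspace X)\<^esub> \<in> carrier (sections (I (Suc (Suc j))) (topspace X))"
      using ab_presheaf.group_sections[OF presheaf openin_topspace] group.is_monoid monoid.one_closed by blast
    fix y assume y: "y \<in> topspace X"
    let ?N = "nb X V [y]"
    have xs: "set [y] \<subseteq> topspace X" "length [y] = Suc 0" using y by auto
    note o = openin_nb[OF V xs(1)]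
    have N: "y \<in> ?N" "?N \<subseteq> topspace X" using y V by (auto simp: nb_def cover_family_def)
    have ay: "a [y] \<in> carrier (sections (I j) ?N)" by (rule cochainsD[OF a xs])
    interpret G: group "sections (I (Suc j)) ?N" by (rule Q.group_sections[OF o])
    have "restr (I (Suc j)) (topspace X) ?N (b []) \<in> carrier (sections (I (Suc j)) ?N)"
      by (rule Q.restr_closed[OF openin_topspace o N(2) b0])
    then have eq: "restr (I (Suc j)) (topspace X) ?N (b []) = d j ?N (a [y])"
      using db[OF xs] nb0 by (simp add: delta_def)
    have "restr (I (Suc (Suc j))) (topspace X) ?N (d (Suc j) (topspace X) (b [])) =
        d (Suc j) ?N (d j ?N (a [y]))"
      using d_restr[OF openin_topspace o N(2) b0] eq by simp
    also have "\<dots> = \<one>\<^bsub>sections (I (Suc (Suc j))) ?N\<^esub>" by (rule d_d[OF o ay])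
    also have "\<dots> = restr (I (Suc (Suc j))) (topspace X) ?N \<one>\<^bsub>sections (I (Suc (Suc j))) (topspace X)\<^esub>"
      by (rule ab_presheaf.restr_one[OF presheaf openin_topspace o N(2), symmetric])
    finally show "\<exists>W. openin X W \<and> y \<in> W \<and> W \<subseteq> topspace X \<and>
        restr (I (Suc (Suc j))) (topspace X) W (d (Suc j) (topspace X) (b [])) =
        restr (I (Suc (Suc j))) (topspace X) W \<one>\<^bsub>sections (I (Suc (Suc j))) (topspace X)\<^esub>"
      using o N by blast
  qed
  then obtain t where t: "t \<in> carrier (sections (I j) (topspace X))" "d j (topspace X) t = b []"
    using surj b0 j by blast
  have t': "(\<lambda>_. t) \<in> cochains X (I j) V 0"
    using t nb0 by (simp add: cochains_def)
  have eq: "delta X (I (Suc j)) V (\<lambda>ys. d j (nb X V ys) t) xs = pull X (I (Suc j)) V V id ?a xs"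
    if xs: "set xs \<subseteq> topspace X" "length xs = Suc 0" for xs
  proof -
    have "delta X (I (Suc j)) V (\<lambda>ys. d j (nb X V ys) t) xs = delta X (I (Suc j)) V b xs"
      by (rule Q.delta_cong[OF _ xs]) (use nb0 t in simp)
    then show ?thesis using db[OF xs] Q.pull_id[OF V a' xs] by simp
  qed
  obtain e where e: "e \<in> closed_cochains j V (Suc 0)"
    "\<And>xs. \<lbrakk>set xs \<subseteq> topspace X; length xs = Suc (Suc 0)\<rbrakk> \<Longrightarrow>
      delta X (I j) V e xs = pull X (I j) V V id (delta X (I j) V a) xs"
    using correct_by_lift[OF V V refines_id a t' eq] by blast
  have "delta X (I j) V e xs = pull X (I j) V V id c xs"
    if "set xs \<subseteq> topspace X" "length xs = Suc (Suc 0)" for xs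
    using e(2)[OF that] da[OF that] that by (simp add: pull_def)
  then show ?case using V refines_id e(1) by blast
next
  case (Suc i j V c)
  note V = Suc.prems(2)
  interpret P: ab_presheaf X "I j" by (rule presheaf)
  interpret Q: ab_sheaf X "I (Suc j)" by (rule sheaf)
  have c: "c \<in> cochains X (I j) V (Suc (Suc (Suc i)))" using Suc.prems(3) by (simp add: closed_cochains_def)
  obtain a where a: "a \<in> cochains X (I j) V (Suc (Suc i))"
    and da: "\<And>xs. \<lbrakk>set xs \<subseteq> topspace X; length xs = Suc (Suc (Suc i))\<rbrakk> \<Longrightarrow> delta X (I j) V a xs = c xs"
    using cech_acyclic[OF injective V c Suc.prems(4)] by blast
  let ?a = "\<lambda>ys. d j (nb X V ys) (a ys)"
  have a0: "?a \<in> cochains X (I (Suc j)) V (Suc (Suc i))"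
    by (rule cochains_hom[OF V d_hom a])
  have a': "?a \<in> closed_cochains (Suc j) V (Suc (Suc i))"
    using a0 d_d[OF openin_nb[OF V] cochainsD[OF a]] by (simp add: closed_cochains_def)
  have da': "delta X (I (Suc j)) V ?a xs = \<one>\<^bsub>sections (I (Suc j)) (nb X V xs)\<^esub>"
    if xs: "set xs \<subseteq> topspace X" "length xs = Suc (Suc (Suc i))" for xs
    using delta_hom[OF presheaf presheaf d_hom V a xs] da[OF xs] xs Suc.prems(3)
    by (simp add: closed_cochains_def)
  have "Suc j + i = r" using Suc.prems(1) by simp
  from Suc.IH[OF this V a' da'] obtain W \<tau> b where W: "cover_family X W" and \<tau>: "crefines X V W \<tau>"
    and b: "b \<in> closed_cochains (Suc j) W (Suc i)"
    and db: "\<And>xs. \<lbrakk>set xs \<subseteq> topspace X; length xs = Suc (Suc i)\<rbrakk> \<Longrightarrow>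
      delta X (I (Suc j)) W b xs = pull X (I (Suc j)) V W \<tau> ?a xs"
    by blast
  have b0: "b \<in> cochains X (I (Suc j)) W (Suc i)" using b by (simp add: closed_cochains_def)
  \<comment> \<open>The values of \<open>b\<close> are closed, so exactness of the resolution lifts
    them near each point; after refinement the lifts exist over entire intersections.\<close>
  define R where "R ts U \<longleftrightarrow> (\<exists>t \<in> carrier (sections (I j) U). d j U t = restr (I (Suc j)) (nb X W ts) U (b ts))"
    for ts U
  obtain W' \<tau>' where W': "cover_family X W'" and \<tau>': "crefines X W W' \<tau>'"
    and R: "\<And>xs. \<lbrakk>set xs \<subseteq> topspace X; length xs = Suc i\<rbrakk> \<Longrightarrow> R (map \<tau>' xs) (nb X W' xs)"
  proof (rule refinement[OF X W, of i R])
    fix ts U U' assume ts: "set ts \<subseteq> topspace X" "length ts = Suc i" and "R ts U"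
      and U: "openin X U" "openin X U'" "U' \<subseteq> U" "U \<subseteq> nb X W ts"
    then obtain t where t: "t \<in> carrier (sections (I j) U)" "d j U t = restr (I (Suc j)) (nb X W ts) U (b ts)"
      by (auto simp: R_def)
    have "d j U' (restr (I j) U U' t) = restr (I (Suc j)) U U' (restr (I (Suc j)) (nb X W ts) U (b ts))"
      using d_restr[OF U(1-3) t(1)] t(2) by simp
    also have "\<dots> = restr (I (Suc j)) (nb X W ts) U' (b ts)"
      by (rule Q.restr_trans[OF openin_nb[OF W ts(1)] U cochainsD[OF b0 ts]])
    finally show "R ts U'"
      unfolding R_def using P.restr_closed[OF U(1-3) t(1)] by blast
  next
    fix ts assume ts: "set ts \<subseteq> topspace X" "length ts = Suc i"
    have one: "\<one>\<^bsub>sections (I j) {}\<^esub> \<in> carrier (sections (I j) {})"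
      using P.group_sections[OF openin_empty] group.is_monoid monoid.one_closed by blast
    have "d j {} \<one>\<^bsub>sections (I j) {}\<^esub> = restr (I (Suc j)) (nb X W ts) {} (b ts)"
      by (rule Q.section_empty[OF d_closed[OF openin_empty one] Q.cochains_restr[OF W b0 ts openin_empty]]) simp
    then show "R ts {}" unfolding R_def using one by blast
  next
    fix ts y assume ts: "set ts \<subseteq> topspace X" "length ts = Suc i" and y: "y \<in> nb X W ts"
    have "d (Suc j) (nb X W ts) (b ts) = \<one>\<^bsub>sections (I (Suc (Suc j))) (nb X W ts)\<^esub>"
      using b ts by (simp add: closed_cochains_def)
    then show "\<exists>U. openin X U \<and> y \<in> U \<and> U \<subseteq> nb X W ts \<and> R ts U"
      using d_exact[OF openin_nb[OF W ts(1)] cochainsD[OF b0 ts] _ y] unfolding R_def by metis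
  qed blast
  define g where "g xs = (SOME t. t \<in> carrier (sections (I j) (nb X W' xs)) \<and>
    d j (nb X W' xs) t = pull X (I (Suc j)) W W' \<tau>' b xs)" for xs
  have g: "g xs \<in> carrier (sections (I j) (nb X W' xs))"
    "d j (nb X W' xs) (g xs) = pull X (I (Suc j)) W W' \<tau>' b xs"
    if "set xs \<subseteq> topspace X" "length xs = Suc i" for xs
  proof -
    have "\<exists>t. t \<in> carrier (sections (I j) (nb X W' xs)) \<and>
        d j (nb X W' xs) t = pull X (I (Suc j)) W W' \<tau>' b xs"
      using R[OF that] by (auto simp: R_def pull_def)
    then have "g xs \<in> carrier (sections (I j) (nb X W' xs)) \<and>
        d j (nb X W' xs) (g xs) = pull X (I (Suc j)) W W' \<tau>' b xs"
      unfolding g_def by (rule someI_ex)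
    then show "g xs \<in> carrier (sections (I j) (nb X W' xs))"
      "d j (nb X W' xs) (g xs) = pull X (I (Suc j)) W W' \<tau>' b xs" by auto
  qed
  have g': "g \<in> cochains X (I j) W' (Suc i)" using g by (simp add: cochains_def)
  note \<tau>\<tau>' = refines_trans[OF \<tau> \<tau>']
  have eq: "delta X (I (Suc j)) W' (\<lambda>ys. d j (nb X W' ys) (g ys)) xs = pull X (I (Suc j)) V W' (\<tau> \<circ> \<tau>') ?a xs"
    if xs: "set xs \<subseteq> topspace X" "length xs = Suc (Suc i)" for xs
  proof -
    have "delta X (I (Suc j)) W' (\<lambda>ys. d j (nb X W' ys) (g ys)) xs =
        delta X (I (Suc j)) W' (pull X (I (Suc j)) W W' \<tau>' b) xs"
      by (rule Q.delta_cong[OF g(2) xs])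
    also have "\<dots> = pull X (I (Suc j)) W W' \<tau>' (delta X (I (Suc j)) W b) xs"
      by (rule Q.delta_pull[OF W W' \<tau>' b0 xs])
    also have "\<dots> = pull X (I (Suc j)) W W' \<tau>' (pull X (I (Suc j)) V W \<tau> ?a) xs"
      using db[OF refines_map[OF \<tau>' xs(1)]] xs by (simp add: pull_def[of _ _ W W'])
    also have "\<dots> = pull X (I (Suc j)) V W' (\<tau> \<circ> \<tau>') ?a xs"
      by (rule Q.pull_pull[OF V W W' \<tau> \<tau>' a0 xs])
    finally show ?thesis .
  qed
  obtain e where e: "e \<in> closed_cochains j W' (Suc (Suc i))"
    "\<And>xs. \<lbrakk>set xs \<subseteq> topspace X; length xs = Suc (Suc (Suc i))\<rbrakk> \<Longrightarrow>
      delta X (I j) W' e xs = pull X (I j) V W' (\<tau> \<circ> \<tau>') (delta X (I j) V a) xs"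
    using correct_by_lift[OF V W' \<tau>\<tau>' a g' eq] by blast
  have "delta X (I j) W' e xs = pull X (I j) V W' (\<tau> \<circ> \<tau>') c xs"
    if "set xs \<subseteq> topspace X" "length xs = Suc (Suc (Suc i))" for xs
    using e(2)[OF that] da[OF refines_map[OF \<tau>\<tau>' that(1)]] that by (simp add: pull_def)
  then show ?case using W' \<tau>\<tau>' e(1) by blast
qed

end

section \<open>Integer cochains modulo \<open>p\<close>\<close>

text \<open>Realized on natural numbers because the coefficient groups in the vanishing hypothesis
  have type \<open>nat monoid\<close>.\<close>

definition zmod :: "nat \<Rightarrow> nat monoid"
  where "zmod p = \<lparr>carrier = {..<p}, monoid.mult = (\<lambda>a b. (a + b) mod p), one = 0\<rparr>"

lemma comm_group_zmod:
  assumes "p > 0"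
  shows "comm_group (zmod p)"
proof (rule comm_groupI)
  fix a assume a: "a \<in> carrier (zmod p)"
  show "\<exists>b\<in>carrier (zmod p). b \<otimes>\<^bsub>zmod p\<^esub> a = \<one>\<^bsub>zmod p\<^esub>"
    using a assms by (intro bexI[of _ "(p - a) mod p"]) (auto simp: zmod_def mod_add_left_eq)
qed (use assms in \<open>auto simp: zmod_def mod_simps add_ac\<close>)

text \<open>The value \<open>f xs\<close> is read as a constant section over
  \<open>nb X V xs\<close>, embedded in the first sheaf of the resolution. Tuples count as small
  when this set is nonempty, because a section over the empty set does not determine a
  residue.\<close>

lemma cocycle_mod_bounds:
  fixes X :: "'x topology" and f :: "'x list \<Rightarrow> int"
  assumes X: "compact_space X" "Hausdorff_space X" and p: "p > 0"
    and coh: "is_sheaf_cohomology X (constant_sheaf X (zmod p)) (Suc r) (singleton_group ())"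
    and V: "cover_family X V"
    and f: "\<And>xs. \<lbrakk>set xs \<subseteq> topspace X; length xs = Suc (Suc (Suc r)); nb X V xs \<noteq> {}\<rbrakk>
      \<Longrightarrow> int p dvd cob f xs"
  obtains W g where "cover_family X W" "\<And>x. x \<in> topspace X \<Longrightarrow> W x \<subseteq> V x"
    "\<And>xs. \<lbrakk>set xs \<subseteq> topspace X; length xs = Suc (Suc r); nb X W xs \<noteq> {}\<rbrakk>
      \<Longrightarrow> int p dvd f xs - cob g xs"
proof -
  let ?A = "constant_sheaf X (zmod p)"
  obtain \<epsilon> and I :: "nat \<Rightarrow> ('x, 'x list \<Rightarrow> nat) presheaf_data" and d
    where res: "injective_resolution X ?A \<epsilon> I d"
      and triv: "complex_cohomology X I d (Suc r) \<cong> singleton_group ()"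
    using coh by (auto simp: is_sheaf_cohomology_def)
  interpret injective_complex X I d
    using res by unfold_locales (auto simp: injective_resolution_def)
  interpret I0: ab_sheaf X "I 0" by (rule sheaf)
  have \<epsilon>: "\<epsilon> \<in> sheaf_hom X ?A (I 0)" "\<And>U. openin X U \<Longrightarrow> inj_on (\<epsilon> U) (carrier (sections ?A U))"
    and exact0: "sheaf_exact X ?A \<epsilon> (I 0) (d 0) (I 1)"
    using res by (auto simp: injective_resolution_def sheaf_mono_def)
  have surj: "\<exists>t \<in> carrier (sections (I r) (topspace X)). d r (topspace X) t = s"
    if "s \<in> carrier (sections (I (Suc r)) (topspace X))"
      "d (Suc r) (topspace X) s = \<one>\<^bsub>sections (I (Suc (Suc r))) (topspace X)\<^esub>" for s
    using trivial_cohomologyD[of X I r d s, OF presheaf presheaf d_hom triv that d_one[OF openin_topspace]]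
    by blast
  define k where "k U a = (\<lambda>_\<in>U. nat (a mod int p))" for U :: "'x set" and a
  define h where "h U a = \<epsilon> U (k U a)" for U a
  have k: "k U a \<in> carrier (sections ?A U)" if "openin X U" for U a
  proof -
    have lt: "nat (a mod int p) < p" using p by (simp add: nat_less_iff)
    have "continuous_map (subtopology X U) (discrete_topology {..<p}) (k U a)"
      by (rule continuous_map_eq[where f = "\<lambda>_. nat (a mod int p)"]) (use lt in \<open>auto simp: k_def\<close>)
    then show ?thesis
      using lt by (auto simp: k_def constant_sheaf_def zmod_def)
  qed
  have h_closed: "h U a \<in> carrier (sections (I 0) U)" if "openin X U" for U a
    unfolding h_def by (rule sheaf_homD(2)[OF \<epsilon>(1) that k[OF that]])
  have h_hom: "h U \<in> hom integer_group (sections (I 0) U)" if U: "openin X U" for U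
  proof -
    have "k U (a + b) = k U a \<otimes>\<^bsub>sections ?A U\<^esub> k U b" for a b
    proof -
      have "nat ((a + b) mod int p) = (nat (a mod int p) + nat (b mod int p)) mod p"
        using p by (simp add: nat_mod_distrib flip: nat_add_distrib mod_add_eq[of a _ b])
      then show ?thesis by (auto simp: k_def constant_sheaf_def zmod_def)
    qed
    then have "h U (a + b) = h U a \<otimes>\<^bsub>sections (I 0) U\<^esub> h U b" for a b
      unfolding h_def using hom_mult[OF sheaf_homD(1)[OF \<epsilon>(1) U] k[OF U] k[OF U]] by simp
    then show ?thesis using h_closed[OF U] by (auto simp: hom_def)
  qed
  have h_restr: "restr (I 0) U U' (h U a) = h U' a" if U: "openin X U" "openin X U'" "U' \<subseteq> U" for U U' a
  proof -
    have "restr ?A U U' (k U a) = k U' a"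
      using U(3) by (auto simp: k_def constant_sheaf_def restrict_def fun_eq_iff)
    then show ?thesis
      unfolding h_def using sheaf_homD(3)[OF \<epsilon>(1) U k[OF U(1)], of a] by simp
  qed
  have exact_iff: "d 0 U s = \<one>\<^bsub>sections (I 1) U\<^esub> \<longleftrightarrow>
      (\<forall>x\<in>U. \<exists>V t. openin X V \<and> x \<in> V \<and> V \<subseteq> U \<and> t \<in> carrier (sections ?A V)
        \<and> \<epsilon> V t = restr (I 0) U V s)" if "openin X U" "s \<in> carrier (sections (I 0) U)" for U s
    by (rule exact0[unfolded sheaf_exact_def, THEN spec, THEN spec, THEN mp, OF conjI[OF that]])
  have d_h: "d 0 U (h U a) = \<one>\<^bsub>sections (I 1) U\<^esub>" if U: "openin X U" for U a
    unfolding exact_iff[OF U h_closed[OF U]]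
    using U k[OF U, of a] h_restr[OF U U, of a]
    by (intro ballI exI[of _ U] exI[of _ "k U a"]) (simp add: h_def)
  have h_inj: "int p dvd a - b" if U: "openin X U" "U \<noteq> {}" and eq: "h U a = h U b" for U a b
  proof -
    have "k U a = k U b"
      using inj_onD[OF \<epsilon>(2)[OF U(1)] eq[unfolded h_def] k[OF U(1)] k[OF U(1)]] .
    moreover obtain x where "x \<in> U" using U(2) by blast
    ultimately have "nat (a mod int p) = nat (b mod int p)"
      by (auto simp: k_def dest!: fun_cong[where x = x])
    then show ?thesis
      using p by (simp add: eq_nat_nat_iff mod_eq_dvd_iff)
  qed
  have h_local: "\<exists>U'. openin X U' \<and> x \<in> U' \<and> U' \<subseteq> U \<and> (\<exists>a. restr (I 0) U U' s = h U' a)"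
    if U: "openin X U" and s: "s \<in> carrier (sections (I 0) U)" "d 0 U s = \<one>\<^bsub>sections (I 1) U\<^esub>"
      and x: "x \<in> U" for U s x
  proof -
    from s(2) x obtain U1 t where U1: "openin X U1" "x \<in> U1" "U1 \<subseteq> U"
      and t: "t \<in> carrier (sections ?A U1)" "\<epsilon> U1 t = restr (I 0) U U1 s"
      unfolding exact_iff[OF U s(1)] by blast
    define U' where "U' = {y \<in> U1. t y = t x}"
    have cont: "continuous_map (subtopology X U1) (discrete_topology {..<p}) t" and tp: "t x < p"
      using t(1) U1(2) by (auto simp: constant_sheaf_def zmod_def)
    have "openin (subtopology X U1) {y \<in> topspace (subtopology X U1). t y \<in> {t x}}"
      by (rule openin_continuous_map_preimage[OF cont]) (simp add: tp)
    moreover have "{y \<in> topspace (subtopology X U1). t y \<in> {t x}} = U'"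
      using openin_subset[OF U1(1)] by (auto simp: U'_def)
    ultimately have U': "openin X U'"
      using openin_trans_full U1(1) by auto
    have sub: "U' \<subseteq> U1" "x \<in> U'" using U1(2) by (auto simp: U'_def)
    have "restr ?A U1 U' t = k U' (int (t x))"
      using tp sub by (auto simp: constant_sheaf_def k_def U'_def restrict_def fun_eq_iff)
    then have "h U' (int (t x)) = restr (I 0) U1 U' (\<epsilon> U1 t)"
      unfolding h_def using sheaf_homD(3)[OF \<epsilon>(1) U1(1) U' sub(1) t(1)] by simp
    also have "\<dots> = restr (I 0) U U' s"
      unfolding t(2) by (rule I0.restr_trans[OF U U1(1) U' sub(1) U1(3) s(1)])
    finally show ?thesis using U' sub U1(3) by (metis subset_trans)
  qed
  let ?c = "\<lambda>xs. h (nb X V xs) (f xs)"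
  have c0: "?c \<in> cochains X (I 0) V (Suc (Suc r))"
    using h_closed openin_nb[OF V] by (simp add: cochains_def)
  have c: "?c \<in> closed_cochains 0 V (Suc (Suc r))"
    using c0 d_h openin_nb[OF V] by (simp add: closed_cochains_def)
  have delta_h: "delta X (I 0) W (\<lambda>ys. h (nb X W ys) (g ys)) xs = h (nb X W xs) (cob g xs)"
    if W: "cover_family X W" and xs: "set xs \<subseteq> topspace X" for W g xs
  proof -
    note o = openin_nb[OF W xs]
    have "delta X (I 0) W (\<lambda>ys. h (nb X W ys) (g ys)) xs =
        cobd (sections (I 0) (nb X W xs)) (\<lambda>ys. h (nb X W xs) (g ys)) xs"
      unfolding delta_def
    proof (rule cobd_cong)
      fix ys assume ys: "set ys \<subseteq> set xs"
      then have "set ys \<subseteq> topspace X" using xs by blast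
      then show "restr (I 0) (nb X W ys) (nb X W xs) (h (nb X W ys) (g ys)) = h (nb X W xs) (g ys)"
        by (intro h_restr openin_nb[OF W] nb_antimono ys xs)
    qed
    then show ?thesis using cobd_of_int_hom[OF I0.group_sections[OF o] h_hom[OF o]] by simp
  qed
  have "delta X (I 0) V ?c xs = \<one>\<^bsub>sections (I 0) (nb X V xs)\<^esub>"
    if xs: "set xs \<subseteq> topspace X" "length xs = Suc (Suc (Suc r))" for xs
  proof -
    note o = openin_nb[OF V xs(1)]
    interpret h: group_hom integer_group "sections (I 0) (nb X V xs)" "h (nb X V xs)"
      using h_hom[OF o] I0.group_sections[OF o] by (simp add: group_hom_def group_hom_axioms_def)
    have "h (nb X V xs) (cob f xs) = \<one>\<^bsub>sections (I 0) (nb X V xs)\<^esub>"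
    proof (cases "nb X V xs = {}")
      \<comment> \<open>Nothing is assumed about \<open>cob f\<close> on such a tuple, but any two
        sections over the empty set agree.\<close>
      case True
      have "\<one>\<^bsub>sections (I 0) (nb X V xs)\<^esub> \<in> carrier (sections (I 0) (nb X V xs))"
        using I0.group_sections[OF o] group.is_monoid monoid.one_closed by blast
      then show ?thesis
        using h_closed[OF o, of "cob f xs"] unfolding True by (intro I0.section_empty)
    next
      case False
      then have "cob f xs mod int p = 0" using f xs by auto
      then have "k (nb X V xs) (cob f xs) = k (nb X V xs) 0" by (simp add: k_def)
      then have "h (nb X V xs) (cob f xs) = h (nb X V xs) 0" by (simp add: h_def)
      then show ?thesis using h.hom_one by simp
    qed
    then show ?thesis using delta_h[OF V xs(1)] by simp
  qed
  from closed_cocycle_bounds[OF X surj add_0 V c this]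
  obtain W \<tau> e where W: "cover_family X W" and \<tau>: "crefines X V W \<tau>"
    and e: "e \<in> closed_cochains 0 W (Suc r)"
    and de: "\<And>xs. \<lbrakk>set xs \<subseteq> topspace X; length xs = Suc (Suc r)\<rbrakk> \<Longrightarrow>
      delta X (I 0) W e xs = pull X (I 0) V W \<tau> ?c xs"
    by blast
  have e0: "e \<in> cochains X (I 0) W (Suc r)" using e by (simp add: closed_cochains_def)
  \<comment> \<open>A closed section is only locally constant; the refinement is made so fine that a
    single integer describes it over each intersection.\<close>
  define R where "R ts U \<longleftrightarrow> (\<exists>a. restr (I 0) (nb X W ts) U (e ts) = h U a)" for ts U
  obtain W' \<tau>' where W': "cover_family X W'" and \<tau>': "crefines X W W' \<tau>'"
    and R: "\<And>xs. \<lbrakk>set xs \<subseteq> topspace X; length xs = Suc r\<rbrakk> \<Longrightarrow> R (map \<tau>' xs) (nb X W' xs)"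
  proof (rule refinement[OF X W, of r R])
    fix ts U U' assume ts: "set ts \<subseteq> topspace X" "length ts = Suc r" and "R ts U"
      and U: "openin X U" "openin X U'" "U' \<subseteq> U" "U \<subseteq> nb X W ts"
    then obtain a where a: "restr (I 0) (nb X W ts) U (e ts) = h U a" by (auto simp: R_def)
    have "restr (I 0) (nb X W ts) U' (e ts) = restr (I 0) U U' (restr (I 0) (nb X W ts) U (e ts))"
      by (rule I0.restr_trans[symmetric, OF openin_nb[OF W ts(1)] U cochainsD[OF e0 ts]])
    then show "R ts U'" unfolding R_def a using h_restr[OF U(1-3)] by auto
  next
    fix ts assume ts: "set ts \<subseteq> topspace X" "length ts = Suc r"
    have "restr (I 0) (nb X W ts) {} (e ts) = h {} 0"
      by (rule I0.section_empty[OF I0.cochains_restr[OF W e0 ts openin_empty] h_closed[OF openin_empty]]) simp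
    then show "R ts {}" unfolding R_def by blast
  next
    fix ts y assume ts: "set ts \<subseteq> topspace X" "length ts = Suc r" and y: "y \<in> nb X W ts"
    have "d 0 (nb X W ts) (e ts) = \<one>\<^bsub>sections (I 1) (nb X W ts)\<^esub>"
      using e ts by (simp add: closed_cochains_def)
    then show "\<exists>U. openin X U \<and> y \<in> U \<and> U \<subseteq> nb X W ts \<and> R ts U"
      unfolding R_def by (rule h_local[OF openin_nb[OF W ts(1)] cochainsD[OF e0 ts] _ y])
  qed blast
  define g where "g xs = (SOME a. pull X (I 0) W W' \<tau>' e xs = h (nb X W' xs) a)" for xs
  have g: "pull X (I 0) W W' \<tau>' e xs = h (nb X W' xs) (g xs)"
    if "set xs \<subseteq> topspace X" "length xs = Suc r" for xs
    unfolding g_def by (rule someI_ex) (use R[OF that] in \<open>simp add: R_def pull_def\<close>)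
  define \<sigma> where "\<sigma> = \<tau> \<circ> \<tau>'"
  have \<sigma>: "crefines X V W' \<sigma>" unfolding \<sigma>_def by (rule refines_trans[OF \<tau> \<tau>'])
  have dg: "int p dvd cob g xs - f (map \<sigma> xs)"
    if xs: "set xs \<subseteq> topspace X" "length xs = Suc (Suc r)" and ne: "nb X W' xs \<noteq> {}" for xs
  proof (rule h_inj[OF openin_nb[OF W' xs(1)] ne])
    have "h (nb X W' xs) (cob g xs) = delta X (I 0) W' (\<lambda>ys. h (nb X W' ys) (g ys)) xs"
      by (rule delta_h[OF W' xs(1), symmetric])
    also have "\<dots> = delta X (I 0) W' (pull X (I 0) W W' \<tau>' e) xs"
      by (rule I0.delta_cong[OF g[symmetric] xs])
    also have "\<dots> = pull X (I 0) W W' \<tau>' (delta X (I 0) W e) xs"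
      by (rule I0.delta_pull[OF W W' \<tau>' e0 xs])
    also have "\<dots> = pull X (I 0) W W' \<tau>' (pull X (I 0) V W \<tau> ?c) xs"
      using de[OF refines_map[OF \<tau>' xs(1)]] xs by (simp add: pull_def[of _ _ W W'])
    also have "\<dots> = pull X (I 0) V W' \<sigma> ?c xs"
      unfolding \<sigma>_def by (rule I0.pull_pull[OF V W W' \<tau> \<tau>' c0 xs])
    also have "\<dots> = h (nb X W' xs) (f (map \<sigma> xs))"
      unfolding pull_def
      by (rule h_restr[OF openin_nb[OF V refines_map[OF \<sigma> xs(1)]] openin_nb[OF W' xs(1)] nb_refines(1)[OF \<sigma> xs(1)]])
    finally show "h (nb X W' xs) (cob g xs) = h (nb X W' xs) (f (map \<sigma> xs))" .
  qed
  show ?thesis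
  proof (rule that[OF W'])
    show "W' x \<subseteq> V x" if "x \<in> topspace X" for x
      using \<sigma> that by (auto simp: crefines_def)
    fix xs assume xs: "set xs \<subseteq> topspace X" "length xs = Suc (Suc r)" and ne: "nb X W' xs \<noteq> {}"
    \<comment> \<open>So far only \<open>f\<close> composed with \<sigma> is bounded. Correcting
      \<open>g\<close> by \<open>prism \<sigma> f\<close> bounds \<open>f\<close> itself, up to the
      prism of \<open>cob f\<close>. That term is divisible by \<open>p\<close>, since the tuples
      mixed from \<open>xs\<close> and its image are still small for \<open>V\<close>.\<close>
    have "int p dvd prism \<sigma> (cob f) xs"
    proof (rule dvd_prism)
      fix ys assume ys: "set ys \<subseteq> set xs \<union> \<sigma> ` set xs" "length ys = Suc (length xs)"
      have "nb X W' xs \<subseteq> nb X V (xs @ map \<sigma> xs)" by (rule nb_refines(3)[OF \<sigma> xs(1)])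
      also have "\<dots> \<subseteq> nb X V ys" by (rule nb_antimono) (use ys in auto)
      finally have "nb X V ys \<noteq> {}" using ne by blast
      moreover have "set ys \<subseteq> topspace X" using ys xs refines_map[OF \<sigma> xs(1)] by auto
      ultimately show "int p dvd cob f ys" using f ys xs by simp
    qed
    moreover have "f xs - cob (\<lambda>ys. g ys - prism \<sigma> f ys) xs =
        - (cob g xs - f (map \<sigma> xs)) - prism \<sigma> (cob f) xs"
      using cob_prism[of \<sigma> f xs] by (simp add: cob_diff)
    ultimately show "int p dvd f xs - cob (\<lambda>ys. g ys - prism \<sigma> f ys) xs"
      using dg[OF xs ne] by (simp only: dvd_diff dvd_minus_iff)
  qed
qed

section \<open>Free actions of a finite cyclic group\<close>

locale free_cyclic =
  fixes X :: "'x topology" and \<theta> :: "'x \<Rightarrow> 'x" and p :: nat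
  assumes \<theta>: "continuous_map X X \<theta>" and p: "p > 1"
    and period: "x \<in> topspace X \<Longrightarrow> (\<theta> ^^ p) x = x"
    and free: "\<lbrakk>x \<in> topspace X; 0 < i; i < p\<rbrakk> \<Longrightarrow> (\<theta> ^^ i) x \<noteq> x"
begin

lemma iter_continuous: "continuous_map X X (\<theta> ^^ i)"
proof (induction i)
  case (Suc i)
  then show ?case using continuous_map_compose[OF Suc \<theta>] by (simp add: comp_def)
qed (simp add: id_def)

lemma iter_closed: "x \<in> topspace X \<Longrightarrow> (\<theta> ^^ i) x \<in> topspace X"
  using iter_continuous[of i] by (auto simp: continuous_map_def)

lemma step_closed: "x \<in> topspace X \<Longrightarrow> \<theta> x \<in> topspace X"
  using iter_closed[of x 1] by simp

lemma iter_map_closed: "set xs \<subseteq> topspace X \<Longrightarrow> set (map (\<theta> ^^ i) xs) \<subseteq> topspace X"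
  using iter_closed by auto

lemma iter_mult: "x \<in> topspace X \<Longrightarrow> (\<theta> ^^ (p * j)) x = x"
  by (induction j) (simp_all add: funpow_add period)

lemma iter_mod: "x \<in> topspace X \<Longrightarrow> (\<theta> ^^ (i mod p)) x = (\<theta> ^^ i) x"
proof -
  assume x: "x \<in> topspace X"
  have "(\<theta> ^^ i) x = (\<theta> ^^ (i mod p + p * (i div p))) x" by simp
  also have "\<dots> = (\<theta> ^^ (i mod p)) x"
    by (simp only: funpow_add comp_def iter_mult[OF x])
  finally show ?thesis by simp
qed

lemma iter_fixed: "x \<in> topspace X \<Longrightarrow> (\<theta> ^^ i) x = x \<Longrightarrow> p dvd i"
  using free[of x "i mod p"] iter_mod[of x i] p by (auto simp: dvd_eq_mod_eq_0)

section \<open>Transversals and positions in orbits\<close>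

definition transversal :: "'x set \<Rightarrow> bool"
  where "transversal K \<longleftrightarrow> K \<subseteq> topspace X \<and> (\<forall>z\<in>K. \<forall>i. (\<theta> ^^ i) z \<in> K \<longrightarrow> p dvd i)"

definition sat :: "'x set \<Rightarrow> 'x set"
  where "sat K = {(\<theta> ^^ i) z | i z. z \<in> K}"

text \<open>A transversal meets each orbit at most once, so on \<open>sat K\<close> this is the
  position in the orbit counted from its point in \<open>K\<close>. Off \<open>sat K\<close> the
  value is unspecified.\<close>

definition idx :: "'x set \<Rightarrow> 'x \<Rightarrow> nat"
  where "idx K x = (LEAST i. \<exists>z\<in>K. (\<theta> ^^ i) z = x)"

lemma idx_iter:
  assumes K: "transversal K" and z: "z \<in> K"
  shows "idx K ((\<theta> ^^ i) z) = i mod p"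
  unfolding idx_def
proof (rule Least_equality)
  have zX: "z \<in> topspace X" using K z by (auto simp: transversal_def)
  then show "\<exists>z'\<in>K. (\<theta> ^^ (i mod p)) z' = (\<theta> ^^ i) z" using z iter_mod by blast
  fix j assume "\<exists>z'\<in>K. (\<theta> ^^ j) z' = (\<theta> ^^ i) z"
  then obtain z' where z': "z' \<in> K" "(\<theta> ^^ j) z' = (\<theta> ^^ i) z" by blast
  then have z'X: "z' \<in> topspace X" using K by (auto simp: transversal_def)
  \<comment> \<open>Since \<theta> has period \<open>p\<close>, the iterate with exponent
    \<open>(p - 1) * j\<close> undoes the one with exponent \<open>j\<close>.\<close>
  have "(\<theta> ^^ ((p - 1) * j)) ((\<theta> ^^ i) z) = (\<theta> ^^ ((p - 1) * j)) ((\<theta> ^^ j) z')"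
    using z' by simp
  also have "\<dots> = (\<theta> ^^ (p * j)) z'"
    using p by (simp flip: funpow_add[THEN fun_cong, unfolded comp_def] add: algebra_simps)
  also have "\<dots> = z'" by (rule iter_mult[OF z'X])
  finally have "(\<theta> ^^ ((p - 1) * j + i)) z = z'" by (simp add: funpow_add)
  then have "p dvd (p - 1) * j + i" using K z z'(1) by (auto simp: transversal_def)
  then have "((p - 1) * j + i + j) mod p = j mod p"
    by (metis add_0 dvd_eq_mod_eq_0 mod_add_left_eq)
  moreover have "(p - 1) * j + i + j = i + p * j" using p by (cases p) simp_all
  ultimately have "(i + p * j) mod p = j mod p" by (simp only:)
  then have "i mod p = j mod p" by simp
  then show "i mod p \<le> j" by simp
qed

lemma idx_self: "\<lbrakk>transversal K; z \<in> K\<rbrakk> \<Longrightarrow> idx K z = 0"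
  using idx_iter[of K z 0] by simp

lemma idx_step:
  assumes "transversal K" "x \<in> sat K"
  shows "idx K (\<theta> x) = (idx K x + 1) mod p"
proof -
  obtain i z where "z \<in> K" "x = (\<theta> ^^ i) z" using assms by (auto simp: sat_def)
  then show ?thesis
    using idx_iter[OF assms(1), of z i] idx_iter[OF assms(1), of z "Suc i"] by (simp add: mod_Suc_eq)
qed

lemma sat_step: 
  assumes "K \<subseteq> topspace X" "x \<in> topspace X"
  shows "\<theta> x \<in> sat K \<longleftrightarrow> x \<in> sat K"
proof
  assume "x \<in> sat K"
  then obtain i z where "z \<in> K" "x = (\<theta> ^^ i) z" by (auto simp: sat_def)
  then have "\<theta> x = (\<theta> ^^ Suc i) z" "z \<in> K" by auto
  then show "\<theta> x \<in> sat K" unfolding sat_def by blast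
next
  assume "\<theta> x \<in> sat K"
  then obtain i z where z: "z \<in> K" "\<theta> x = (\<theta> ^^ i) z" by (auto simp: sat_def)
  have "x = (\<theta> ^^ (p - 1 + 1)) x" using p period[OF assms(2)] by simp
  also have "\<dots> = (\<theta> ^^ (p - 1)) (\<theta> x)" by (simp add: funpow_swap1)
  also have "\<dots> = (\<theta> ^^ (p - 1 + i)) z" using z by (simp add: funpow_add)
  finally show "x \<in> sat K" using z by (auto simp: sat_def)
qed

definition cyc_orbit :: "'x \<Rightarrow> 'x set"
  where "cyc_orbit x = {(\<theta> ^^ i) x | i. True}"

text \<open>One representative per orbit, by choice alone. The labels counted from it are in general
  discontinuous, which arbitrary cochains tolerate.\<close>

definition reps :: "'x set"
  where "reps = (\<lambda>x. SOME z. z \<in> cyc_orbit x) ` topspace X"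

lemma orbit_iter:
  assumes "x \<in> topspace X"
  shows "cyc_orbit ((\<theta> ^^ i) x) = cyc_orbit x"
proof
  show "cyc_orbit ((\<theta> ^^ i) x) \<subseteq> cyc_orbit x"
    by (auto simp: cyc_orbit_def simp flip: funpow_add[THEN fun_cong, unfolded comp_def])
  show "cyc_orbit x \<subseteq> cyc_orbit ((\<theta> ^^ i) x)"
  proof
    fix y assume "y \<in> cyc_orbit x"
    then obtain j where "y = (\<theta> ^^ j) x" by (auto simp: cyc_orbit_def)
    also have "\<dots> = (\<theta> ^^ j) ((\<theta> ^^ (p * i)) x)" by (simp add: iter_mult[OF assms])
    also have "p * i = (p - 1) * i + i" using p by (simp add: algebra_simps)
    also have "(\<theta> ^^ j) ((\<theta> ^^ ((p - 1) * i + i)) x) = (\<theta> ^^ (j + (p - 1) * i)) ((\<theta> ^^ i) x)"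
      by (simp add: funpow_add)
    finally show "y \<in> cyc_orbit ((\<theta> ^^ i) x)" by (auto simp: cyc_orbit_def)
  qed
qed

lemma orbit_self: "x \<in> cyc_orbit x"
  unfolding cyc_orbit_def by (rule CollectI, rule exI[of _ 0]) simp

lemma some_orbit: "(SOME z. z \<in> cyc_orbit x) \<in> cyc_orbit x"
  using orbit_self by (rule someI)

lemma transversal_reps: "transversal reps"
  unfolding transversal_def
proof (intro conjI ballI allI impI)
  show "reps \<subseteq> topspace X"
  proof
    fix w assume "w \<in> reps"
    then obtain x where x: "x \<in> topspace X" "w = (SOME v. v \<in> cyc_orbit x)" by (auto simp: reps_def)
    then have "w \<in> cyc_orbit x" using some_orbit by simp
    then show "w \<in> topspace X" using x iter_closed by (auto simp: cyc_orbit_def)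
  qed
  fix z i assume z: "z \<in> reps" and iz: "(\<theta> ^^ i) z \<in> reps"
  have *: "w = (SOME v. v \<in> cyc_orbit w) \<and> w \<in> topspace X" if w: "w \<in> reps" for w
  proof -
    obtain x where x: "x \<in> topspace X" "w = (SOME v. v \<in> cyc_orbit x)"
      using w unfolding reps_def by blast
    obtain k where k: "w = (\<theta> ^^ k) x" using some_orbit[of x] x by (auto simp: cyc_orbit_def)
    then show ?thesis using x orbit_iter iter_closed by metis
  qed
  have "(\<theta> ^^ i) z = z" using *[OF z] *[OF iz] orbit_iter by metis
  then show "p dvd i" using iter_fixed *[OF z] by blast
qed

lemma sat_reps: "x \<in> topspace X \<Longrightarrow> x \<in> sat reps"
proof -
  assume x: "x \<in> topspace X"
  obtain k where k: "(SOME v. v \<in> cyc_orbit x) = (\<theta> ^^ k) x" using some_orbit[of x] by (auto simp: cyc_orbit_def)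
  have "(\<theta> ^^ k) x \<in> reps" using x by (auto simp: reps_def simp flip: k)
  moreover have "x \<in> cyc_orbit ((\<theta> ^^ k) x)" unfolding orbit_iter[OF x] by (rule orbit_self)
  ultimately show ?thesis unfolding sat_def cyc_orbit_def by blast
qed

section \<open>Equivariant cochains\<close>

text \<open>
  The zigzag \<open>b = \<delta> u\<close>, \<open>N u = e \<equiv> \<delta> c\<close>, \<open>(\<theta> - 1) c \<equiv> 1\<close> exhibits \<open>b\<close> as the invariant
  cocycle that generates the even cohomology of the cyclic group.
\<close>

definition lab :: "'x \<Rightarrow> int" where "lab x = int (idx reps x)"
definition c :: "'x list \<Rightarrow> int" where "c xs = lab (hd xs)"
definition u :: "'x list \<Rightarrow> int" where "u xs = - (cob c xs div int p)"
definition e :: "'x list \<Rightarrow> int" where "e xs = cob c xs mod int p"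
definition b :: "'x list \<Rightarrow> int" where "b = cob u"

fun bpow :: "nat \<Rightarrow> 'x list \<Rightarrow> int" where
  "bpow 0 = (\<lambda>_. 1)"
| "bpow (Suc m) = cup 2 b (bpow m)"

definition invariant :: "nat \<Rightarrow> ('x list \<Rightarrow> int) \<Rightarrow> bool"
  where "invariant n f \<longleftrightarrow> (\<forall>xs. set xs \<subseteq> topspace X \<and> length xs = n \<longrightarrow> f (map \<theta> xs) = f xs)"

definition orbit_sum :: "('x list \<Rightarrow> int) \<Rightarrow> 'x list \<Rightarrow> int"
  where "orbit_sum f xs = (\<Sum>i<p. f (map (\<theta> ^^ i) xs))"

lemma lab_step: "x \<in> topspace X \<Longrightarrow> lab (\<theta> x) = (lab x + 1) mod int p"
  using idx_step[OF transversal_reps sat_reps] by (simp add: lab_def zmod_int add.commute)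

lemma lab_range: "x \<in> topspace X \<Longrightarrow> 0 \<le> lab x \<and> lab x < int p"
proof -
  assume "x \<in> topspace X"
  then obtain i z where "z \<in> reps" "x = (\<theta> ^^ i) z" using sat_reps unfolding sat_def by blast
  then show ?thesis using idx_iter[OF transversal_reps] p by (simp add: lab_def)
qed

lemma lab_iter: "x \<in> topspace X \<Longrightarrow> lab ((\<theta> ^^ i) x) = (lab x + int i) mod int p"
proof (induction i)
  case 0
  then show ?case using lab_range by simp
next
  case (Suc i)
  then show ?case using lab_step[OF iter_closed[of x i]] by (simp add: mod_simps add_ac)
qed

text \<open>A shift permutes the residues modulo \<open>p\<close>. In the induction, the sum over
  \<open>Suc p\<close> terms is split at either end.\<close>

lemma sum_shift_mod: "(\<Sum>i<p. (int a + int i) mod int p) = (\<Sum>i<p. int i)"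
proof (induction a)
  case (Suc a)
  have "(\<Sum>i<p. (int (Suc a) + int i) mod int p) + int a mod int p = (\<Sum>i<Suc p. (int a + int i) mod int p)"
    unfolding sum.lessThan_Suc_shift by (simp add: add_ac)
  also have "\<dots> = (\<Sum>i<p. (int a + int i) mod int p) + int a mod int p" by simp
  finally show ?case using Suc by simp
qed simp

lemma sum_lab: "x \<in> topspace X \<Longrightarrow> (\<Sum>i<p. lab ((\<theta> ^^ i) x)) = (\<Sum>i<p. int i)"
  using sum_shift_mod[of "idx reps x"] by (simp add: lab_iter) (simp add: lab_def)

lemma cob_c: "e xs = cob c xs + int p * u xs"
  by (simp add: e_def u_def minus_mult_div_eq_mod[symmetric])

lemma pair_cases:
  assumes "length xs = 2"
  obtains x y where "xs = [x, y]"
  using assms by (cases xs; cases "tl xs") auto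

lemma e_invariant: "invariant 2 e"
  unfolding invariant_def
proof (intro allI impI)
  fix xs assume xs: "set xs \<subseteq> topspace X \<and> length xs = 2"
  then obtain x y where "xs = [x, y]" by (auto elim: pair_cases)
  then show "e (map \<theta> xs) = e xs"
    using xs by (simp add: e_def c_def lab_step mod_simps)
qed

text \<open>Summed over an orbit, \<open>cob c\<close> contributes 0, because the labels of either
  entry run once through all residues, while the invariant \<open>e\<close> contributes
  \<open>p\<close> equal terms. Dividing \<open>cob_c\<close> by \<open>p\<close> gives the
  claim.\<close>

lemma orbit_sum_u:
  assumes xs: "set xs \<subseteq> topspace X" "length xs = 2"
  shows "orbit_sum u xs = e xs"
proof -
  obtain x y where xy: "xs = [x, y]" using xs by (auto elim: pair_cases)
  have e: "e (map (\<theta> ^^ i) xs) = e xs" for i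
    using xs by (simp add: xy e_def c_def lab_iter mod_simps)
  have "int p * orbit_sum u xs = (\<Sum>i<p. e (map (\<theta> ^^ i) xs) - cob c (map (\<theta> ^^ i) xs))"
    unfolding orbit_sum_def sum_distrib_left by (rule sum.cong) (simp_all add: cob_c)
  also have "\<dots> = int p * e xs - (\<Sum>i<p. lab ((\<theta> ^^ i) y) - lab ((\<theta> ^^ i) x))"
    unfolding sum_subtractf e by (simp add: xy c_def sum_subtractf)
  also have "\<dots> = int p * e xs"
    using xs by (simp add: xy sum_subtractf sum_lab)
  finally show ?thesis using p by simp
qed

lemma cob_e: "cob e xs = int p * b xs"
proof -
  have "cob e xs = cob (\<lambda>ys. cob c ys + int p * u ys) xs"
    by (rule cob_cong) (rule cob_c)
  then show ?thesis by (simp add: cob_add cob_const_mult b_def)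
qed

lemma invariant_cob:
  assumes "invariant n f"
  shows "invariant (Suc n) (cob f)"
  unfolding invariant_def
proof (intro allI impI)
  fix xs assume xs: "set xs \<subseteq> topspace X \<and> length xs = Suc n"
  have "cob f (map \<theta> xs) = cob (\<lambda>ys. f (map \<theta> ys)) xs" by (rule cob_map[symmetric])
  also have "\<dots> = cob f xs"
    by (rule cob_cong) (use assms xs in \<open>auto simp: invariant_def\<close>)
  finally show "cob f (map \<theta> xs) = cob f xs" .
qed

lemma invariant_cup:
  assumes "invariant (Suc m) f" "invariant (Suc n) g"
  shows "invariant (Suc (m + n)) (cup m f g)"
  unfolding invariant_def
proof (intro allI impI)
  fix xs assume xs: "set xs \<subseteq> topspace X \<and> length xs = Suc (m + n)"
  then have "set (take (Suc m) xs) \<subseteq> topspace X" "set (drop m xs) \<subseteq> topspace X"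
    using set_take_subset set_drop_subset by fastforce+
  then have "f (map \<theta> (take (Suc m) xs)) = f (take (Suc m) xs)" "g (map \<theta> (drop m xs)) = g (drop m xs)"
    using assms xs by (auto simp: invariant_def)
  then show "cup m f g (map \<theta> xs) = cup m f g xs"
    by (simp add: cup_def take_map drop_map)
qed

lemma invariant_iter:
  assumes "invariant n f" "set xs \<subseteq> topspace X" "length xs = n"
  shows "f (map (\<theta> ^^ i) xs) = f xs"
proof (induction i)
  case (Suc i)
  have "f (map \<theta> (map (\<theta> ^^ i) xs)) = f (map (\<theta> ^^ i) xs)"
    using assms(1)[unfolded invariant_def, rule_format, of "map (\<theta> ^^ i) xs"] assms(2,3)
      iter_map_closed[OF assms(2), of i] by (simp del: map_map)
  then show ?case using Suc by (simp add: comp_def)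
qed simp

text \<open>Invariance passes from \<open>e\<close> to its coboundary, which is \<open>p\<close>
  times \<open>b\<close>, and \<open>p\<close> cancels over the integers.\<close>

lemma b_invariant: "invariant 3 b"
  unfolding invariant_def
proof (intro allI impI)
  fix xs assume xs: "set xs \<subseteq> topspace X \<and> length xs = 3"
  have "cob e (map \<theta> xs) = cob e xs"
    using invariant_cob[OF e_invariant] xs by (auto simp: invariant_def)
  then show "b (map \<theta> xs) = b xs" using p by (simp add: cob_e)
qed

lemma bpow_invariant: "invariant (Suc (2 * m)) (bpow m)"
proof (induction m)
  case (Suc m)
  have "invariant (Suc (2 + 2 * m)) (cup 2 b (bpow m))"
    using invariant_cup[of 2 b "2 * m" "bpow m"] b_invariant Suc by (simp add: eval_nat_numeral)
  then show ?case by simp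
qed (simp add: invariant_def)

lemma cob_bpow: "length xs = Suc (Suc (2 * m)) \<Longrightarrow> cob (bpow m) xs = 0"
proof (induction m arbitrary: xs)
  case 0
  then obtain x y where "xs = [x, y]" using pair_cases[of xs] by auto
  then show ?case by simp
next
  case (Suc m)
  have "cob (bpow m) (drop 2 xs) = 0" using Suc by simp
  then show ?case
    using Suc.prems by (simp add: cob_cup) (simp add: cup_def b_def)
qed

text \<open>On one transversal \<open>b\<close> is the coboundary of an invariant cochain. For
  several of them, differences that vanish on different members are multiplied, as in the proof that
  cup length is bounded by the size of a cover of trivializing sets.\<close>

lemma bpow_local:
  assumes "finite T" "T \<noteq> {}" "\<And>K. K \<in> T \<Longrightarrow> transversal K"
  obtains v where "invariant (2 * card T) v"
    "\<And>K xs. \<lbrakk>K \<in> T; set xs \<subseteq> K; length xs = Suc (2 * card T)\<rbrakk> \<Longrightarrow> bpow (card T) xs = cob v xs"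
proof -
  have s: "\<exists>s. invariant 2 s \<and> (\<forall>xs. set xs \<subseteq> K \<and> length xs = 3 \<longrightarrow> b xs = cob s xs)"
    if K: "transversal K" for K
  proof -
    \<comment> \<open>Labels from \<open>reps\<close> and positions from \<open>K\<close> advance
      together along \<theta>, so their difference modulo \<open>p\<close> is invariant. On
      \<open>K\<close> the position is 0 and \<open>a\<close> agrees with \<open>c\<close>; off
      \<open>sat K\<close>, itself stable under \<theta>, the default 0 is invariant as
      well.\<close>
    define a where "a xs = (if hd xs \<in> sat K then (lab (hd xs) - int (idx K (hd xs))) mod int p else 0)" for xs
    \<comment> \<open>On \<open>K\<close> the division is exact and gives \<open>u\<close>.
      Elsewhere only invariance matters, and rounding preserves it.\<close>
    define s where "s xs = (e xs - cob a xs) div int p" for xs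
    have KX: "K \<subseteq> topspace X" using K by (simp add: transversal_def)
    have a: "a [\<theta> x] = a [x]" if "x \<in> topspace X" for x
      using sat_step[OF KX that] lab_step[OF that] idx_step[OF K, of x]
      by (auto simp: a_def zmod_int mod_simps)
    have "invariant 2 s"
      unfolding invariant_def
    proof (intro allI impI)
      fix xs assume xs: "set xs \<subseteq> topspace X \<and> length xs = 2"
      then obtain x y where xy: "xs = [x, y]" by (auto elim: pair_cases)
      have "e (map \<theta> xs) = e xs" using e_invariant xs by (simp add: invariant_def)
      then show "s (map \<theta> xs) = s xs" using xs a by (simp add: s_def xy)
    qed
    moreover have "b xs = cob s xs" if xs: "set xs \<subseteq> K" "length xs = 3" for xs
      unfolding b_def
    proof (rule cob_cong)
      fix ys assume ys: "set ys \<subseteq> set xs" "Suc (length ys) = length xs"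
      then have "length ys = 2" using xs by simp
      then obtain x y where xy: "ys = [x, y]" by (rule pair_cases)
      have ac: "a [x] = lab x" if "x \<in> K" for x
      proof -
        have "(\<theta> ^^ 0) x \<in> sat K" unfolding sat_def using that by blast
        then show ?thesis
          using idx_self[OF K that] lab_range[of x] KX that by (auto simp: a_def)
      qed
      have "x \<in> K" "y \<in> K" using ys xs by (auto simp: xy)
      then have "e ys - cob a ys = int p * u ys"
        using cob_c[of ys] ac[of x] ac[of y] by (simp add: xy c_def)
      then show "u ys = s ys" using p by (simp add: s_def)
    qed
    ultimately show ?thesis by blast
  qed
  have "\<exists>v. invariant (2 * card T) v \<and>
    (\<forall>K xs. K \<in> T \<and> set xs \<subseteq> K \<and> length xs = Suc (2 * card T) \<longrightarrow> bpow (card T) xs = cob v xs)"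
    using assms
  proof (induction T rule: finite_ne_induct)
    case (singleton K)
    then obtain s where "invariant 2 s" "\<forall>xs. set xs \<subseteq> K \<and> length xs = 3 \<longrightarrow> b xs = cob s xs"
      using s by blast
    then show ?case by (intro exI[of _ s]) (simp add: cup_def)
  next
    case (insert K T)
    define n where "n = card T"
    have n: "n > 0" "card (insert K T) = Suc n" using insert by (auto simp: n_def card_gt_0_iff)
    obtain v where v: "invariant (2 * n) v"
      "\<And>K xs. \<lbrakk>K \<in> T; set xs \<subseteq> K; length xs = Suc (2 * n)\<rbrakk> \<Longrightarrow> bpow n xs = cob v xs"
      using insert.IH[OF insert.prems] unfolding n_def by blast
    obtain s where s: "invariant 2 s" "\<And>xs. \<lbrakk>set xs \<subseteq> K; length xs = 3\<rbrakk> \<Longrightarrow> b xs = cob s xs"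
      using s[of K] insert by auto
    define w where "w xs = bpow n xs - cob v xs" for xs
    \<comment> \<open>Chosen so that \<open>bpow (Suc n)\<close> minus \<open>cob v'\<close> is the
      product of \<open>b - cob s\<close>, which vanishes on \<open>K\<close>, and \<open>w\<close>,
      which vanishes on the members of \<open>T\<close>.\<close>
    define v' where "v' xs = cup 2 b v xs + cup 1 s w xs" for xs
    have "invariant (Suc (2 * n)) w"
      using bpow_invariant[of n] invariant_cob[OF v(1)] by (simp add: w_def invariant_def)
    then have "invariant (Suc (1 + 2 * n)) (cup 1 s w)"
      using s(1) by (intro invariant_cup) (simp_all add: eval_nat_numeral)
    moreover have "invariant (Suc (2 + (2 * n - 1))) (cup 2 b v)"
      using b_invariant v(1) n by (intro invariant_cup) (simp_all add: eval_nat_numeral)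
    ultimately have "invariant (2 * Suc n) v'"
      using n by (simp add: v'_def invariant_def)
    moreover have "bpow (Suc n) xs = cob v' xs"
      if K': "K' \<in> insert K T" and xs: "set xs \<subseteq> K'" "length xs = Suc (2 * Suc n)" for K' xs
    proof -
      have dw: "cob w (drop 1 xs) = 0"
        using cob_bpow[of "drop 1 xs" n] xs by (simp add: w_def[abs_def] cob_diff)
      have "cob (cup 2 b v) xs = cup 2 b (cob v) xs"
        using xs n by (simp add: cob_cup) (simp add: cup_def b_def)
      moreover have "cob (cup 1 s w) xs = cup 2 (cob s) w xs"
        using xs n dw by (simp add: cob_cup numeral_2_eq_2) (simp add: cup_def)
      ultimately have "bpow (Suc n) xs - cob v' xs = (b (take 3 xs) - cob s (take 3 xs)) * w (drop 2 xs)"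
        by (simp add: v'_def[abs_def] cob_add) (simp add: cup_def w_def algebra_simps)
      also have "\<dots> = 0"
      proof (cases "K' = K")
        case True
        then have "set (take 3 xs) \<subseteq> K" using xs set_take_subset[of 3 xs] by blast
        then have "b (take 3 xs) = cob s (take 3 xs)" using s(2) xs by simp
        then show ?thesis by simp
      next
        case False
        have "set (drop 2 xs) \<subseteq> K'" using xs set_drop_subset[of 2 xs] by blast
        then have "w (drop 2 xs) = 0" using v(2)[of K' "drop 2 xs"] K' False xs by (simp add: w_def)
        then show ?thesis by simp
      qed
      finally show ?thesis by simp
    qed
    ultimately show ?case unfolding n(2) by blast
  qed
  then show ?thesis using that by blast
qed

section \<open>Descent from a bounding power to a contradiction\<close>

lemma equivariant_cover:
  assumes W: "cover_family X W"
  obtains W' where "cover_family X W'"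
    "\<And>xs i. \<lbrakk>nb X W' xs \<noteq> {}; i < p\<rbrakk> \<Longrightarrow> nb X W (map (\<theta> ^^ i) xs) \<noteq> {}"
proof -
  \<comment> \<open>The preimages of the cover under all iterates are intersected: a point
    witnessing that \<open>xs\<close> is small is moved by \<open>\<theta> ^^ i\<close> to a witness
    for the translated tuple.\<close>
  define W' where "W' x = (\<Inter>i\<in>{..<p}. {y \<in> topspace X. (\<theta> ^^ i) y \<in> W ((\<theta> ^^ i) x)}) \<inter> topspace X" for x
  show ?thesis
  proof (rule that[of W'])
    show "cover_family X W'"
      unfolding cover_family_def
    proof (intro ballI conjI)
      fix x assume x: "x \<in> topspace X"
      show "openin X (W' x)" unfolding W'_def
        by (intro openin_INT openin_continuous_map_preimage[OF iter_continuous])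
          (use W iter_closed[OF x] in \<open>auto simp: cover_family_def\<close>)
      show "x \<in> W' x" using x W iter_closed[OF x] by (auto simp: W'_def cover_family_def)
    qed
    fix xs i assume "nb X W' xs \<noteq> {}" and i: "i < p"
    then obtain y where y: "y \<in> topspace X" "\<And>x. x \<in> set xs \<Longrightarrow> y \<in> W' x" by (auto simp: nb_def)
    then have "(\<theta> ^^ i) y \<in> nb X W (map (\<theta> ^^ i) xs)"
      using i iter_closed by (auto simp: nb_def W'_def)
    then show "nb X W (map (\<theta> ^^ i) xs) \<noteq> {}" by blast
  qed
qed

lemma orbit_sum_step:
  assumes "set xs \<subseteq> topspace X"
  shows "orbit_sum f (map \<theta> xs) = orbit_sum f xs"
proof -
  let ?F = "\<lambda>i. f (map (\<theta> ^^ i) xs)"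
  have "map (\<theta> ^^ p) xs = xs" using assms period by (auto intro: map_idI)
  then have "?F p = ?F 0" by simp
  moreover have "(\<Sum>i<Suc p. ?F i) = ?F 0 + (\<Sum>i<p. ?F (Suc i))" by (rule sum.lessThan_Suc_shift)
  moreover have "orbit_sum f (map \<theta> xs) = (\<Sum>i<p. ?F (Suc i))"
    by (simp add: orbit_sum_def comp_def funpow_swap1)
  ultimately show ?thesis by (simp add: orbit_sum_def)
qed

text \<open>Each \<open>z'\<close> in \<open>W z\<close> also lies in \<open>W z'\<close>, so the
  residue of \<open>g\<close> is constant on \<open>W z\<close>, and the set where it takes the
  value at \<open>x\<close> is open and closed.\<close>

lemma locally_constant_mod:
  assumes "connected_space X" and W: "cover_family X W"
    and g: "\<And>x y. \<lbrakk>x \<in> topspace X; y \<in> topspace X; nb X W [x, y] \<noteq> {}\<rbrakk> \<Longrightarrow> int p dvd g y - g x"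
    and xy: "x \<in> topspace X" "y \<in> topspace X"
  shows "int p dvd g y - g x"
proof -
  define S where "S = {z \<in> topspace X. int p dvd g z - g x}"
  have near: "int p dvd g z' - g z" if "z \<in> topspace X" "z' \<in> W z" for z z'
  proof -
    have "z' \<in> topspace X" using W that openin_subset by (auto simp: cover_family_def)
    moreover have "z' \<in> nb X W [z, z']" using calculation W that by (auto simp: nb_def cover_family_def)
    ultimately show ?thesis using g that by blast
  qed
  have sub: "W z \<subseteq> topspace X" if "z \<in> topspace X" for z
    using W that openin_subset by (auto simp: cover_family_def)
  have "openin X S"
  proof (subst openin_subopen, intro ballI)
    fix z assume z: "z \<in> S"
    have "W z \<subseteq> S"
    proof
      fix z' assume z': "z' \<in> W z"
      have "int p dvd (g z' - g z) + (g z - g x)" 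
        by (intro dvd_add near[OF _ z']) (use z in \<open>auto simp: S_def\<close>)
      then show "z' \<in> S" using z z' sub by (auto simp: S_def)
    qed
    then show "\<exists>U. openin X U \<and> z \<in> U \<and> U \<subseteq> S" using W z by (auto simp: cover_family_def S_def)
  qed
  moreover have "openin X (topspace X - S)"
  proof (subst openin_subopen, intro ballI)
    fix z assume z: "z \<in> topspace X - S"
    have "W z \<subseteq> topspace X - S"
    proof
      fix z' assume z': "z' \<in> W z"
      have "z' \<notin> S"
      proof
        assume "z' \<in> S"
        then have "int p dvd (g z' - g x) - (g z' - g z)"
          by (intro dvd_diff[OF _ near[OF _ z']]) (use z in \<open>auto simp: S_def\<close>)
        then show False using z by (simp add: S_def)
      qed
      then show "z' \<in> topspace X - S" using z z' sub by auto
    qed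
    then show "\<exists>U. openin X U \<and> z \<in> U \<and> U \<subseteq> topspace X - S" using W z by (auto simp: cover_family_def)
  qed
  moreover have "S \<subseteq> topspace X" "x \<in> S" using xy by (auto simp: S_def)
  ultimately have "S = topspace X"
    using assms(1) unfolding connected_space_clopen_in closedin_def by blast
  then show ?thesis using xy by (auto simp: S_def)
qed

text \<open>The condition on orbit sums carries the content: for positive \<open>m\<close>, the
  cochain \<open>cup 1 u (bpow (m - 1))\<close> satisfies the first congruence in any case.\<close>

definition bounded_mod :: "nat \<Rightarrow> bool"
  where "bounded_mod m \<longleftrightarrow> (\<exists>V v. cover_family X V \<and>
    (\<forall>xs. set xs \<subseteq> topspace X \<and> length xs = Suc (2 * m) \<and> nb X V xs \<noteq> {}
      \<longrightarrow> int p dvd bpow m xs - cob v xs) \<and>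
    (\<forall>xs. set xs \<subseteq> topspace X \<and> length xs = 2 * m \<and> nb X V xs \<noteq> {} \<longrightarrow> int p dvd orbit_sum v xs))"

text \<open>Since \<open>b = cob u\<close>, the cochain \<open>cup 1 u (bpow n) - v\<close> is a
  cocycle modulo \<open>p\<close>, hence the coboundary of some \<open>w\<close>. Taking orbit sums
  removes \<open>v\<close>, and it turns \<open>u\<close> into \<open>e\<close>, which is congruent
  to \<open>cob c\<close>, while the invariant \<open>bpow n\<close> factors out.\<close>

lemma bounded_mod_half_step:
  assumes X: "compact_space X" "Hausdorff_space X"
    and coh: "\<And>r. is_sheaf_cohomology X (constant_sheaf X (zmod p)) (Suc r) (singleton_group ())"
    and bnd: "bounded_mod (Suc n)"
  obtains W w where "cover_family X W"
    "\<And>xs. \<lbrakk>set xs \<subseteq> topspace X; length xs = Suc (Suc (2 * n)); nb X W xs \<noteq> {}\<rbrakk>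
      \<Longrightarrow> int p dvd cob (\<lambda>ys. cup 0 c (bpow n) ys - orbit_sum w ys) xs"
proof -
  obtain V v where V: "cover_family X V"
    and bv: "\<And>xs. \<lbrakk>set xs \<subseteq> topspace X; length xs = Suc (2 * Suc n); nb X V xs \<noteq> {}\<rbrakk>
      \<Longrightarrow> int p dvd bpow (Suc n) xs - cob v xs"
    and nv: "\<And>xs. \<lbrakk>set xs \<subseteq> topspace X; length xs = 2 * Suc n; nb X V xs \<noteq> {}\<rbrakk> \<Longrightarrow> int p dvd orbit_sum v xs"
    using bnd unfolding bounded_mod_def by blast
  define f where "f xs = cup 1 u (bpow n) xs - v xs" for xs
  have p0: "0 < p" using p by simp
  have dvd: "int p dvd cob f xs"
    if xs: "set xs \<subseteq> topspace X" "length xs = Suc (Suc (Suc (2 * n)))" "nb X V xs \<noteq> {}" for xs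
  proof -
    have "cob (bpow n) (drop 1 xs) = 0" using xs by (intro cob_bpow) simp
    then have "cob (cup 1 u (bpow n)) xs = bpow (Suc n) xs"
      using xs by (simp add: cob_cup numeral_2_eq_2 b_def) (simp add: cup_def)
    then show ?thesis using bv[OF xs(1) _ xs(3)] xs(2) by (simp add: f_def[abs_def] cob_diff)
  qed
  obtain W w where W: "cover_family X W" "\<And>x. x \<in> topspace X \<Longrightarrow> W x \<subseteq> V x"
    and w: "\<And>xs. \<lbrakk>set xs \<subseteq> topspace X; length xs = Suc (Suc (2 * n)); nb X W xs \<noteq> {}\<rbrakk>
      \<Longrightarrow> int p dvd f xs - cob w xs"
    using cocycle_mod_bounds[OF X p0 coh V dvd] by blast
  \<comment> \<open>All translates of a tuple small for \<open>W'\<close> are small for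
    \<open>W\<close>, so the congruence for \<open>w\<close> can be summed over the orbit.\<close>
  obtain W' where W': "cover_family X W'"
    "\<And>xs i. \<lbrakk>nb X W' xs \<noteq> {}; i < p\<rbrakk> \<Longrightarrow> nb X W (map (\<theta> ^^ i) xs) \<noteq> {}"
    using equivariant_cover[OF W(1)] by blast
  show ?thesis
  proof (rule that[OF W'(1)])
    fix xs assume xs: "set xs \<subseteq> topspace X" "length xs = Suc (Suc (2 * n))" "nb X W' xs \<noteq> {}"
    have "nb X W xs \<noteq> {}" using W'(2)[OF xs(3), of 0] p by simp
    moreover have "nb X W xs \<subseteq> nb X V xs" using W(2) xs(1) by (fastforce simp: nb_def)
    ultimately have nv': "int p dvd orbit_sum v xs" using nv[OF xs(1)] xs(2) by auto
    have "int p dvd (\<Sum>i<p. f (map (\<theta> ^^ i) xs) - cob w (map (\<theta> ^^ i) xs))"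
      by (rule dvd_sum, rule w) (use xs iter_map_closed W'(2) in auto)
    also have "(\<Sum>i<p. f (map (\<theta> ^^ i) xs) - cob w (map (\<theta> ^^ i) xs)) = orbit_sum f xs - cob (orbit_sum w) xs"
      unfolding orbit_sum_def[abs_def] cob_sum by (simp add: sum_subtractf cob_map)
    finally have 1: "int p dvd orbit_sum f xs - cob (orbit_sum w) xs" .
    have sets: "set (take 2 xs) \<subseteq> topspace X" "set (drop 1 xs) \<subseteq> topspace X"
      using xs set_take_subset[of 2 xs] set_drop_subset[of 1 xs] by blast+
    have "orbit_sum (cup 1 u (bpow n)) xs = (\<Sum>i<p. u (map (\<theta> ^^ i) (take 2 xs)) * bpow n (map (\<theta> ^^ i) (drop 1 xs)))"
      by (simp add: orbit_sum_def cup_def take_map drop_map numeral_2_eq_2)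
    also have "\<dots> = orbit_sum u (take 2 xs) * bpow n (drop 1 xs)"
      using invariant_iter[OF bpow_invariant sets(2)] xs by (simp add: orbit_sum_def sum_distrib_right)
    also have "\<dots> = e (take 2 xs) * bpow n (drop 1 xs)"
      using orbit_sum_u[OF sets(1)] xs by simp
    finally have "orbit_sum f xs = e (take 2 xs) * bpow n (drop 1 xs) - orbit_sum v xs"
      by (simp add: f_def orbit_sum_def sum_subtractf)
    moreover have "cob (cup 0 c (bpow n)) xs = cob c (take 2 xs) * bpow n (drop 1 xs)"
      using cob_bpow[OF xs(2)] xs by (simp add: cob_cup) (simp add: cup_def numeral_2_eq_2)
    ultimately have "cob (\<lambda>ys. cup 0 c (bpow n) ys - orbit_sum w ys) xs =
       (orbit_sum f xs - cob (orbit_sum w) xs) + orbit_sum v xs - int p * (u (take 2 xs) * bpow n (drop 1 xs))"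
      using cob_c[of "take 2 xs"] by (simp add: cob_diff algebra_simps)
    then show "int p dvd cob (\<lambda>ys. cup 0 c (bpow n) ys - orbit_sum w ys) xs"
      using 1 nv' by simp
  qed
qed

text \<open>The label of the first entry grows by 1 modulo \<open>p\<close> along \<theta>, and the
  other factor is invariant.\<close>

lemma c_step:
  assumes "set xs \<subseteq> topspace X" "length xs = Suc (2 * n)"
  shows "int p dvd cup 0 c (bpow n) (map \<theta> xs) - cup 0 c (bpow n) xs - bpow n xs"
proof -
  obtain x ys where xs: "xs = x # ys" using assms by (cases xs) auto
  have "bpow n (map \<theta> xs) = bpow n xs" using bpow_invariant assms by (simp add: invariant_def)
  then have "cup 0 c (bpow n) (map \<theta> xs) - cup 0 c (bpow n) xs - bpow n xs =
      (lab (\<theta> x) - (lab x + 1)) * bpow n xs"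
    by (simp add: cup_def c_def xs algebra_simps)
  moreover have "int p dvd lab (\<theta> x) - (lab x + 1)"
    using lab_step[of x] assms by (simp add: xs mod_eq_dvd_iff[symmetric])
  ultimately show ?thesis by simp
qed

text \<open>The cocycle left by the half step is congruent to some \<open>cob z\<close>. Subtracting
  it from its translate removes the invariant orbit sum and leaves \<open>bpow n\<close> by
  \<open>c_step\<close>. The new cochain is the translate of \<open>z\<close> minus
  \<open>z\<close>, whose orbit sum telescopes to 0.\<close>

lemma bounded_mod_step:
  assumes X: "compact_space X" "Hausdorff_space X"
    and coh: "\<And>r. is_sheaf_cohomology X (constant_sheaf X (zmod p)) (Suc r) (singleton_group ())"
    and bnd: "bounded_mod (Suc n)" and n: "n > 0"
  shows "bounded_mod n"
proof -
  obtain W w where W: "cover_family X W"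
    and w: "\<And>xs. \<lbrakk>set xs \<subseteq> topspace X; length xs = Suc (Suc (2 * n)); nb X W xs \<noteq> {}\<rbrakk>
      \<Longrightarrow> int p dvd cob (\<lambda>ys. cup 0 c (bpow n) ys - orbit_sum w ys) xs"
    using bounded_mod_half_step[OF X coh bnd] by blast
  define f where "f ys = cup 0 c (bpow n) ys - orbit_sum w ys" for ys
  \<comment> \<open>Here \<open>r = 2 * n - 1\<close>, so the vanishing used is that in degree
    \<open>2 * n\<close>, which has to be positive.\<close>
  have len: "Suc (Suc (2 * n - 1)) = Suc (2 * n)" using n by simp
  have p0: "0 < p" using p by simp
  have dvd: "int p dvd cob f xs"
    if "set xs \<subseteq> topspace X" "length xs = Suc (Suc (Suc (2 * n - 1)))" "nb X W xs \<noteq> {}" for xs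
    unfolding f_def using w that len by simp
  obtain V z where V: "cover_family X V" "\<And>x. x \<in> topspace X \<Longrightarrow> V x \<subseteq> W x"
    and z: "\<And>xs. \<lbrakk>set xs \<subseteq> topspace X; length xs = Suc (Suc (2 * n - 1)); nb X V xs \<noteq> {}\<rbrakk>
      \<Longrightarrow> int p dvd f xs - cob z xs"
    using cocycle_mod_bounds[where r = "2 * n - 1" and f = f, OF X p0 coh W dvd] by blast
  note V = V(1) and z = z[unfolded len]
  obtain V' where V': "cover_family X V'"
    "\<And>xs i. \<lbrakk>nb X V' xs \<noteq> {}; i < p\<rbrakk> \<Longrightarrow> nb X V (map (\<theta> ^^ i) xs) \<noteq> {}"
    using equivariant_cover[OF V] by blast
  define v where "v xs = z (map \<theta> xs) - z xs" for xs
  have "int p dvd bpow n xs - cob v xs"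
    if xs: "set xs \<subseteq> topspace X" "length xs = Suc (2 * n)" "nb X V' xs \<noteq> {}" for xs
  proof -
    have "nb X V xs \<noteq> {}" "nb X V (map \<theta> xs) \<noteq> {}"
      using V'(2)[OF xs(3), of 0] V'(2)[OF xs(3), of 1] p by simp_all
    moreover have "set (map \<theta> xs) \<subseteq> topspace X" using xs step_closed by auto
    ultimately have fz: "int p dvd f xs - cob z xs" "int p dvd f (map \<theta> xs) - cob z (map \<theta> xs)"
      using z[of xs] z[of "map \<theta> xs"] xs by simp_all
    have "int p dvd (f (map \<theta> xs) - cob z (map \<theta> xs)) - (f xs - cob z xs)
        - (cup 0 c (bpow n) (map \<theta> xs) - cup 0 c (bpow n) xs - bpow n xs)"
      by (rule dvd_diff[OF dvd_diff[OF fz(2,1)] c_step[OF xs(1,2)]])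
    also have "\<dots> = bpow n xs - cob v xs"
      using orbit_sum_step[OF xs(1), of w] by (simp add: f_def v_def[abs_def] cob_diff cob_map)
    finally show ?thesis .
  qed
  moreover have "orbit_sum v xs = 0" if xs: "set xs \<subseteq> topspace X" for xs
    using orbit_sum_step[OF xs, of z] by (simp add: v_def orbit_sum_def sum_subtractf funpow_swap1 comp_def)
  ultimately show ?thesis
    unfolding bounded_mod_def using V'(1)
    by (intro exI[of _ V'] exI[of _ v] conjI allI impI) simp_all
qed

text \<open>In degree 0 the half step leaves a function that is constant modulo \<open>p\<close> by
  connectedness, although \<theta> raises it by 1.\<close>

lemma not_bounded_mod_1:
  assumes X: "compact_space X" "Hausdorff_space X" "connected_space X" "topspace X \<noteq> {}"
    and coh: "\<And>r. is_sheaf_cohomology X (constant_sheaf X (zmod p)) (Suc r) (singleton_group ())"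
  shows "\<not> bounded_mod 1"
proof
  assume "bounded_mod 1"
  then have "bounded_mod (Suc 0)" by simp
  then obtain W w where W: "cover_family X W"
    and w: "\<And>xs. \<lbrakk>set xs \<subseteq> topspace X; length xs = Suc (Suc (2 * 0)); nb X W xs \<noteq> {}\<rbrakk>
      \<Longrightarrow> int p dvd cob (\<lambda>ys. cup 0 c (bpow 0) ys - orbit_sum w ys) xs"
    using bounded_mod_half_step[OF X(1,2) coh] by blast
  define g where "g x = cup 0 c (bpow 0) [x] - orbit_sum w [x]" for x
  obtain x where x: "x \<in> topspace X" using X(4) by blast
  have "int p dvd g (\<theta> x) - g x"
  proof (rule locally_constant_mod[OF X(3) W _ x step_closed[OF x]])
    fix y y' assume "y \<in> topspace X" "y' \<in> topspace X" "nb X W [y, y'] \<noteq> {}"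
    then show "int p dvd g y' - g y" using w[of "[y, y']"] by (simp add: g_def)
  qed
  moreover have "int p dvd cup 0 c (bpow 0) [\<theta> x] - cup 0 c (bpow 0) [x] - 1"
    using c_step[of "[x]" 0] x by simp
  ultimately have "int p dvd (g (\<theta> x) - g x) - (cup 0 c (bpow 0) [\<theta> x] - cup 0 c (bpow 0) [x] - 1)"
    by (rule dvd_diff)
  also have "\<dots> = 1" using orbit_sum_step[of "[x]" w] x by (simp add: g_def)
  finally show False using p by simp
qed

text \<open>Freeness makes the finitely many other translates of \<open>x\<close> distinct from
  \<open>x\<close>; they are separated from \<open>x\<close> by disjoint open sets, whose preimages
  under the iterates cut out \<open>U\<close>.\<close>

lemma transversal_nbhd:
  assumes H: "Hausdorff_space X" and x: "x \<in> topspace X"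
  obtains U where "openin X U" "x \<in> U" "\<And>K. K \<subseteq> U \<Longrightarrow> transversal K"
proof -
  have "\<forall>i. \<exists>A B. i \<in> {0<..<p} \<longrightarrow> openin X A \<and> openin X B \<and> x \<in> A \<and> (\<theta> ^^ i) x \<in> B \<and> disjnt A B"
  proof
    fix i
    show "\<exists>A B. i \<in> {0<..<p} \<longrightarrow> openin X A \<and> openin X B \<and> x \<in> A \<and> (\<theta> ^^ i) x \<in> B \<and> disjnt A B"
      using H free[OF x, of i] x iter_closed[OF x, of i] unfolding Hausdorff_space_def
      by (metis greaterThanLessThan_iff)
  qed
  then obtain A B where AB: "\<And>i. i \<in> {0<..<p} \<Longrightarrow>
      openin X (A i) \<and> openin X (B i) \<and> x \<in> A i \<and> (\<theta> ^^ i) x \<in> B i \<and> disjnt (A i) (B i)"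
    by metis
  define U where "U = (\<Inter>i\<in>{0<..<p}. A i \<inter> {y \<in> topspace X. (\<theta> ^^ i) y \<in> B i}) \<inter> topspace X"
  show ?thesis
  proof (rule that)
    show "openin X U" unfolding U_def
      by (intro openin_INT openin_Int openin_continuous_map_preimage[OF iter_continuous]) (use AB in auto)
    show "x \<in> U" using AB x by (auto simp: U_def)
    fix K assume K: "K \<subseteq> U"
    show "transversal K" unfolding transversal_def
    proof (intro conjI ballI allI impI)
      show "K \<subseteq> topspace X" using K by (auto simp: U_def)
      fix z i assume z: "z \<in> K" and iz: "(\<theta> ^^ i) z \<in> K"
      have "z \<in> U" using z K by blast
      moreover have "z \<in> topspace X" using calculation by (simp add: U_def)
      ultimately have iz': "(\<theta> ^^ (i mod p)) z \<in> U" "z \<in> U"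
        using iz K by (auto simp only: iter_mod)
      show "p dvd i"
      proof (rule ccontr)
        assume "\<not> p dvd i"
        then have m: "i mod p \<in> {0<..<p}" using p by (auto simp: dvd_eq_mod_eq_0)
        then have "(\<theta> ^^ (i mod p)) z \<in> A (i mod p)" "(\<theta> ^^ (i mod p)) z \<in> B (i mod p)"
          using iz' by (auto simp: U_def)
        then show False using AB[OF m] by (auto simp: disjnt_def)
      qed
    qed
  qed
qed

text \<open>A star refinement places every small tuple inside one of finitely many transversals, so
  that the power counted by them bounds an invariant cochain on small tuples; this starts the
  descent.\<close>

theorem not_acyclic:
  assumes X: "compact_space X" "Hausdorff_space X" "connected_space X" "topspace X \<noteq> {}"
    and coh: "\<And>r. is_sheaf_cohomology X (constant_sheaf X (zmod p)) (Suc r) (singleton_group ())"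
  shows False
proof -
  have "\<forall>x\<in>topspace X. \<exists>U. openin X U \<and> x \<in> U \<and> (\<forall>K. K \<subseteq> U \<longrightarrow> transversal K)"
    using transversal_nbhd[OF X(2)] by (metis (no_types, lifting))
  from bchoice[OF this] obtain V where V: "\<And>x. x \<in> topspace X \<Longrightarrow> openin X (V x) \<and> x \<in> V x \<and> (\<forall>K. K \<subseteq> V x \<longrightarrow> transversal K)"
    by blast
  then have "cover_family X V" by (simp add: cover_family_def)
  from shrinking[OF X(1,2) this] obtain T K where T: "finite T" "T \<subseteq> topspace X"
    and K: "\<And>t. t \<in> T \<Longrightarrow> closedin X (K t) \<and> K t \<subseteq> V t"
    and cover: "topspace X \<subseteq> (\<Union>t\<in>T. X interior_of K t)"
    by metis
  have cover': "topspace X \<subseteq> (\<Union>t\<in>T. K t)"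
  proof
    fix x assume "x \<in> topspace X"
    then obtain t where "t \<in> T" "x \<in> X interior_of K t" using cover by blast
    then show "x \<in> (\<Union>t\<in>T. K t)" using interior_of_subset[of X "K t"] by blast
  qed
  obtain W where W: "cover_family X W" "\<And>xs. nb X W xs \<noteq> {} \<Longrightarrow> \<exists>t\<in>T. set xs \<subseteq> K t"
    using star_refinement[of T X K, OF T(1) _ cover'] K by metis
  have "T \<noteq> {}" using cover X(4) by blast
  obtain v where v: "invariant (2 * card (K ` T)) v"
    "\<And>L xs. \<lbrakk>L \<in> K ` T; set xs \<subseteq> L; length xs = Suc (2 * card (K ` T))\<rbrakk>
      \<Longrightarrow> bpow (card (K ` T)) xs = cob v xs"
  proof (rule bpow_local[of "K ` T"])
    show "finite (K ` T)" "K ` T \<noteq> {}" using T \<open>T \<noteq> {}\<close> by auto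
    show "transversal L" if "L \<in> K ` T" for L using that K V T by blast
  qed blast
  define m where "m = card (K ` T)"
  have "bounded_mod m"
    unfolding bounded_mod_def
  proof (intro exI conjI allI impI)
    show "cover_family X W" by (rule W)
    show "int p dvd bpow m xs - cob v xs"
      if xs: "set xs \<subseteq> topspace X \<and> length xs = Suc (2 * m) \<and> nb X W xs \<noteq> {}" for xs
    proof -
      obtain t where "t \<in> T" "set xs \<subseteq> K t" using W(2) xs by blast
      then show ?thesis using v(2)[of "K t" xs] xs by (simp add: m_def)
    qed
    \<comment> \<open>The \<open>p\<close> terms of the orbit sum of an invariant cochain are
      equal.\<close>
    show "int p dvd orbit_sum v xs" if "set xs \<subseteq> topspace X \<and> length xs = 2 * m \<and> nb X W xs \<noteq> {}" for xs
      using invariant_iter[OF v(1)] that by (simp add: orbit_sum_def m_def)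
  qed
  moreover have "m > 0" unfolding m_def using T \<open>T \<noteq> {}\<close> by (simp add: card_gt_0_iff)
  ultimately have "bounded_mod 1"
  proof (induction m)
    case (Suc m)
    show ?case
    proof (cases "m = 0")
      case True
      then show ?thesis using Suc by simp
    next
      case False
      then show ?thesis using Suc bounded_mod_step[OF X(1,2) coh] by blast
    qed
  qed simp
  then show False using not_bounded_mod_1[OF X coh] by blast
qed

end

section \<open>From an element of finite order to a free cyclic action\<close>

theorem proposition7p10:
  fixes X :: "'x topology" and G :: "'g monoid" and T :: "'g topology"
    and \<phi> :: "'g \<Rightarrow> 'x \<Rightarrow> 'x"
  assumes "topspace X \<noteq> {}" and "connected_space X"
    and "compact_space X" and "Hausdorff_space X"
    and "\<And>(A :: nat monoid) n. \<lbrakk>comm_group A; finite (carrier A); n > 0\<rbrakk>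
      \<Longrightarrow> is_sheaf_cohomology X (constant_sheaf X A) n (singleton_group ())"
    and "profinite_group G T"
    and "continuous_action G T X \<phi>" and "free_action G (topspace X) \<phi>"
  shows "torsion_free_group G"
  unfolding torsion_free_group_def
proof (intro ballI impI)
  fix g assume g: "g \<in> carrier G" and tors: "\<exists>n::nat. n > 0 \<and> g [^]\<^bsub>G\<^esub> n = \<one>\<^bsub>G\<^esub>"
  interpret action: group_action G "topspace X" \<phi>
    using assms(7) by (simp add: continuous_action_def)
  interpret group G using action.group_hom by (simp add: group_hom_def)
  \<comment> \<open>The exact order of \<open>g\<close>, prime or not. By minimality the powers with
    exponent strictly between 0 and \<open>p\<close> are nontrivial, hence fix no point.\<close>
  define p where "p = (LEAST n::nat. n > 0 \<and> g [^]\<^bsub>G\<^esub> n = \<one>\<^bsub>G\<^esub>)"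
  have p: "p > 0" "g [^]\<^bsub>G\<^esub> p = \<one>\<^bsub>G\<^esub>" unfolding p_def using LeastI_ex[OF tors] by auto
  have least: "g [^]\<^bsub>G\<^esub> i \<noteq> \<one>\<^bsub>G\<^esub>" if "0 < i" "i < p" for i
    using not_less_Least[of i "\<lambda>n::nat. n > 0 \<and> g [^]\<^bsub>G\<^esub> n = \<one>\<^bsub>G\<^esub>"] that by (auto simp: p_def)
  have iter: "(\<phi> g ^^ i) x = \<phi> (g [^]\<^bsub>G\<^esub> i) x \<and> \<phi> (g [^]\<^bsub>G\<^esub> i) x \<in> topspace X" if "x \<in> topspace X" for i x
  proof (induction i)
    case 0
    then show ?case using that action.id_eq_one by (metis action.element_image funpow_0 nat_pow_0 one_closed restrict_apply)
  next
    case (Suc i)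
    then show ?case
      using action.composition_rule[OF that g nat_pow_closed[OF g, of i]] action.element_image[OF g]
        nat_pow_Suc2[OF g] by auto
  qed
  show "g = \<one>\<^bsub>G\<^esub>"
  proof (rule ccontr)
    assume "g \<noteq> \<one>\<^bsub>G\<^esub>"
    then have "p \<noteq> 1" using p g by auto
    have "topspace T = carrier G"
      using assms(6) by (simp add: profinite_group_def topological_group_def)
    then have "continuous_map X (prod_topology T X) (\<lambda>x. (g, x))"
      using g by (simp add: continuous_map_pairwise comp_def)
    then have "continuous_map X X ((\<lambda>(g, x). \<phi> g x) \<circ> (\<lambda>x. (g, x)))"
      using assms(7) continuous_map_compose unfolding continuous_action_def by blast
    then have cont: "continuous_map X X (\<phi> g)" by (simp add: comp_def)
    interpret free_cyclic X "\<phi> g" p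
    proof
      show "(\<phi> g ^^ p) x = x" if "x \<in> topspace X" for x
        using iter[OF that, of p] iter[OF that, of 0] p by simp
      show "(\<phi> g ^^ i) x \<noteq> x" if "x \<in> topspace X" "0 < i" "i < p" for x i
        using iter[OF that(1), of i] least[OF that(2,3)] assms(8) nat_pow_closed[OF g, of i] that(1)
        by (auto simp: free_action_def)
    qed (use cont p \<open>p \<noteq> 1\<close> in auto)
    show False
      by (rule not_acyclic[OF assms(3,4,2,1)], rule assms(5)[OF comm_group_zmod])
        (use p in \<open>auto simp: zmod_def\<close>)
  qed
qed

end
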